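(* Let $(M,\varphi,\xi_\alpha,\eta^\alpha,g)$ be a compact, connected and regular Lorentzian $\mathcal{S}$-manifold with $\dim(M)=2n+s$, $s\geqslant1$, with $\xi_1$ timelike. Let $\pi\colon M\to N$ be the principal $\mathbb{T}^s$-bundle over a $2n$-dimensional compact Kähler manifold $(N,J,G)$ obtained by fibrating $M$ by its $s$ characteristic vector fields; $\pi$ is a semi-Riemannian submersion with totally geodesic fibres. Let $p\in M$, and suppose that, for any $x\in S_\varphi((\xi_1)_p)$, $\varphi x$ is an eigenvector of $R_x$. Then $M$ is $\varphi$-null Osserman with respect to $(\xi_1)_p$ if and only if $N$ is Osserman at $p'=\pi(p)$.
   Context: All manifolds are connected; all tensor fields and maps are smooth. Curvature convention: $R(Z,W)Y=([\nabla_Z,\nabla_W]-\nabla_{[Z,W]})Y$, with $\nabla$ the Levi-Civita connection. **Lorentzian $\mathcal{S}$-manifolds.** A globally framed $f$-structure ($g.f.f$-structure) on a manifold $M$ of dimension $2n+s$ consists of a nonvanishing $(1,1)$-tensor field $\varphi$ of constant rank $2n$ with $\varphi^3+\varphi=0$, together with vector fields $\xi_1,\dots,\xi_s$ (characteristic vector fields) spanning $\ker\varphi$ and $1$-forms $\eta^1,\dots,\eta^s$ such that $\varphi^2=-I+\sum_\alpha\eta^\alpha\otimes\xi_\alpha$ and $\eta^\alpha(\xi_\beta)=\delta^\alpha_\beta$. It is normal if $[\varphi,\varphi]+2\sum_\alpha d\eta^\alpha\otimes\xi_\alpha=0$, where $[\varphi,\varphi]$ is the Nijenhuis torsion. A semi-Riemannian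 metric $g$ is compatible if $g(\varphi X,\varphi Y)=g(X,Y)-\sum_\alpha\varepsilon_\alpha\eta^\alpha(X)\eta^\alpha(Y)$, where $\varepsilon_\alpha=g(\xi_\alpha,\xi_\alpha)=\pm1$. Then $TM=\mathrm{Im}(\varphi)\oplus\ker(\varphi)$ orthogonally. An indefinite $\mathcal{S}$-manifold is a normal $g.f.f$-manifold with compatible metric such that $d\eta^\alpha=\Phi$ for all $\alpha$, where $\Phi(X,Y)=g(X,\varphi Y)$; here $2d\eta(X,Y)=X\eta(Y)-Y\eta(X)-\eta([X,Y])$, so that $\nabla_X\xi_\alpha=-\varepsilon_\alpha\varphi X$. It is a Lorentzian $\mathcal{S}$-manifold if $g$ is Lorentzian (signature with exactly one minus sign); then exactly one $\xi_\alpha$ is timelike, and it is labelled $\xi_1$. For $s=1$ it is a Lorentzian Sasakian manifold. Regularity of the structure is meant in the sense of Palais and of Blair–Ludden–Yano (regularity of the foliations generated by the characteristic vector fields). **The bundle.** A known theorem says that a compact, connected and regular indefinite $\mathcal{S}$-manifold $M$ with $s\geqslant2$ is the total space of a principal bundle $\pi\colon M\to N$ with group the $s$-dimensional torus $\mathbb{T}^s$ over a $2n$-dimensional compact Kähler manifold $N$ (possibly indefinite), and that $\pi$ factors as $\pi=\pi'\circ\tau$ through a principal $\mathbb{T}^{s-1}$-bundle $\tau\colon M\to M'$ over a compact regular (possibly indefinite) Sasakian manifold $M'$ of dimension $2n+1$ and a principal $\mathbb{S}^1$-bundle $\pi'\colon M'\to N$; all three maps are semi-Riemannian submersions with totally geodesic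 fibres. By construction the vertical distribution of $\pi$ is $\ker d\pi=\mathrm{span}(\xi_1,\dots,\xi_s)$ and the horizontal one is $\mathrm{Im}(\varphi)$. For $s=1$, $\pi$ is the circle bundle of type $\pi'$, from a compact regular Lorentzian Sasakian manifold to a compact Kähler manifold. **Submersions.** A semi-Riemannian submersion $f\colon(M,g)\to(B,g')$ is a submersion whose fibres are semi-Riemannian submanifolds and such that $(df)_p$ restricted to the horizontal space $\mathcal{H}_p=(\ker (df)_p)^\bot$ is an isometry onto $T_{f(p)}B$, for all $p\in M$. **Osserman conditions.** For a unit (spacelike or timelike) vector $z\in T_pM$, the Jacobi operator is $R_z\colon z^\bot\to z^\bot$, $R_z(y)=R_p(y,z)z$. A Riemannian manifold $N$ is Osserman at $q$ if the eigenvalues of $R_z$ with their multiplicities are independent of the unit vector $z\in T_qN$. On a Lorentzian manifold, for a null vector $u\ne0$ put $\bar u^\bot=u^\bot/\mathrm{span}(u)$ with projection $u^\bot\to\bar u^\bot$, $x\mapsto\bar x$, and positive definite inner product $\bar g(\bar x,\bar y)=g(x,y)$; define $\bar R_u\colon\bar u^\bot\to\bar u^\bot$ by $\bar R_u(\bar x)=\overline{R_p(x,u)u}$ (self-adjoint). For a unit timelike $z\in T_pM$ let $N(z)=\{u\in T_pM: g(u,u)=0,\ g(u,z)=-1\}$ and $S(z)=\{x\in z^\bot: g(x,x)=1\}$; $\psi\colon N(z)\to S(z)$, $\psi(u)=u-z$, is a bijection. Put $S_\varphi((\xi_1)_p)=S((\xi_1)_p)\cap\mathrm{Im}(\varphi_p)$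 and $N_\varphi((\xi_1)_p)=\psi^{-1}(S_\varphi((\xi_1)_p))$; $M$ is $\varphi$-null Osserman with respect to $(\xi_1)_p$ if the eigenvalues of $\bar R_u$ with multiplicities are independent of $u\in N_\varphi((\xi_1)_p)$. *)

theory Defs
  imports "HOL-Analysis.Analysis"
begin

section \<open>Smooth manifolds\<close>

primrec Ck_on :: "nat \<Rightarrow> 'a::euclidean_space set \<Rightarrow> ('a \<Rightarrow> 'b::real_normed_vector) \<Rightarrow> bool" where
  "Ck_on 0 S f \<longleftrightarrow> continuous_on S f"
| "Ck_on (Suc k) S f \<longleftrightarrow>
     (\<forall>x\<in>S. f differentiable (at x)) \<and> (\<forall>v. Ck_on k S (\<lambda>x. frechet_derivative f (at x) v))"

text \<open>Only used for open \<open>S\<close>.\<close>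
definition smooth_on :: "'a::euclidean_space set \<Rightarrow> ('a \<Rightarrow> 'b::real_normed_vector) \<Rightarrow> bool" where
  "smooth_on S f \<longleftrightarrow> (\<forall>k. Ck_on k S f)"

text \<open>A chart \<open>(U, c)\<close> has domain \<open>U\<close>; the values of \<open>c\<close> outside \<open>U\<close> are irrelevant.\<close>
type_synonym ('m, 'e) chart = "'m set \<times> ('m \<Rightarrow> 'e)"
type_synonym ('m, 'e) atlas = "('m, 'e) chart set"

definition chart_image :: "('m, 'e) chart \<Rightarrow> 'e set" where
  "chart_image \<kappa> = snd \<kappa> ` fst \<kappa>"

definition chart_inv :: "('m, 'e) chart \<Rightarrow> 'e \<Rightarrow> 'm" where
  "chart_inv \<kappa> = inv_into (fst \<kappa>) (snd \<kappa>)"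

definition is_chart :: "('m::topological_space, 'e::euclidean_space) chart \<Rightarrow> bool" where
  "is_chart \<kappa> \<longleftrightarrow> open (fst \<kappa>) \<and> open (chart_image \<kappa>) \<and>
     homeomorphism (fst \<kappa>) (chart_image \<kappa>) (snd \<kappa>) (chart_inv \<kappa>)"

definition compatible ::
  "('m::topological_space, 'e::euclidean_space) chart \<Rightarrow> ('m, 'e) chart \<Rightarrow> bool" where
  "compatible \<kappa> \<kappa>' \<longleftrightarrow>
     smooth_on (snd \<kappa> ` (fst \<kappa> \<inter> fst \<kappa>')) (snd \<kappa>' \<circ> chart_inv \<kappa>) \<and>
     smooth_on (snd \<kappa>' ` (fst \<kappa> \<inter> fst \<kappa>')) (snd \<kappa> \<circ> chart_inv \<kappa>')"

text \<open>A connected smooth manifold of dimension \<open>DIM('e)\<close> with underlying space the type \<open>'m\<close>.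
  The atlas need not be maximal.\<close>
definition smooth_manifold ::
  "('m::{t2_space, second_countable_topology}, 'e::euclidean_space) atlas \<Rightarrow> bool" where
  "smooth_manifold A \<longleftrightarrow> connected (UNIV :: 'm set) \<and> (\<Union>\<kappa>\<in>A. fst \<kappa>) = UNIV \<and>
     (\<forall>\<kappa>\<in>A. is_chart \<kappa>) \<and> (\<forall>\<kappa>\<in>A. \<forall>\<kappa>'\<in>A. compatible \<kappa> \<kappa>')"

definition max_atlas ::
  "('m::topological_space, 'e::euclidean_space) atlas \<Rightarrow> ('m, 'e) atlas" where
  "max_atlas A = {\<kappa>. is_chart \<kappa> \<and> (\<forall>\<kappa>'\<in>A. compatible \<kappa> \<kappa>')}"

definition eucl_atlas :: "('e, 'e) atlas" where
  "eucl_atlas = {(UNIV, \<lambda>x. x)}"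

definition prod_atlas :: "('m, 'e) atlas \<Rightarrow> ('n, 'h) atlas \<Rightarrow> ('m \<times> 'n, 'e \<times> 'h) atlas" where
  "prod_atlas A B = {(fst \<kappa> \<times> fst \<kappa>', map_prod (snd \<kappa>) (snd \<kappa>')) |\<kappa> \<kappa>'. \<kappa> \<in> A \<and> \<kappa>' \<in> B}"

text \<open>Smoothness of \<open>f\<close> on an open subset \<open>S\<close> of a manifold.\<close>
definition smooth_map ::
  "('m::topological_space, 'e::euclidean_space) atlas \<Rightarrow>
   ('n::topological_space, 'h::euclidean_space) atlas \<Rightarrow> 'm set \<Rightarrow> ('m \<Rightarrow> 'n) \<Rightarrow> bool" where
  "smooth_map A B S f \<longleftrightarrow> continuous_on S f \<and>
     (\<forall>\<kappa>\<in>A. \<forall>\<kappa>'\<in>B. smooth_on (snd \<kappa> ` (S \<inter> fst \<kappa> \<inter> f -` fst \<kappa>')) (snd \<kappa>' \<circ> f \<circ> chart_inv \<kappa>))"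

section \<open>Tangent vectors and tensor fields\<close>

text \<open>The tangent space at \<open>p\<close> is the model space \<open>'e\<close>: a tangent vector at \<open>p\<close> is represented by
  its components in a chart \<open>chart_at A p\<close> around \<open>p\<close>, chosen once and for all. The components in
  any other chart \<open>\<kappa>\<close> around \<open>p\<close> are obtained with the derivative of the transition map,
  \<open>to_chart A \<kappa> p\<close>, whose inverse is \<open>from_chart A \<kappa> p\<close>. Accordingly a vector field is a function
  \<open>'m \<Rightarrow> 'e\<close>, a one-form a function \<open>'m \<Rightarrow> 'e \<Rightarrow> real\<close>, a field of endomorphisms a function
  \<open>'m \<Rightarrow> 'e \<Rightarrow> 'e\<close>, and so on.\<close>
definition chart_at :: "('m, 'e) atlas \<Rightarrow> 'm \<Rightarrow> ('m, 'e) chart" where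
  "chart_at A p = (SOME \<kappa>. \<kappa> \<in> A \<and> p \<in> fst \<kappa>)"

definition to_chart ::
  "('m, 'e::euclidean_space) atlas \<Rightarrow> ('m, 'e) chart \<Rightarrow> 'm \<Rightarrow> 'e \<Rightarrow> 'e" where
  "to_chart A \<kappa> p =
     frechet_derivative (snd \<kappa> \<circ> chart_inv (chart_at A p)) (at (snd (chart_at A p) p))"

definition from_chart ::
  "('m, 'e::euclidean_space) atlas \<Rightarrow> ('m, 'e) chart \<Rightarrow> 'm \<Rightarrow> 'e \<Rightarrow> 'e" where
  "from_chart A \<kappa> p = frechet_derivative (snd (chart_at A p) \<circ> chart_inv \<kappa>) (at (snd \<kappa> p))"

definition tangent_map ::
  "('m, 'e::euclidean_space) atlas \<Rightarrow> ('n, 'h::euclidean_space) atlas \<Rightarrow>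
   ('m \<Rightarrow> 'n) \<Rightarrow> 'm \<Rightarrow> 'e \<Rightarrow> 'h" where
  "tangent_map A B f p =
     frechet_derivative (snd (chart_at B (f p)) \<circ> f \<circ> chart_inv (chart_at A p))
       (at (snd (chart_at A p) p))"

text \<open>Coordinate expressions of tensor fields in a chart, as functions on the image of the chart.\<close>

definition vec_in ::
  "('m, 'e::euclidean_space) atlas \<Rightarrow> ('m, 'e) chart \<Rightarrow> ('m \<Rightarrow> 'e) \<Rightarrow> 'e \<Rightarrow> 'e" where
  "vec_in A \<kappa> X y = to_chart A \<kappa> (chart_inv \<kappa> y) (X (chart_inv \<kappa> y))"

definition form_in ::
  "('m, 'e::euclidean_space) atlas \<Rightarrow> ('m, 'e) chart \<Rightarrow> ('m \<Rightarrow> 'e \<Rightarrow> real) \<Rightarrow> 'e \<Rightarrow> 'e \<Rightarrow> real" where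
  "form_in A \<kappa> \<omega> y v = \<omega> (chart_inv \<kappa> y) (from_chart A \<kappa> (chart_inv \<kappa> y) v)"

definition endo_in ::
  "('m, 'e::euclidean_space) atlas \<Rightarrow> ('m, 'e) chart \<Rightarrow> ('m \<Rightarrow> 'e \<Rightarrow> 'e) \<Rightarrow> 'e \<Rightarrow> 'e \<Rightarrow> 'e" where
  "endo_in A \<kappa> T y v =
     to_chart A \<kappa> (chart_inv \<kappa> y) (T (chart_inv \<kappa> y) (from_chart A \<kappa> (chart_inv \<kappa> y) v))"

definition bil_in ::
  "('m, 'e::euclidean_space) atlas \<Rightarrow> ('m, 'e) chart \<Rightarrow> ('m \<Rightarrow> 'e \<Rightarrow> 'e \<Rightarrow> real) \<Rightarrow>
   'e \<Rightarrow> 'e \<Rightarrow> 'e \<Rightarrow> real" where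
  "bil_in A \<kappa> g y v w =
     g (chart_inv \<kappa> y) (from_chart A \<kappa> (chart_inv \<kappa> y) v) (from_chart A \<kappa> (chart_inv \<kappa> y) w)"

definition vector_field :: "('m, 'e::euclidean_space) atlas \<Rightarrow> ('m \<Rightarrow> 'e) \<Rightarrow> bool" where
  "vector_field A X \<longleftrightarrow> (\<forall>\<kappa>\<in>A. smooth_on (chart_image \<kappa>) (vec_in A \<kappa> X))"

definition one_form :: "('m, 'e::euclidean_space) atlas \<Rightarrow> ('m \<Rightarrow> 'e \<Rightarrow> real) \<Rightarrow> bool" where
  "one_form A \<omega> \<longleftrightarrow> (\<forall>p. linear (\<omega> p)) \<and>
     (\<forall>\<kappa>\<in>A. \<forall>v. smooth_on (chart_image \<kappa>) (\<lambda>y. form_in A \<kappa> \<omega> y v))"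

definition endo_field :: "('m, 'e::euclidean_space) atlas \<Rightarrow> ('m \<Rightarrow> 'e \<Rightarrow> 'e) \<Rightarrow> bool" where
  "endo_field A T \<longleftrightarrow> (\<forall>p. linear (T p)) \<and>
     (\<forall>\<kappa>\<in>A. \<forall>v. smooth_on (chart_image \<kappa>) (\<lambda>y. endo_in A \<kappa> T y v))"

text \<open>The index of a symmetric bilinear form: the largest dimension of a subspace on which it is
  negative definite.\<close>
definition form_index :: "('e::euclidean_space \<Rightarrow> 'e \<Rightarrow> real) \<Rightarrow> nat" where
  "form_index b = Max {dim W |W. subspace W \<and> (\<forall>w\<in>W. w \<noteq> 0 \<longrightarrow> b w w < 0)}"

definition semi_riemannian_metric ::
  "('m, 'e::euclidean_space) atlas \<Rightarrow> nat \<Rightarrow> ('m \<Rightarrow> 'e \<Rightarrow> 'e \<Rightarrow> real) \<Rightarrow> bool" where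
  "semi_riemannian_metric A \<nu> g \<longleftrightarrow>
     (\<forall>p. bilinear (g p) \<and> (\<forall>v w. g p v w = g p w v) \<and>
          (\<forall>v. (\<forall>w. g p v w = 0) \<longrightarrow> v = 0) \<and> form_index (g p) = \<nu>) \<and>
     (\<forall>\<kappa>\<in>A. \<forall>v w. smooth_on (chart_image \<kappa>) (\<lambda>y. bil_in A \<kappa> g y v w))"

abbreviation lorentzian_metric ::
  "('m, 'e::euclidean_space) atlas \<Rightarrow> ('m \<Rightarrow> 'e \<Rightarrow> 'e \<Rightarrow> real) \<Rightarrow> bool" where
  "lorentzian_metric A g \<equiv> semi_riemannian_metric A 1 g"

abbreviation riemannian_metric ::
  "('m, 'e::euclidean_space) atlas \<Rightarrow> ('m \<Rightarrow> 'e \<Rightarrow> 'e \<Rightarrow> real) \<Rightarrow> bool" where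
  "riemannian_metric A g \<equiv> semi_riemannian_metric A 0 g"

section \<open>Tensor calculus on open subsets of a Euclidean space\<close>

text \<open>The operators below are local; on a manifold they are applied to coordinate expressions in
  charts. Here \<open>X, Y, \<dots>\<close> are vector fields, \<open>T\<close> is a field of endomorphisms, \<open>\<omega>\<close> a one-form,
  \<open>\<Omega>\<close> a two-form and \<open>G\<close> a metric.\<close>

definition lie_bracket :: "('e::euclidean_space \<Rightarrow> 'e) \<Rightarrow> ('e \<Rightarrow> 'e) \<Rightarrow> 'e \<Rightarrow> 'e" where
  "lie_bracket X Y y = frechet_derivative Y (at y) (X y) - frechet_derivative X (at y) (Y y)"

definition nijenhuis ::
  "('e::euclidean_space \<Rightarrow> 'e \<Rightarrow> 'e) \<Rightarrow> ('e \<Rightarrow> 'e) \<Rightarrow> ('e \<Rightarrow> 'e) \<Rightarrow> 'e \<Rightarrow> 'e" where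
  "nijenhuis T X Y y =
     T y (T y (lie_bracket X Y y)) + lie_bracket (\<lambda>z. T z (X z)) (\<lambda>z. T z (Y z)) y
     - T y (lie_bracket (\<lambda>z. T z (X z)) Y y) - T y (lie_bracket X (\<lambda>z. T z (Y z)) y)"

text \<open>The exterior derivative of a one-form, with the convention
  \<open>2 d\<omega>(X,Y) = X \<omega>(Y) - Y \<omega>(X) - \<omega>([X,Y])\<close>.\<close>
definition ext_deriv ::
  "('e::euclidean_space \<Rightarrow> 'e \<Rightarrow> real) \<Rightarrow> ('e \<Rightarrow> 'e) \<Rightarrow> ('e \<Rightarrow> 'e) \<Rightarrow> 'e \<Rightarrow> real" where
  "ext_deriv \<omega> X Y y =
     (frechet_derivative (\<lambda>z. \<omega> z (Y z)) (at y) (X y)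
      - frechet_derivative (\<lambda>z. \<omega> z (X z)) (at y) (Y y) - \<omega> y (lie_bracket X Y y)) / 2"

text \<open>The exterior derivative of a two-form, up to a constant factor.\<close>
definition ext_deriv2 ::
  "('e::euclidean_space \<Rightarrow> 'e \<Rightarrow> 'e \<Rightarrow> real) \<Rightarrow> ('e \<Rightarrow> 'e) \<Rightarrow> ('e \<Rightarrow> 'e) \<Rightarrow> ('e \<Rightarrow> 'e) \<Rightarrow>
   'e \<Rightarrow> real" where
  "ext_deriv2 \<Omega> X Y Z y =
     frechet_derivative (\<lambda>z. \<Omega> z (Y z) (Z z)) (at y) (X y)
     + frechet_derivative (\<lambda>z. \<Omega> z (Z z) (X z)) (at y) (Y y)
     + frechet_derivative (\<lambda>z. \<Omega> z (X z) (Y z)) (at y) (Z y)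
     - \<Omega> y (lie_bracket X Y y) (Z y) - \<Omega> y (lie_bracket Y Z y) (X y)
     - \<Omega> y (lie_bracket Z X y) (Y y)"

text \<open>The Levi-Civita covariant derivative \<open>\<nabla>\<^sub>X Y\<close>, given by the Koszul formula (tested against
  constant vector fields \<open>v\<close>).\<close>
definition levi_civita ::
  "('e::euclidean_space \<Rightarrow> 'e \<Rightarrow> 'e \<Rightarrow> real) \<Rightarrow> ('e \<Rightarrow> 'e) \<Rightarrow> ('e \<Rightarrow> 'e) \<Rightarrow> 'e \<Rightarrow> 'e" where
  "levi_civita G X Y y = (THE w. \<forall>v. 2 * G y w v =
       frechet_derivative (\<lambda>z. G z (Y z) v) (at y) (X y)
     + frechet_derivative (\<lambda>z. G z (X z) v) (at y) (Y y)
     - frechet_derivative (\<lambda>z. G z (X z) (Y z)) (at y) v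
     + G y (lie_bracket X Y y) v - G y (lie_bracket X (\<lambda>_. v) y) (Y y)
     - G y (lie_bracket Y (\<lambda>_. v) y) (X y))"

text \<open>\<open>curvature G Z W Y\<close> is \<open>R(Z,W)Y\<close>.\<close>
definition curvature ::
  "('e::euclidean_space \<Rightarrow> 'e \<Rightarrow> 'e \<Rightarrow> real) \<Rightarrow> ('e \<Rightarrow> 'e) \<Rightarrow> ('e \<Rightarrow> 'e) \<Rightarrow> ('e \<Rightarrow> 'e) \<Rightarrow> 'e \<Rightarrow> 'e" where
  "curvature G Z W Y y =
     levi_civita G Z (levi_civita G W Y) y - levi_civita G W (levi_civita G Z Y) y
     - levi_civita G (lie_bracket Z W) Y y"

text \<open>The curvature tensor at a point, \<open>riem A g p z w y = R\<^sub>p(z,w)y\<close>. By tensoriality, the tangent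
  vectors may be extended by fields with constant components in \<open>chart_at A p\<close>.\<close>
definition riem ::
  "('m, 'e::euclidean_space) atlas \<Rightarrow> ('m \<Rightarrow> 'e \<Rightarrow> 'e \<Rightarrow> real) \<Rightarrow> 'm \<Rightarrow> 'e \<Rightarrow> 'e \<Rightarrow> 'e \<Rightarrow> 'e" where
  "riem A g p z w y =
     curvature (bil_in A (chart_at A p) g) (\<lambda>_. z) (\<lambda>_. w) (\<lambda>_. y) (snd (chart_at A p) p)"

section \<open>Lorentzian S-manifolds\<close>

text \<open>The characteristic vector fields are indexed by a finite type \<open>'s\<close>, so \<open>s = CARD('s) \<ge> 1\<close>.\<close>
definition gff_manifold ::
  "('m::{t2_space, second_countable_topology}, 'e::euclidean_space) atlas \<Rightarrow> nat \<Rightarrow>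
   ('m \<Rightarrow> 'e \<Rightarrow> 'e) \<Rightarrow> ('s::finite \<Rightarrow> 'm \<Rightarrow> 'e) \<Rightarrow> ('s \<Rightarrow> 'm \<Rightarrow> 'e \<Rightarrow> real) \<Rightarrow> bool" where
  "gff_manifold A n \<phi> \<xi> \<eta> \<longleftrightarrow>
     smooth_manifold A \<and> DIM('e) = 2 * n + CARD('s) \<and>
     endo_field A \<phi> \<and> (\<forall>\<alpha>. vector_field A (\<xi> \<alpha>)) \<and> (\<forall>\<alpha>. one_form A (\<eta> \<alpha>)) \<and>
     (\<forall>p. (\<exists>v. \<phi> p v \<noteq> 0) \<and> dim (range (\<phi> p)) = 2 * n \<and>
        (\<forall>v. \<phi> p (\<phi> p (\<phi> p v)) + \<phi> p v = 0) \<and>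
        span (range (\<lambda>\<alpha>. \<xi> \<alpha> p)) = {v. \<phi> p v = 0} \<and>
        (\<forall>v. \<phi> p (\<phi> p v) = - v + (\<Sum>\<alpha>\<in>UNIV. \<eta> \<alpha> p v *\<^sub>R \<xi> \<alpha> p)) \<and>
        (\<forall>\<alpha> \<beta>. \<eta> \<alpha> p (\<xi> \<beta> p) = (if \<alpha> = \<beta> then 1 else 0)))"

definition normal_gff ::
  "('m, 'e::euclidean_space) atlas \<Rightarrow>
   ('m \<Rightarrow> 'e \<Rightarrow> 'e) \<Rightarrow> ('s::finite \<Rightarrow> 'm \<Rightarrow> 'e) \<Rightarrow> ('s \<Rightarrow> 'm \<Rightarrow> 'e \<Rightarrow> real) \<Rightarrow> bool" where
  "normal_gff A \<phi> \<xi> \<eta> \<longleftrightarrow>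
     (\<forall>\<kappa>\<in>A. \<forall>X Y. smooth_on (chart_image \<kappa>) X \<longrightarrow> smooth_on (chart_image \<kappa>) Y \<longrightarrow>
        (\<forall>y\<in>chart_image \<kappa>. nijenhuis (endo_in A \<kappa> \<phi>) X Y y
           + 2 *\<^sub>R (\<Sum>\<alpha>\<in>UNIV. ext_deriv (form_in A \<kappa> (\<eta> \<alpha>)) X Y y *\<^sub>R vec_in A \<kappa> (\<xi> \<alpha>) y) = 0))"

definition compatible_metric ::
  "('m \<Rightarrow> 'e::euclidean_space \<Rightarrow> 'e) \<Rightarrow> ('s::finite \<Rightarrow> 'm \<Rightarrow> 'e) \<Rightarrow> ('s \<Rightarrow> 'm \<Rightarrow> 'e \<Rightarrow> real) \<Rightarrow>
   ('m \<Rightarrow> 'e \<Rightarrow> 'e \<Rightarrow> real) \<Rightarrow> bool" where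
  "compatible_metric \<phi> \<xi> \<eta> g \<longleftrightarrow>
     (\<exists>\<epsilon>::'s \<Rightarrow> real. (\<forall>\<alpha>. \<epsilon> \<alpha> = 1 \<or> \<epsilon> \<alpha> = -1) \<and>
        (\<forall>p. (\<forall>\<alpha>. g p (\<xi> \<alpha> p) (\<xi> \<alpha> p) = \<epsilon> \<alpha>) \<and>
             (\<forall>v w. g p (\<phi> p v) (\<phi> p w) = g p v w - (\<Sum>\<alpha>\<in>UNIV. \<epsilon> \<alpha> * \<eta> \<alpha> p v * \<eta> \<alpha> p w))))"

definition fundamental_form ::
  "('m \<Rightarrow> 'e \<Rightarrow> 'e \<Rightarrow> real) \<Rightarrow> ('m \<Rightarrow> 'e \<Rightarrow> 'e) \<Rightarrow> 'm \<Rightarrow> 'e \<Rightarrow> 'e \<Rightarrow> real" where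
  "fundamental_form g \<phi> p v w = g p v (\<phi> p w)"

text \<open>\<open>\<alpha>\<^sub>1\<close> is the index of the timelike characteristic vector field.\<close>
definition lorentzian_S_manifold ::
  "('m::{t2_space, second_countable_topology}, 'e::euclidean_space) atlas \<Rightarrow> nat \<Rightarrow>
   ('m \<Rightarrow> 'e \<Rightarrow> 'e) \<Rightarrow> ('s::finite \<Rightarrow> 'm \<Rightarrow> 'e) \<Rightarrow> ('s \<Rightarrow> 'm \<Rightarrow> 'e \<Rightarrow> real) \<Rightarrow>
   ('m \<Rightarrow> 'e \<Rightarrow> 'e \<Rightarrow> real) \<Rightarrow> 's \<Rightarrow> bool" where
  "lorentzian_S_manifold A n \<phi> \<xi> \<eta> g \<alpha>\<^sub>1 \<longleftrightarrow>
     gff_manifold A n \<phi> \<xi> \<eta> \<and> normal_gff A \<phi> \<xi> \<eta> \<and>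
     lorentzian_metric A g \<and> compatible_metric \<phi> \<xi> \<eta> g \<and>
     (\<forall>\<alpha>. \<forall>\<kappa>\<in>A. \<forall>X Y. smooth_on (chart_image \<kappa>) X \<longrightarrow> smooth_on (chart_image \<kappa>) Y \<longrightarrow>
        (\<forall>y\<in>chart_image \<kappa>. ext_deriv (form_in A \<kappa> (\<eta> \<alpha>)) X Y y
           = bil_in A \<kappa> (fundamental_form g \<phi>) y (X y) (Y y))) \<and>
     (\<forall>p. g p (\<xi> \<alpha>\<^sub>1 p) (\<xi> \<alpha>\<^sub>1 p) < 0)"

section \<open>Regularity\<close>

text \<open>The leaf through \<open>p\<close> of the foliation with (involutive) tangent distribution \<open>\<Delta>\<close>: all points
  that can be joined to \<open>p\<close> by a smooth curve tangent to \<open>\<Delta>\<close>.\<close>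
definition leaf ::
  "('m::topological_space, 'e::euclidean_space) atlas \<Rightarrow> ('m \<Rightarrow> 'e set) \<Rightarrow> 'm \<Rightarrow> 'm set" where
  "leaf A \<Delta> p = {q. \<exists>\<gamma> S. open S \<and> {0..1} \<subseteq> S \<and> smooth_map eucl_atlas A S (\<gamma> :: real \<Rightarrow> 'm) \<and>
     \<gamma> 0 = p \<and> \<gamma> 1 = q \<and>
     (\<forall>t\<in>{0..1}. vector_derivative (snd (chart_at A (\<gamma> t)) \<circ> \<gamma>) (at t) \<in> \<Delta> (\<gamma> t))}"

text \<open>Palais: every point is the centre of a cubical chart which is flat with respect to the
  foliation (the distribution is spanned by the coordinate fields in the directions \<open>D\<close>, so that the
  slices are given by fixing the remaining coordinates) and in which every leaf meets at most one
  slice.\<close>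
definition regular_foliation ::
  "('m::topological_space, 'e::euclidean_space) atlas \<Rightarrow> ('m \<Rightarrow> 'e set) \<Rightarrow> bool" where
  "regular_foliation A \<Delta> \<longleftrightarrow>
     (\<forall>p. \<exists>\<kappa>\<in>max_atlas A. \<exists>D\<subseteq>Basis. \<exists>a>0. p \<in> fst \<kappa> \<and>
        chart_image \<kappa> = box (snd \<kappa> p - a *\<^sub>R One) (snd \<kappa> p + a *\<^sub>R One) \<and>
        (\<forall>q\<in>fst \<kappa>. to_chart A \<kappa> q ` \<Delta> q = span D) \<and>
        (\<forall>q\<in>fst \<kappa>. \<forall>r\<in>fst \<kappa> \<inter> leaf A \<Delta> q. \<forall>b\<in>Basis - D. snd \<kappa> q \<bullet> b = snd \<kappa> r \<bullet> b))"

definition char_distribution :: "('s::finite \<Rightarrow> 'm \<Rightarrow> 'e::euclidean_space) \<Rightarrow> 'm \<Rightarrow> 'e set" where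
  "char_distribution \<xi> p = span (range (\<lambda>\<alpha>. \<xi> \<alpha> p))"

text \<open>Blair--Ludden--Yano: the characteristic vector fields and the distribution they span are
  regular.\<close>
definition regular_structure ::
  "('m::topological_space, 'e::euclidean_space) atlas \<Rightarrow> ('s::finite \<Rightarrow> 'm \<Rightarrow> 'e) \<Rightarrow> bool" where
  "regular_structure A \<xi> \<longleftrightarrow>
     regular_foliation A (char_distribution \<xi>) \<and> (\<forall>\<alpha>. regular_foliation A (\<lambda>p. span {\<xi> \<alpha> p}))"

section \<open>Kaehler manifolds\<close>

definition kaehler_manifold ::
  "('n::{t2_space, second_countable_topology}, 'h::euclidean_space) atlas \<Rightarrow>
   ('n \<Rightarrow> 'h \<Rightarrow> 'h) \<Rightarrow> ('n \<Rightarrow> 'h \<Rightarrow> 'h \<Rightarrow> real) \<Rightarrow> bool" where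
  "kaehler_manifold B J G \<longleftrightarrow>
     smooth_manifold B \<and> endo_field B J \<and> riemannian_metric B G \<and>
     (\<forall>q v. J q (J q v) = - v) \<and> (\<forall>q v w. G q (J q v) (J q w) = G q v w) \<and>
     (\<forall>\<kappa>\<in>B. \<forall>X Y Z. smooth_on (chart_image \<kappa>) X \<longrightarrow> smooth_on (chart_image \<kappa>) Y \<longrightarrow>
        smooth_on (chart_image \<kappa>) Z \<longrightarrow>
        (\<forall>y\<in>chart_image \<kappa>. nijenhuis (endo_in B \<kappa> J) X Y y = 0 \<and>
           ext_deriv2 (bil_in B \<kappa> (fundamental_form G J)) X Y Z y = 0))"

section \<open>Principal torus bundles and submersions\<close>

text \<open>The torus \<open>\<T>\<^sup>s\<close> is the group of vectors of unit complex numbers, with componentwise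
  multiplication. Smoothness of maps defined on it is expressed via the covering homomorphism
  \<open>torus_exp\<close>, which is a local diffeomorphism.\<close>
definition torus :: "(complex ^ 's::finite) set" where
  "torus = {z. \<forall>k. cmod (z $ k) = 1}"

definition torus_exp :: "real ^ 's::finite \<Rightarrow> complex ^ 's" where
  "torus_exp t = (\<chi> k. cis (t $ k))"

definition principal_torus_bundle ::
  "('m::topological_space, 'e::euclidean_space) atlas \<Rightarrow>
   ('n::topological_space, 'h::euclidean_space) atlas \<Rightarrow>
   ('m \<Rightarrow> 'n) \<Rightarrow> (complex ^ 's::finite \<Rightarrow> 'm \<Rightarrow> 'm) \<Rightarrow> bool" where
  "principal_torus_bundle A B \<pi> act \<longleftrightarrow>
     smooth_map A B UNIV \<pi> \<and> surj \<pi> \<and>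
     (\<forall>x. act 1 x = x) \<and> (\<forall>z\<in>torus. \<forall>w\<in>torus. \<forall>x. act (z * w) x = act z (act w x)) \<and>
     smooth_map (prod_atlas eucl_atlas A) A UNIV (\<lambda>(t, x). act (torus_exp t) x) \<and>
     (\<forall>z\<in>torus. \<forall>x. act z x = x \<longrightarrow> z = 1) \<and>
     (\<forall>x. \<pi> -` {\<pi> x} = (\<lambda>z. act z x) ` torus) \<and>
     (\<forall>q. \<exists>W \<theta>. open W \<and> q \<in> W \<and> smooth_map A eucl_atlas (\<pi> -` W) (\<theta> :: 'm \<Rightarrow> complex ^ 's) \<and>
        (\<forall>z\<in>torus. \<forall>x\<in>\<pi> -` W. \<theta> (act z x) = z * \<theta> x) \<and>
        bij_betw (\<lambda>x. (\<pi> x, \<theta> x)) (\<pi> -` W) (W \<times> torus) \<and>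
        smooth_map (prod_atlas B eucl_atlas) A (W \<times> UNIV)
          (\<lambda>(w, t). inv_into (\<pi> -` W) (\<lambda>x. (\<pi> x, \<theta> x)) (w, torus_exp t)))"

definition vertical ::
  "('m, 'e::euclidean_space) atlas \<Rightarrow> ('n, 'h::euclidean_space) atlas \<Rightarrow> ('m \<Rightarrow> 'n) \<Rightarrow> 'm \<Rightarrow> 'e set"
  where
  "vertical A B f p = {v. tangent_map A B f p v = 0}"

text \<open>The fibres of \<open>\<pi>\<close> are the leaves of the foliation generated by the characteristic vector
  fields.\<close>
definition fibrates_by ::
  "('m::topological_space, 'e::euclidean_space) atlas \<Rightarrow> ('n, 'h::euclidean_space) atlas \<Rightarrow>
   ('m \<Rightarrow> 'n) \<Rightarrow> ('s::finite \<Rightarrow> 'm \<Rightarrow> 'e) \<Rightarrow> bool" where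
  "fibrates_by A B \<pi> \<xi> \<longleftrightarrow>
     (\<forall>p. \<pi> -` {\<pi> p} = leaf A (char_distribution \<xi>) p \<and>
          vertical A B \<pi> p = char_distribution \<xi> p)"

definition horizontal ::
  "('m, 'e::euclidean_space) atlas \<Rightarrow> ('n, 'h::euclidean_space) atlas \<Rightarrow>
   ('m \<Rightarrow> 'e \<Rightarrow> 'e \<Rightarrow> real) \<Rightarrow> ('m \<Rightarrow> 'n) \<Rightarrow> 'm \<Rightarrow> 'e set" where
  "horizontal A B g f p = {v. \<forall>w\<in>vertical A B f p. g p v w = 0}"

text \<open>The fibres of a submersion are automatically submanifolds with tangent spaces the vertical
  spaces; they are semi-Riemannian iff the metric is nondegenerate on the latter.\<close>
definition semi_riemannian_submersion ::
  "('m::topological_space, 'e::euclidean_space) atlas \<Rightarrow>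
   ('n::topological_space, 'h::euclidean_space) atlas \<Rightarrow>
   ('m \<Rightarrow> 'e \<Rightarrow> 'e \<Rightarrow> real) \<Rightarrow> ('n \<Rightarrow> 'h \<Rightarrow> 'h \<Rightarrow> real) \<Rightarrow> ('m \<Rightarrow> 'n) \<Rightarrow> bool" where
  "semi_riemannian_submersion A B g G f \<longleftrightarrow>
     smooth_map A B UNIV f \<and>
     (\<forall>p. surj (tangent_map A B f p) \<and>
        (\<forall>v\<in>vertical A B f p. (\<forall>w\<in>vertical A B f p. g p v w = 0) \<longrightarrow> v = 0) \<and>
        bij_betw (tangent_map A B f p) (horizontal A B g f p) UNIV \<and>
        (\<forall>v\<in>horizontal A B g f p. \<forall>w\<in>horizontal A B g f p.
           G (f p) (tangent_map A B f p v) (tangent_map A B f p w) = g p v w))"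

definition totally_geodesic_fibres ::
  "('m, 'e::euclidean_space) atlas \<Rightarrow> ('n, 'h::euclidean_space) atlas \<Rightarrow>
   ('m \<Rightarrow> 'e \<Rightarrow> 'e \<Rightarrow> real) \<Rightarrow> ('m \<Rightarrow> 'n) \<Rightarrow> bool" where
  "totally_geodesic_fibres A B g f \<longleftrightarrow>
     (\<forall>\<kappa>\<in>A. \<forall>V W. smooth_on (chart_image \<kappa>) V \<longrightarrow> smooth_on (chart_image \<kappa>) W \<longrightarrow>
        (\<forall>q\<in>fst \<kappa>. V (snd \<kappa> q) \<in> to_chart A \<kappa> q ` vertical A B f q) \<longrightarrow>
        (\<forall>q\<in>fst \<kappa>. W (snd \<kappa> q) \<in> to_chart A \<kappa> q ` vertical A B f q) \<longrightarrow>
        (\<forall>q\<in>fst \<kappa>. levi_civita (bil_in A \<kappa> g) V W (snd \<kappa> q)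
           \<in> to_chart A \<kappa> q ` vertical A B f q))"

section \<open>Osserman conditions\<close>

definition orth :: "('m \<Rightarrow> 'e \<Rightarrow> 'e \<Rightarrow> real) \<Rightarrow> 'm \<Rightarrow> 'e \<Rightarrow> 'e set" where
  "orth g p z = {y. g p y z = 0}"

text \<open>The Jacobi operator \<open>R\<^sub>z\<close>, to be considered on \<open>orth g p z\<close>.\<close>
definition jacobi ::
  "('m, 'e::euclidean_space) atlas \<Rightarrow> ('m \<Rightarrow> 'e \<Rightarrow> 'e \<Rightarrow> real) \<Rightarrow> 'm \<Rightarrow> 'e \<Rightarrow> 'e \<Rightarrow> 'e" where
  "jacobi A g p z y = riem A g p y z z"

definition jacobi_eigenvector ::
  "('m, 'e::euclidean_space) atlas \<Rightarrow> ('m \<Rightarrow> 'e \<Rightarrow> 'e \<Rightarrow> real) \<Rightarrow> 'm \<Rightarrow> 'e \<Rightarrow> 'e \<Rightarrow> bool" where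
  "jacobi_eigenvector A g p z v \<longleftrightarrow>
     v \<in> orth g p z \<and> v \<noteq> 0 \<and> (\<exists>\<mu>. jacobi A g p z v = \<mu> *\<^sub>R v)"

text \<open>The operators in both Osserman conditions are self-adjoint with respect to positive definite
  inner products, so their eigenvalues are real and the multiplicity of \<open>\<mu>\<close> is the dimension of its
  eigenspace (\<open>0\<close> if \<open>\<mu>\<close> is not an eigenvalue).\<close>
definition jacobi_mult ::
  "('m, 'e::euclidean_space) atlas \<Rightarrow> ('m \<Rightarrow> 'e \<Rightarrow> 'e \<Rightarrow> real) \<Rightarrow> 'm \<Rightarrow> 'e \<Rightarrow> real \<Rightarrow> nat" where
  "jacobi_mult A g p z \<mu> = dim {y \<in> orth g p z. jacobi A g p z y = \<mu> *\<^sub>R y}"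

definition osserman_at ::
  "('n, 'h::euclidean_space) atlas \<Rightarrow> ('n \<Rightarrow> 'h \<Rightarrow> 'h \<Rightarrow> real) \<Rightarrow> 'n \<Rightarrow> bool" where
  "osserman_at B G q \<longleftrightarrow>
     (\<forall>z z'. G q z z = 1 \<longrightarrow> G q z' z' = 1 \<longrightarrow> (\<forall>\<mu>. jacobi_mult B G q z \<mu> = jacobi_mult B G q z' \<mu>))"

text \<open>For a null vector \<open>u\<close>, the elements of the quotient of \<open>orth g p u\<close> by \<open>span {u}\<close> are
  the cosets \<open>null_class u x\<close>.\<close>
definition null_class :: "'e::euclidean_space \<Rightarrow> 'e \<Rightarrow> 'e set" where
  "null_class u x = {x + w |w. w \<in> span {u}}"

definition null_quotient ::
  "('m \<Rightarrow> 'e::euclidean_space \<Rightarrow> 'e \<Rightarrow> real) \<Rightarrow> 'm \<Rightarrow> 'e \<Rightarrow> 'e set set" where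
  "null_quotient g p u = null_class u ` orth g p u"

definition null_scale :: "'e::euclidean_space \<Rightarrow> real \<Rightarrow> 'e set \<Rightarrow> 'e set" where
  "null_scale u \<mu> C = (\<Union>x\<in>C. null_class u (\<mu> *\<^sub>R x))"

definition null_jacobi ::
  "('m, 'e::euclidean_space) atlas \<Rightarrow> ('m \<Rightarrow> 'e \<Rightarrow> 'e \<Rightarrow> real) \<Rightarrow> 'm \<Rightarrow> 'e \<Rightarrow> 'e set \<Rightarrow> 'e set" where
  "null_jacobi A g p u C = (\<Union>x\<in>C. null_class u (riem A g p x u u))"

text \<open>A subspace of the quotient is a set of cosets; its dimension is that of its preimage (the union
  of the cosets) minus that of \<open>span {u}\<close>.\<close>
definition null_dim :: "'e::euclidean_space \<Rightarrow> 'e set set \<Rightarrow> nat" where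
  "null_dim u \<W> = dim (\<Union>\<W>) - dim (span {u})"

definition null_jacobi_mult ::
  "('m, 'e::euclidean_space) atlas \<Rightarrow> ('m \<Rightarrow> 'e \<Rightarrow> 'e \<Rightarrow> real) \<Rightarrow> 'm \<Rightarrow> 'e \<Rightarrow> real \<Rightarrow> nat" where
  "null_jacobi_mult A g p u \<mu> =
     null_dim u {C \<in> null_quotient g p u. null_jacobi A g p u C = null_scale u \<mu> C}"

definition null_congruence :: "('m \<Rightarrow> 'e::euclidean_space \<Rightarrow> 'e \<Rightarrow> real) \<Rightarrow> 'm \<Rightarrow> 'e \<Rightarrow> 'e set" where
  "null_congruence g p z = {u. g p u u = 0 \<and> g p u z = -1}"

definition celestial_sphere :: "('m \<Rightarrow> 'e::euclidean_space \<Rightarrow> 'e \<Rightarrow> real) \<Rightarrow> 'm \<Rightarrow> 'e \<Rightarrow> 'e set" where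
  "celestial_sphere g p z = {x \<in> orth g p z. g p x x = 1}"

definition phi_sphere ::
  "('m \<Rightarrow> 'e::euclidean_space \<Rightarrow> 'e \<Rightarrow> real) \<Rightarrow> ('m \<Rightarrow> 'e \<Rightarrow> 'e) \<Rightarrow> 'm \<Rightarrow> 'e \<Rightarrow> 'e set" where
  "phi_sphere g \<phi> p z = celestial_sphere g p z \<inter> range (\<phi> p)"

definition phi_null_congruence ::
  "('m \<Rightarrow> 'e::euclidean_space \<Rightarrow> 'e \<Rightarrow> real) \<Rightarrow> ('m \<Rightarrow> 'e \<Rightarrow> 'e) \<Rightarrow> 'm \<Rightarrow> 'e \<Rightarrow> 'e set" where
  "phi_null_congruence g \<phi> p z = {u \<in> null_congruence g p z. u - z \<in> phi_sphere g \<phi> p z}"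

definition phi_null_osserman ::
  "('m, 'e::euclidean_space) atlas \<Rightarrow> ('m \<Rightarrow> 'e \<Rightarrow> 'e \<Rightarrow> real) \<Rightarrow> ('m \<Rightarrow> 'e \<Rightarrow> 'e) \<Rightarrow>
   'm \<Rightarrow> 'e \<Rightarrow> bool" where
  "phi_null_osserman A g \<phi> p z \<longleftrightarrow>
     (\<forall>u\<in>phi_null_congruence g \<phi> p z. \<forall>u'\<in>phi_null_congruence g \<phi> p z. \<forall>\<mu>.
        null_jacobi_mult A g p u \<mu> = null_jacobi_mult A g p u' \<mu>)"

end

theory Submission
  imports Defs
begin

text \<open>Write \<open>x\<close> for a horizontal unit vector at \<open>p\<close> and \<open>u = \<xi>\<^sub>1 + x\<close>. Normality and \<open>d\<eta>\<^sup>\<alpha> = \<Phi>\<close> give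
  \<open>\<nabla>\<^sub>X \<xi>\<^sub>\<alpha> = - \<epsilon>\<^sub>\<alpha> \<phi> X\<close> and hence all curvature terms containing some \<open>\<xi>\<^sub>\<alpha>\<close>. It follows that the null Jacobi
  operator of \<open>u\<close> splits into \<open>I + R\<^sub>x\<close> on the horizontal vectors orthogonal to \<open>x\<close> and an operator on
  \<open>span(\<xi>\<^sub>2,\<dots>,\<xi>\<^sub>s)\<close> which does not depend on \<open>x\<close>. By O'Neill's formula the Jacobi operator of the base at
  \<open>d\<pi>(x)\<close> is \<open>y \<mapsto> R\<^sub>x y + 3 (\<Sum>\<epsilon>\<^sub>\<alpha>) g(y, \<phi> x) \<phi> x\<close>. As \<open>\<phi> x\<close> is an eigenvector of \<open>R\<^sub>x\<close>, the two spectra differ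
  only in the eigenvalue belonging to \<open>\<phi> x\<close>. If either spectrum is constant, this eigenvalue, being a
  continuous function on a connected sphere with finitely many values, is constant as well, and then so is
  the other one.\<close>

section \<open>Calculus\<close>

text \<open>The obstacle is O'Neill's formula. Its usual derivation extends vectors to basic
  horizontal fields, whereas the curvature here is computed from fields with constant components in
  a chart, which are neither horizontal nor projectable. The remedy is to change the connection
  upstairs. Differentiating G(d\<pi> v, d\<pi> w) = g(\<phi> v, \<phi> w) and solving for the
  Hessian of \<pi>, as in the Koszul formula, shows that \<pi> is affine for the torsion-free
  connection whose difference from \<nabla> is \<theta>(v) \<phi> z + \<theta>(z) \<phi> v, where
  \<theta> is the sum of the forms g(-, \<xi>_\<alpha>). The curvature of the base is therefore the
  image of the curvature of that connection, and for horizontal vectors the correction stems from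
  d\<theta>; this is the origin of the factor 3. At a single point everything is linear algebra in
  \<phi>, \<xi>, \<nabla>\<phi> and \<nabla>\<xi>. What analysis has to supply is the symmetry of
  second derivatives, for smoothness given by iterated Frechet derivatives, and the
  differentiability of the Christoffel symbols, which are known only as solutions of linear
  equations.\<close>

abbreviation fd :: "('a::real_normed_vector \<Rightarrow> 'b::real_normed_vector) \<Rightarrow> 'a \<Rightarrow> 'a \<Rightarrow> 'b" where
  "fd f y v \<equiv> frechet_derivative f (at y) v"

lemma Ck_on_const: "Ck_on k S (\<lambda>_. c)"
  by (induction k arbitrary: c) auto

lemma smooth_on_const: "smooth_on S (\<lambda>_. c)"
  by (simp add: smooth_on_def Ck_on_const)

lemma smooth_on_differentiable: "smooth_on S f \<Longrightarrow> x \<in> S \<Longrightarrow> f differentiable (at x)"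
  unfolding smooth_on_def by (metis Ck_on.simps(2))

lemma smooth_on_fd: "smooth_on S f \<Longrightarrow> smooth_on S (\<lambda>x. fd f x v)"
  unfolding smooth_on_def by (metis Ck_on.simps(2))

lemma smooth_on_continuous: "smooth_on S f \<Longrightarrow> continuous_on S f"
  unfolding smooth_on_def by (metis Ck_on.simps(1))

lemma fd_eq: "(f has_derivative f') (at y) \<Longrightarrow> frechet_derivative f (at y) = f'"
  using frechet_derivative_at by metis

lemma differentiable_has_fd: "f differentiable (at y) \<Longrightarrow> (f has_derivative frechet_derivative f (at y)) (at y)"
  using frechet_derivative_works by blast

lemma has_derivative_cong_open:
  assumes "open U" "y \<in> U" "\<And>z. z \<in> U \<Longrightarrow> f z = g z"
  shows "(f has_derivative f') (at y) \<longleftrightarrow> (g has_derivative f') (at y)"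
proof
  show "(g has_derivative f') (at y)" if "(f has_derivative f') (at y)"
    by (rule has_derivative_transform_within_open[OF that assms])
  show "(f has_derivative f') (at y)" if "(g has_derivative f') (at y)"
    by (rule has_derivative_transform_within_open[OF that assms(1,2)]) (simp add: assms(3))
qed

lemma fd_cong_open:
  assumes "open U" "y \<in> U" "\<And>z. z \<in> U \<Longrightarrow> f z = g z"
  shows "frechet_derivative f (at y) = frechet_derivative g (at y)"
  unfolding frechet_derivative_def using has_derivative_cong_open[OF assms] by simp

lemma differentiable_cong_open:
  assumes "open U" "y \<in> U" "\<And>z. z \<in> U \<Longrightarrow> f z = g z"
  shows "f differentiable (at y) \<longleftrightarrow> g differentiable (at y)"
  unfolding differentiable_def using has_derivative_cong_open[OF assms] by simp

lemma fd_add: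
  assumes "f differentiable (at y)" "g differentiable (at y)"
  shows "fd (\<lambda>z. f z + g z) y v = fd f y v + fd g y v"
  by (rule fd_eq[OF has_derivative_add, THEN fun_cong]; rule differentiable_has_fd; rule assms)

lemma fd_diff:
  assumes "f differentiable (at y)" "g differentiable (at y)"
  shows "fd (\<lambda>z. f z - g z) y v = fd f y v - fd g y v"
  by (rule fd_eq[OF has_derivative_diff, THEN fun_cong]; rule differentiable_has_fd; rule assms)

lemma fd_scaleR_const:
  assumes "f differentiable (at y)"
  shows "fd (\<lambda>z. c *\<^sub>R f z) y v = c *\<^sub>R fd f y v"
  by (rule fd_eq[OF has_derivative_scaleR_right, THEN fun_cong]; rule differentiable_has_fd; rule assms)

lemma fd_mult_const:
  fixes f :: "'a::real_normed_vector \<Rightarrow> real"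
  assumes "f differentiable (at y)"
  shows "fd (\<lambda>z. c * f z) y v = c * fd f y v"
  using fd_scaleR_const[OF assms] by simp

lemma fd_sum:
  assumes "\<And>i. i \<in> I \<Longrightarrow> f i differentiable (at y)"
  shows "fd (\<lambda>z. \<Sum>i\<in>I. f i z) y v = (\<Sum>i\<in>I. fd (f i) y v)"
  by (rule fd_eq[OF has_derivative_sum, THEN fun_cong]; rule differentiable_has_fd; rule assms)

section \<open>Families of linear maps and product rules\<close>

lemma linear_expand:
  fixes f :: "'a::euclidean_space \<Rightarrow> 'b::real_vector"
  assumes "linear f"
  shows "f x = (\<Sum>b\<in>Basis. (x \<bullet> b) *\<^sub>R f b)"
proof -
  have "f x = f (\<Sum>b\<in>Basis. (x \<bullet> b) *\<^sub>R b)" by (simp add: euclidean_representation)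
  also have "\<dots> = (\<Sum>b\<in>Basis. (x \<bullet> b) *\<^sub>R f b)"
    by (simp add: linear_sum[OF assms] linear_cmul[OF assms])
  finally show ?thesis .
qed

text \<open>The product rule for a tensor field applied to a vector field. A coordinate tensor is
  known only through its values on fixed vectors, so a basis expansion reduces the claim to finitely
  many products of a scalar and a vector. Linearity is asked on \<open>U\<close> alone, because
  coordinate expressions are arbitrary outside the chart image.\<close>

lemma has_derivative_linear_family:
  fixes Q :: "'a::real_normed_vector \<Rightarrow> 'b::euclidean_space \<Rightarrow> 'c::real_normed_vector"
  assumes U: "open U" "y \<in> U" and lin: "\<And>z. z \<in> U \<Longrightarrow> linear (Q z)"
    and dQ: "\<And>b. (\<lambda>z. Q z b) differentiable (at y)" and dX: "X differentiable (at y)"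
  shows "((\<lambda>z. Q z (X z)) has_derivative (\<lambda>v. fd (\<lambda>z. Q z (X y)) y v + Q y (fd X y v))) (at y)"
proof -
  have Q: "((\<lambda>z. Q z b) has_derivative fd (\<lambda>z. Q z b) y) (at y)" for b
    using dQ frechet_derivative_works by blast
  have X: "(X has_derivative fd X y) (at y)"
    using dX frechet_derivative_works by blast
  have 1: "((\<lambda>z. \<Sum>b\<in>Basis. (X z \<bullet> b) *\<^sub>R Q z b) has_derivative
      (\<lambda>v. \<Sum>b\<in>Basis. (X y \<bullet> b) *\<^sub>R fd (\<lambda>z. Q z b) y v + (fd X y v \<bullet> b) *\<^sub>R Q y b)) (at y)"
    by (intro has_derivative_sum has_derivative_scaleR has_derivative_inner_left X Q)
  have "((\<lambda>z. \<Sum>b\<in>Basis. (X y \<bullet> b) *\<^sub>R Q z b) has_derivative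
      (\<lambda>v. \<Sum>b\<in>Basis. (X y \<bullet> b) *\<^sub>R fd (\<lambda>z. Q z b) y v)) (at y)"
    by (intro has_derivative_sum has_derivative_scaleR_right Q)
  then have "((\<lambda>z. Q z (X y)) has_derivative
      (\<lambda>v. \<Sum>b\<in>Basis. (X y \<bullet> b) *\<^sub>R fd (\<lambda>z. Q z b) y v)) (at y)"
    by (rule iffD2[OF has_derivative_cong_open[OF U linear_expand[OF lin]], rotated])
  then have 2: "fd (\<lambda>z. Q z (X y)) y v = (\<Sum>b\<in>Basis. (X y \<bullet> b) *\<^sub>R fd (\<lambda>z. Q z b) y v)" for v
    using fd_eq by metis
  have 3: "Q y w = (\<Sum>b\<in>Basis. (w \<bullet> b) *\<^sub>R Q y b)" for w
    using linear_expand[OF lin[OF U(2)]] .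
  have 4: "(\<lambda>v. \<Sum>b\<in>Basis. (X y \<bullet> b) *\<^sub>R fd (\<lambda>z. Q z b) y v + (fd X y v \<bullet> b) *\<^sub>R Q y b)
      = (\<lambda>v. fd (\<lambda>z. Q z (X y)) y v + Q y (fd X y v))"
    unfolding 2 by (subst (2) 3) (simp add: sum.distrib)
  have "((\<lambda>z. Q z (X z)) has_derivative
      (\<lambda>v. \<Sum>b\<in>Basis. (X y \<bullet> b) *\<^sub>R fd (\<lambda>z. Q z b) y v + (fd X y v \<bullet> b) *\<^sub>R Q y b)) (at y)"
    using 1 by (rule iffD2[OF has_derivative_cong_open[OF U linear_expand[OF lin]], rotated])
  then show ?thesis unfolding 4 .
qed

lemmas fd_linear_family = has_derivative_linear_family[THEN fd_eq, THEN fun_cong]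

lemma differentiable_linear_family:
  fixes Q :: "'a::real_normed_vector \<Rightarrow> 'b::euclidean_space \<Rightarrow> 'c::real_normed_vector"
  assumes "open U" "y \<in> U" "\<And>z. z \<in> U \<Longrightarrow> linear (Q z)"
    and "\<And>b. (\<lambda>z. Q z b) differentiable (at y)" "X differentiable (at y)"
  shows "(\<lambda>z. Q z (X z)) differentiable (at y)"
  using has_derivative_linear_family[OF assms] differentiable_def by blast

lemma continuous_on_linear_family:
  fixes Q :: "'a::topological_space \<Rightarrow> 'b::euclidean_space \<Rightarrow> 'c::real_normed_vector"
  assumes "\<And>z. z \<in> S \<Longrightarrow> linear (Q z)" "\<And>b. continuous_on S (\<lambda>z. Q z b)" "continuous_on S X"
  shows "continuous_on S (\<lambda>z. Q z (X z))"
proof -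
  have "continuous_on S (\<lambda>z. \<Sum>b\<in>Basis. (X z \<bullet> b) *\<^sub>R Q z b)"
    by (intro continuous_intros assms)
  then show ?thesis
    by (rule iffD2[OF continuous_on_cong[OF refl linear_expand[OF assms(1)]], rotated])
qed

section \<open>Symmetry of second derivatives\<close>

lemma mvt_line:
  fixes f :: "'a::real_normed_vector \<Rightarrow> real"
  assumes "h > 0" "\<And>t. 0 \<le> t \<Longrightarrow> t \<le> h \<Longrightarrow> f differentiable (at (z + t *\<^sub>R u))"
  shows "\<exists>t. 0 < t \<and> t < h \<and> f (z + h *\<^sub>R u) - f z = h * fd f (z + t *\<^sub>R u) u"
proof -
  have "((\<lambda>t. f (z + t *\<^sub>R u)) has_derivative (\<lambda>s. fd f (z + t *\<^sub>R u) (s *\<^sub>R u))) (at t)"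
    if "0 \<le> t" "t \<le> h" for t
  proof -
    have 1: "((\<lambda>t. z + t *\<^sub>R u) has_derivative (\<lambda>s. s *\<^sub>R u)) (at t)"
      by (auto intro!: derivative_eq_intros)
    show ?thesis
      by (rule has_derivative_compose[OF 1])
        (use assms(2)[OF that] frechet_derivative_works in blast)
  qed
  note der = this
  have "((\<lambda>t. f (z + t *\<^sub>R u)) has_real_derivative fd f (z + t *\<^sub>R u) u) (at t)"
    if "0 \<le> t" "t \<le> h" for t
  proof -
    have "(\<lambda>s. fd f (z + t *\<^sub>R u) (s *\<^sub>R u)) = (*) (fd f (z + t *\<^sub>R u) u)"
      using linear_cmul[OF linear_frechet_derivative[OF assms(2)[OF that]]] by (auto simp: mult.commute)
    then show ?thesis
      using der[OF that]
      by (simp add: has_field_derivative_def)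
  qed
  from MVT2[OF assms(1) this] show ?thesis by auto
qed

text \<open>Two applications of the mean value theorem: in direction \<open>v\<close> to the
  increment \<open>k\<close> of \<open>f\<close> along \<open>w\<close>, then in direction
  \<open>w\<close> to the derivative of \<open>f\<close> along \<open>v\<close>.\<close>

lemma second_difference:
  fixes f :: "'a::euclidean_space \<Rightarrow> real"
  assumes S: "smooth_on S f" and h: "h > 0"
    and in_S: "\<And>s t. \<lbrakk>0 \<le> s; s \<le> h; 0 \<le> t; t \<le> h\<rbrakk> \<Longrightarrow> x + s *\<^sub>R v + t *\<^sub>R w \<in> S"
  shows "\<exists>s t. 0 < s \<and> s < h \<and> 0 < t \<and> t < h \<and>
    f (x + h *\<^sub>R v + h *\<^sub>R w) - f (x + h *\<^sub>R v) - f (x + h *\<^sub>R w) + f x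
      = h * h * fd (\<lambda>y. fd f y v) (x + s *\<^sub>R v + t *\<^sub>R w) w"
proof -
  have df: "f differentiable (at (x + s *\<^sub>R v + t *\<^sub>R w))" if "0 \<le> s" "s \<le> h" "0 \<le> t" "t \<le> h" for s t
    using smooth_on_differentiable[OF S in_S[OF that]] .
  have dfv: "(\<lambda>y. fd f y v) differentiable (at (x + s *\<^sub>R v + t *\<^sub>R w))"
    if "0 \<le> s" "s \<le> h" "0 \<le> t" "t \<le> h" for s t
    using smooth_on_differentiable[OF smooth_on_fd[OF S] in_S[OF that]] .
  define k where "k y = f (y + h *\<^sub>R w) - f y" for y
  have k': "(k has_derivative (\<lambda>a. fd f (x + s *\<^sub>R v + h *\<^sub>R w) a - fd f (x + s *\<^sub>R v) a)) (at (x + s *\<^sub>R v))"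
    if s: "0 \<le> s" "s \<le> h" for s
  proof -
    have 1: "((\<lambda>y. y + h *\<^sub>R w) has_derivative (\<lambda>a. a)) (at (x + s *\<^sub>R v))"
      by (auto intro!: derivative_eq_intros)
    have "((\<lambda>y. f (y + h *\<^sub>R w)) has_derivative fd f (x + s *\<^sub>R v + h *\<^sub>R w)) (at (x + s *\<^sub>R v))"
      using has_derivative_compose[OF 1, of f "fd f (x + s *\<^sub>R v + h *\<^sub>R w)"] df[OF s, of h] h
        frechet_derivative_works by auto
    moreover have "(f has_derivative fd f (x + s *\<^sub>R v)) (at (x + s *\<^sub>R v))"
      using df[OF s, of 0] h frechet_derivative_works by auto
    ultimately show ?thesis
      unfolding k_def by (rule has_derivative_diff)
  qed
  then have "k differentiable (at (x + s *\<^sub>R v))" if "0 \<le> s" "s \<le> h" for s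
    using that differentiable_def by blast
  from mvt_line[OF h this] obtain s where s: "0 < s" "s < h"
    "k (x + h *\<^sub>R v) - k x = h * fd k (x + s *\<^sub>R v) v" by blast
  have "fd k (x + s *\<^sub>R v) v = fd f (x + s *\<^sub>R v + h *\<^sub>R w) v - fd f (x + s *\<^sub>R v) v"
    using fd_eq[OF k'] s by auto
  moreover obtain t where t: "0 < t" "t < h"
    "fd f (x + s *\<^sub>R v + h *\<^sub>R w) v - fd f (x + s *\<^sub>R v) v
       = h * fd (\<lambda>y. fd f y v) (x + s *\<^sub>R v + t *\<^sub>R w) w"
    using mvt_line[OF h, of "\<lambda>y. fd f y v" "x + s *\<^sub>R v" w] dfv[of s] s by auto
  ultimately show ?thesis
    using s unfolding k_def by (intro exI[of _ s] exI[of _ t]) (auto simp: algebra_simps)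
qed

text \<open>The second difference is symmetric in \<open>v\<close> and \<open>w\<close>, and it
  equals \<open>h * h\<close> times either mixed derivative at a point near \<open>x\<close>.
  Continuity of both then excludes a gap at \<open>x\<close>; \<open>e\<close> is half of the
  supposed gap.\<close>

lemma fd_commute_real:
  fixes f :: "'a::euclidean_space \<Rightarrow> real"
  assumes U: "open U" "x \<in> U" and f: "smooth_on U f"
  shows "fd (\<lambda>y. fd f y v) x w = fd (\<lambda>y. fd f y w) x v"
proof (rule ccontr)
  assume ne: "\<not> ?thesis"
  define a where "a y = fd (\<lambda>y. fd f y v) y w" for y
  define b where "b y = fd (\<lambda>y. fd f y w) y v" for y
  define e where "e = \<bar>a x - b x\<bar> / 2"
  have e: "e > 0" using ne by (simp add: e_def a_def b_def)
  have "continuous_on U a" "continuous_on U b"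
    unfolding a_def b_def by (intro smooth_on_continuous smooth_on_fd f)+
  then have "isCont a x" "isCont b x"
    using U continuous_on_eq_continuous_at by blast+
  then have "\<forall>\<^sub>F y in nhds x. dist (a y) (a x) < e" "\<forall>\<^sub>F y in nhds x. dist (b y) (b x) < e"
    using e tendstoD isCont_def tendsto_at_iff_tendsto_nhds by metis+
  moreover have "\<forall>\<^sub>F y in nhds x. y \<in> U" using U eventually_nhds_in_open by blast
  ultimately have "\<forall>\<^sub>F y in nhds x. dist (a y) (a x) < e \<and> dist (b y) (b x) < e \<and> y \<in> U"
    by eventually_elim auto
  then obtain r where r: "r > 0"
    "\<And>y. dist y x < r \<Longrightarrow> dist (a y) (a x) < e \<and> dist (b y) (b x) < e \<and> y \<in> U"
    by (auto simp: eventually_nhds_metric)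
  \<comment> \<open>With this step the whole parallelogram stays within \<open>r / 2\<close> of
    \<open>x\<close>; the summand 1 avoids a zero denominator.\<close>
  define h where "h = r / (2 * (norm v + norm w + 1))"
  have h: "h > 0" unfolding h_def using r(1)
    by (intro divide_pos_pos mult_pos_pos) (auto intro: add_nonneg_pos)
  have near: "dist (x + s *\<^sub>R v + t *\<^sub>R w) x < r" if "0 \<le> s" "s \<le> h" "0 \<le> t" "t \<le> h" for s t
  proof -
    have "dist (x + s *\<^sub>R v + t *\<^sub>R w) x \<le> s * norm v + t * norm w"
      using norm_triangle_ineq[of "s *\<^sub>R v" "t *\<^sub>R w"] that by (simp add: dist_norm)
    also have "\<dots> \<le> h * norm v + h * norm w"
      using that by (intro add_mono mult_right_mono) auto
    also have "\<dots> \<le> h * (norm v + norm w + 1)"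
      using h by (simp add: algebra_simps)
    also have "\<dots> = r / 2"
    proof -
      have "norm v + norm w + 1 > 0" by (intro add_nonneg_pos) auto
      then show ?thesis unfolding h_def by (simp add: field_simps)
    qed
    finally show ?thesis using r(1) by simp
  qed
  obtain s t where st: "0 < s" "s < h" "0 < t" "t < h"
    "f (x + h *\<^sub>R v + h *\<^sub>R w) - f (x + h *\<^sub>R v) - f (x + h *\<^sub>R w) + f x = h * h * a (x + s *\<^sub>R v + t *\<^sub>R w)"
    using second_difference[OF f h, of x v w] near r(2) unfolding a_def by blast
  have near': "dist (x + t *\<^sub>R w + s *\<^sub>R v) x < r" if "0 \<le> s" "s \<le> h" "0 \<le> t" "t \<le> h" for s t
    using near[OF that] by (simp add: algebra_simps)
  obtain s' t' where st': "0 < s'" "s' < h" "0 < t'" "t' < h"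
    "f (x + h *\<^sub>R w + h *\<^sub>R v) - f (x + h *\<^sub>R w) - f (x + h *\<^sub>R v) + f x = h * h * b (x + t' *\<^sub>R w + s' *\<^sub>R v)"
    using second_difference[OF f h, of x w v] near' r(2) unfolding b_def by blast
  have "a (x + s *\<^sub>R v + t *\<^sub>R w) = b (x + t' *\<^sub>R w + s' *\<^sub>R v)"
    using st(5) st'(5) h by (simp add: algebra_simps)
  moreover have "dist (a (x + s *\<^sub>R v + t *\<^sub>R w)) (a x) < e"
    using near[of s t] st r(2) by auto
  moreover have "dist (b (x + t' *\<^sub>R w + s' *\<^sub>R v)) (b x) < e"
    using near'[of s' t'] st' r(2) by auto
  ultimately show False unfolding e_def dist_real_def by (auto simp: field_simps abs_if split: if_splits)
qed

lemma fd_inner: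
  assumes "f differentiable (at y)"
  shows "fd (\<lambda>z. f z \<bullet> b) y v = fd f y v \<bullet> b"
  by (rule fd_eq[OF has_derivative_inner_left, THEN fun_cong]; rule differentiable_has_fd; rule assms)

lemma Ck_on_inner: "open S \<Longrightarrow> Ck_on k S f \<Longrightarrow> Ck_on k S (\<lambda>z. f z \<bullet> b)"
proof (induction k arbitrary: f)
  case 0
  then show ?case by (auto intro: continuous_intros)
next
  case (Suc k)
  have eq: "fd (\<lambda>z. f z \<bullet> b) y v = fd f y v \<bullet> b" if "y \<in> S" for y v
    using Suc.prems that by (intro fd_inner) auto
  \<comment> \<open>The derivative of the product and the product of the derivative agree only on
    \<open>S\<close>, so the induction hypothesis is carried over by a congruence rule, which holds
    because \<open>S\<close> is open.\<close>
  have *: "Ck_on k S g = Ck_on k S h" if "\<And>y. y \<in> S \<Longrightarrow> g y = h y" for k and g h :: "'a \<Rightarrow> real"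
    using that
  proof (induction k arbitrary: g h)
    case 0 then show ?case by (auto cong: continuous_on_cong)
  next
    case (Suc k)
    have 1: "fd g y v = fd h y v" if "y \<in> S" for y v
      using fd_cong_open[OF \<open>open S\<close> that Suc.prems] by simp
    have "Ck_on k S (\<lambda>y. fd g y v) = Ck_on k S (\<lambda>y. fd h y v)" for v
      by (rule Suc.IH) (use 1 in auto)
    then show ?case
      using differentiable_cong_open[OF \<open>open S\<close> _ Suc.prems] by auto
  qed
  have "Ck_on k S (\<lambda>y. fd f y v \<bullet> b)" for v
    using Suc by auto
  then have "Ck_on k S (\<lambda>y. fd (\<lambda>z. f z \<bullet> b) y v)" for v
    using *[of "\<lambda>y. fd (\<lambda>z. f z \<bullet> b) y v" "\<lambda>y. fd f y v \<bullet> b" k] eq by auto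
  moreover have "(\<lambda>z. f z \<bullet> b) differentiable (at y)" if "y \<in> S" for y
    using Suc.prems that by (auto intro: differentiable_inner)
  ultimately show ?case by simp
qed

lemma fd_commute:
  fixes f :: "'a::euclidean_space \<Rightarrow> 'b::euclidean_space"
  assumes U: "open U" "x \<in> U" and f: "smooth_on U f"
  shows "fd (\<lambda>y. fd f y v) x w = fd (\<lambda>y. fd f y w) x v"
proof (rule euclidean_eqI)
  fix b :: 'b
  have s: "smooth_on U (\<lambda>z. f z \<bullet> b)"
    using f U by (auto simp: smooth_on_def Ck_on_inner)
  have "fd (\<lambda>y. fd f y v) x w \<bullet> b = fd (\<lambda>y. fd (\<lambda>z. f z \<bullet> b) y v) x w" for v w
  proof -
    have "fd (\<lambda>y. fd f y v) x w \<bullet> b = fd (\<lambda>y. fd f y v \<bullet> b) x w"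
      using fd_inner[OF smooth_on_differentiable[OF smooth_on_fd[OF f] U(2)]] by simp
    also have "\<dots> = fd (\<lambda>y. fd (\<lambda>z. f z \<bullet> b) y v) x w"
      by (rule fd_cong_open[OF U, THEN fun_cong])
        (rule fd_inner[OF smooth_on_differentiable[OF f], symmetric])
    finally show ?thesis .
  qed
  then show "fd (\<lambda>y. fd f y v) x w \<bullet> b = fd (\<lambda>y. fd f y w) x v \<bullet> b"
    using fd_commute_real[OF U s] by simp
qed

text \<open>As \<open>e\<close> vanishes at \<open>y\<close>, continuity of the scalar factor is
  enough: the error is \<open>a z\<close> times the remainder of \<open>e\<close> plus
  \<open>a z - a y\<close> times a linear term. This allows a factor to be treated before its own
  differentiability is known.\<close>

lemma differentiable_scaleR_vanishing:
  fixes e :: "'a::real_normed_vector \<Rightarrow> 'b::real_normed_vector" and a :: "'a \<Rightarrow> real"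
  assumes a: "isCont a y" and e: "(e has_derivative e') (at y)" and e0: "e y = 0"
  shows "((\<lambda>z. a z *\<^sub>R e z) has_derivative (\<lambda>v. a y *\<^sub>R e' v)) (at y)"
proof -
  have bl: "bounded_linear e'" using e has_derivative_bounded_linear by blast
  then obtain K where K: "\<And>v. norm (e' v) \<le> norm v * K" "K > 0"
    using bounded_linear.pos_bounded by blast
  have lim: "((\<lambda>z. norm (e z - e' (z - y)) / norm (z - y)) \<longlongrightarrow> 0) (at y)"
    using e e0 by (simp add: has_derivative_iff_norm)
  have la: "((\<lambda>z. \<bar>a z\<bar>) \<longlongrightarrow> \<bar>a y\<bar>) (at y)"
    using a by (simp add: isCont_def tendsto_rabs)
  have la0: "((\<lambda>z. \<bar>a z - a y\<bar>) \<longlongrightarrow> 0) (at y)"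
    using a by (simp add: isCont_def LIM_zero tendsto_rabs_zero)
  have "((\<lambda>z. \<bar>a z\<bar> * (norm (e z - e' (z - y)) / norm (z - y)) + \<bar>a z - a y\<bar> * K) \<longlongrightarrow> \<bar>a y\<bar> * 0 + 0 * K) (at y)"
    by (intro tendsto_intros lim la la0)
  then have L: "((\<lambda>z. \<bar>a z\<bar> * (norm (e z - e' (z - y)) / norm (z - y)) + \<bar>a z - a y\<bar> * K) \<longlongrightarrow> 0) (at y)"
    by simp
  have bound: "norm (a z *\<^sub>R e z - a y *\<^sub>R e y - a y *\<^sub>R e' (z - y)) / norm (z - y)
      \<le> \<bar>a z\<bar> * (norm (e z - e' (z - y)) / norm (z - y)) + \<bar>a z - a y\<bar> * K" if "z \<noteq> y" for z
  proof -
    have "a z *\<^sub>R e z - a y *\<^sub>R e y - a y *\<^sub>R e' (z - y)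
        = a z *\<^sub>R (e z - e' (z - y)) + (a z - a y) *\<^sub>R e' (z - y)"
      using e0 by (simp add: algebra_simps)
    then have "norm (a z *\<^sub>R e z - a y *\<^sub>R e y - a y *\<^sub>R e' (z - y))
        \<le> \<bar>a z\<bar> * norm (e z - e' (z - y)) + \<bar>a z - a y\<bar> * norm (e' (z - y))"
      by (metis norm_scaleR norm_triangle_ineq)
    also have "\<dots> \<le> \<bar>a z\<bar> * norm (e z - e' (z - y)) + \<bar>a z - a y\<bar> * (norm (z - y) * K)"
      by (intro add_left_mono mult_left_mono K) auto
    finally show ?thesis using that by (simp add: field_simps)
  qed
  have "((\<lambda>z. norm (a z *\<^sub>R e z - a y *\<^sub>R e y - a y *\<^sub>R e' (z - y)) / norm (z - y)) \<longlongrightarrow> 0) (at y)"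
    by (rule tendsto_sandwich[OF _ _ tendsto_const L])
      (use bound in \<open>auto simp: eventually_at_filter\<close>)
  then show ?thesis
    using bounded_linear_compose[OF bounded_linear_scaleR_right bl] by (simp add: has_derivative_iff_norm)
qed

text \<open>The solution \<open>h\<close> of a linear equation depends differentiably on the coefficients: with
  \<open>M = (L y)\<inverse>\<close> one has \<open>h z = M (k z - (L z - L y) (h z))\<close>, first used to see that \<open>h\<close> is bounded and
  continuous and then to differentiate.\<close>
lemma differentiable_linear_solution:
  fixes L :: "'a::real_normed_vector \<Rightarrow> 'b::euclidean_space \<Rightarrow> 'b"
  assumes U: "open U" "y \<in> U" and lin: "\<And>z. z \<in> U \<Longrightarrow> linear (L z)"
    and dL: "\<And>b. (\<lambda>z. L z b) differentiable (at y)" and dk: "k differentiable (at y)"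
    and inj: "inj (L y)" and eq: "\<And>z. z \<in> U \<Longrightarrow> L z (h z) = k z"
  shows "h differentiable (at y)"
proof -
  obtain M where M: "linear M" "\<And>v. M (L y v) = v"
    using linear_injective_left_inverse[OF lin[OF U(2)] inj] by (metis comp_apply id_apply)
  define E where "E z v = L z v - L y v" for z v
  have E_sum: "E z v = (\<Sum>b\<in>Basis. (v \<bullet> b) *\<^sub>R E z b)" if "z \<in> U" for z v
    unfolding E_def using linear_expand[OF lin[OF that], of v] linear_expand[OF lin[OF U(2)], of v]
    by (simp add: sum_subtractf algebra_simps)
  have h: "h z = M (k z - E z (h z))" if "z \<in> U" for z
  proof -
    have "k z - E z (h z) = L y (h z)" using eq[OF that] by (simp add: E_def)
    then show ?thesis using M(2) by simp
  qed
  obtain c where c: "c > 0" "\<And>v. norm (M v) \<le> norm v * c"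
    using M(1) linear_conv_bounded_linear bounded_linear.pos_bounded by blast
  define s where "s z = (\<Sum>b\<in>Basis. norm (E z b))" for z
  have sE: "norm (E z v) \<le> norm v * s z" if "z \<in> U" for z v
  proof -
    have "norm (E z v) \<le> (\<Sum>b\<in>Basis. norm ((v \<bullet> b) *\<^sub>R E z b))"
      using E_sum[OF that, of v] norm_sum by metis
    also have "\<dots> \<le> (\<Sum>b\<in>Basis. norm v * norm (E z b))"
      by (intro sum_mono) (auto intro!: mult_right_mono Basis_le_norm)
    finally show ?thesis by (simp add: s_def sum_distrib_left)
  qed
  have "(\<lambda>z. L z b) \<midarrow>y\<rightarrow> L y b" for b
    using dL differentiable_imp_continuous_within isCont_def by blast
  then have E0: "(\<lambda>z. E z b) \<midarrow>y\<rightarrow> 0" for b unfolding E_def by (simp add: LIM_zero)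
  have "s \<midarrow>y\<rightarrow> (\<Sum>b\<in>(Basis::'b set). 0)"
    unfolding s_def by (intro tendsto_sum tendsto_norm_zero E0)
  then have s0: "s \<midarrow>y\<rightarrow> 0" by simp
  have kc: "k \<midarrow>y\<rightarrow> k y"
    using dk differentiable_imp_continuous_within isCont_def by blast
  have hy: "h y = M (k y)"
    using h[OF U(2)] by (simp add: E_def)
  have evU: "\<forall>\<^sub>F z in at y. z \<in> U" using U eventually_at_in_open' by blast
  have "\<forall>\<^sub>F z in at y. s z < 1 / (2 * c)"
    using s0 c by (intro order_tendstoD(2)[where y=0]) auto
  moreover have "\<forall>\<^sub>F z in at y. norm (k z) < norm (k y) + 1"
    using tendsto_norm[OF kc] by (rule order_tendstoD(2)) auto
  \<comment> \<open>\<open>h z\<close> occurs on both sides of its equation. The bound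
    \<open>1 / (2 * c)\<close> on \<open>s\<close> makes the coefficient on the right equal to one
    half, so the term can be absorbed on the left.\<close>
  ultimately have hb: "\<forall>\<^sub>F z in at y. norm (h z) \<le> 2 * c * (norm (k y) + 1)"
    using evU
  proof eventually_elim
    case (elim z)
    have "norm (h z) \<le> norm (k z - E z (h z)) * c"
      using h[OF elim(3)] c(2) by metis
    also have "\<dots> \<le> (norm (k z) + norm (h z) * s z) * c"
      using c(1) norm_triangle_ineq4[of "k z" "E z (h z)"] sE[OF elim(3), of "h z"]
      by (intro mult_right_mono) linarith+
    also have "\<dots> \<le> (norm (k y) + 1 + norm (h z) * (1 / (2 * c))) * c"
      using elim c(1) by (intro mult_right_mono add_mono mult_left_mono) auto
    also have "\<dots> = (norm (k y) + 1) * c + norm (h z) / 2"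
      using c(1) by (simp add: field_simps)
    finally show ?case by (simp add: algebra_simps)
  qed
  have "((\<lambda>z. (norm (k z - k y) + 2 * c * (norm (k y) + 1) * s z) * c) \<longlongrightarrow> (norm (k y - k y) + 2 * c * (norm (k y) + 1) * 0) * c) (at y)"
    by (intro tendsto_intros kc s0)
  then have lim: "((\<lambda>z. (norm (k z - k y) + 2 * c * (norm (k y) + 1) * s z) * c) \<longlongrightarrow> 0) (at y)"
    by simp
  have "\<forall>\<^sub>F z in at y. norm (h z - h y) \<le> (norm (k z - k y) + 2 * c * (norm (k y) + 1) * s z) * c"
    using evU hb
  proof eventually_elim
    case (elim z)
    have "M (k z - k y - E z (h z)) = M (k z - E z (h z)) - M (k y)"
      by (simp add: linear_diff[OF M(1)])
    then have "h z - h y = M (k z - k y - E z (h z))"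
      by (simp only: h[OF elim(1), symmetric] hy[symmetric])
    then have "norm (h z - h y) \<le> norm (k z - k y - E z (h z)) * c" using c(2) by metis
    also have "\<dots> \<le> (norm (k z - k y) + norm (h z) * s z) * c"
      using c(1) norm_triangle_ineq4[of "k z - k y" "E z (h z)"] sE[OF elim(1), of "h z"]
      by (intro mult_right_mono) linarith+
    also have "\<dots> \<le> (norm (k z - k y) + 2 * c * (norm (k y) + 1) * s z) * c"
      using elim c(1) by (intro mult_right_mono add_mono mult_right_mono) (auto simp: s_def intro: sum_nonneg)
    finally show ?case .
  qed
  then have "((\<lambda>z. h z - h y) \<longlongrightarrow> 0) (at y)"
    by (rule Lim_null_comparison[OF _ lim])
  then have hc: "isCont h y"
    using LIM_zero_cancel isCont_def by blast
  have dE: "((\<lambda>z. E z b) has_derivative fd (\<lambda>z. L z b) y) (at y)" for b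
    unfolding E_def using has_derivative_diff[OF _ has_derivative_const, of "\<lambda>z. L z b" "fd (\<lambda>z. L z b) y" "at y"]
      dL frechet_derivative_works by fastforce
  \<comment> \<open>Each \<open>E z b\<close> vanishes at \<open>y\<close> and \<open>h\<close> is
    now continuous there, which is the situation of
    \<open>differentiable_scaleR_vanishing\<close>.\<close>
  have "((\<lambda>z. \<Sum>b\<in>Basis. (h z \<bullet> b) *\<^sub>R E z b) has_derivative
      (\<lambda>v. \<Sum>b\<in>Basis. (h y \<bullet> b) *\<^sub>R fd (\<lambda>z. L z b) y v)) (at y)"
    by (intro has_derivative_sum differentiable_scaleR_vanishing dE)
      (auto simp: E_def intro!: continuous_intros hc)
  then have "(\<lambda>z. \<Sum>b\<in>Basis. (h z \<bullet> b) *\<^sub>R E z b) differentiable (at y)"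
    using differentiable_def by blast
  then have "(\<lambda>z. k z - (\<Sum>b\<in>Basis. (h z \<bullet> b) *\<^sub>R E z b)) differentiable (at y)"
    using dk by (intro differentiable_diff)
  then have "(\<lambda>z. M (k z - (\<Sum>b\<in>Basis. (h z \<bullet> b) *\<^sub>R E z b))) differentiable (at y)"
    using bounded_linear.has_derivative[OF M(1)[unfolded linear_conv_bounded_linear]]
    unfolding differentiable_def by blast
  moreover have "h z = M (k z - (\<Sum>b\<in>Basis. (h z \<bullet> b) *\<^sub>R E z b))" if "z \<in> U" for z
    using h[OF that] E_sum[OF that, of "h z"] by simp
  ultimately show ?thesis
    by (rule iffD2[OF differentiable_cong_open[OF U], rotated])
qed

section \<open>Levi-Civita connection and curvature in a chart\<close>

lemma linear_fd_family:
  assumes U: "open U" "y \<in> U" and lin: "\<And>z. z \<in> U \<Longrightarrow> linear (Q z)"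
    and dQ: "\<And>b. (\<lambda>z. Q z b) differentiable (at y)"
  shows "linear (\<lambda>b. fd (\<lambda>z. Q z b) y v)"
proof (rule linearI)
  fix b c r
  have "fd (\<lambda>z. Q z (b + c)) y = fd (\<lambda>z. Q z b + Q z c) y"
    by (rule fd_cong_open[OF U]) (simp add: lin linear_add)
  then show "fd (\<lambda>z. Q z (b + c)) y v = fd (\<lambda>z. Q z b) y v + fd (\<lambda>z. Q z c) y v"
    by (simp add: fd_add[OF dQ dQ])
  have "fd (\<lambda>z. Q z (r *\<^sub>R b)) y = fd (\<lambda>z. r *\<^sub>R Q z b) y"
    by (rule fd_cong_open[OF U]) (simp add: lin linear_cmul)
  then show "fd (\<lambda>z. Q z (r *\<^sub>R b)) y v = r *\<^sub>R fd (\<lambda>z. Q z b) y v"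
    by (simp add: fd_scaleR_const[OF dQ])
qed

lemma differentiable_scaleR_vec:
  fixes f :: "'a::real_normed_vector \<Rightarrow> real"
  shows "f differentiable (at y) \<Longrightarrow> (\<lambda>z. f z *\<^sub>R c) differentiable (at y)"
  unfolding differentiable_def using has_derivative_scaleR_left by blast

text \<open>The vector that represents \<open>b w\<close> in the Euclidean inner product. A bilinear
  form thus becomes an endomorphism, and the theory of injective linear maps applies to indefinite
  forms.\<close>

definition form_map :: "('e::euclidean_space \<Rightarrow> 'e \<Rightarrow> real) \<Rightarrow> 'e \<Rightarrow> 'e" where
  "form_map b w = (\<Sum>e\<in>Basis. b w e *\<^sub>R e)"

lemma form_map_inner:
  assumes "bilinear b" shows "form_map b w \<bullet> v = b w v"
proof -
  have "linear (b w)" using assms by (simp add: bilinear_def)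
  from linear_expand[OF this, of v] show ?thesis
    by (simp add: form_map_def inner_sum_left inner_commute[of v] mult.commute)
qed

lemma linear_form_map:
  fixes b :: "'e::euclidean_space \<Rightarrow> 'e \<Rightarrow> real"
  shows "bilinear b \<Longrightarrow> linear (form_map b)"
  by (intro linearI euclidean_eqI[where 'a='e])
    (simp_all add: form_map_inner bilinear_ladd bilinear_lmul inner_add_left)

lemma inj_form_map:
  fixes b :: "'e::euclidean_space \<Rightarrow> 'e \<Rightarrow> real"
  assumes "bilinear b" "\<And>v. (\<And>w. b v w = 0) \<Longrightarrow> v = 0"
  shows "inj (form_map b)"
  using linear_form_map[OF assms(1)] assms(2) form_map_inner[OF assms(1)]
  by (metis inner_zero_left linear_injective_0)

lemma nondegenerate_representation:
  fixes b :: "'e::euclidean_space \<Rightarrow> 'e \<Rightarrow> real"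
  assumes b: "bilinear b" "\<And>v. (\<And>w. b v w = 0) \<Longrightarrow> v = 0" and k: "linear k"
  shows "\<exists>!w. \<forall>v. b w v = k v"
proof -
  have "surj (form_map b)"
    using linear_injective_imp_surjective[OF linear_form_map[OF b(1)] inj_form_map[OF b]] by simp
  then obtain w where w: "form_map b w = (\<Sum>e\<in>Basis. k e *\<^sub>R e)" by (metis surjD)
  have "b w v = k v" for v
    using form_map_inner[OF b(1), of w v] linear_expand[OF k, of v] unfolding w
    by (simp add: inner_sum_left inner_commute[of v] mult.commute)
  moreover have "w' = w" if "\<forall>v. b w' v = k v" for w'
  proof -
    have "form_map b w' = form_map b w"
      unfolding form_map_def using that \<open>\<And>v. b w v = k v\<close> by simp
    then show ?thesis using inj_form_map[OF b] by (simp add: inj_eq)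
  qed
  ultimately show ?thesis by blast
qed

text \<open>All conditions are confined to the open set \<open>U\<close>: a coordinate metric has no
  meaning outside the chart image, and for a submersion the domain has to be shrunk further.\<close>

locale metric_chart =
  fixes U :: "'e::euclidean_space set" and g :: "'e \<Rightarrow> 'e \<Rightarrow> 'e \<Rightarrow> real"
  assumes open_U: "open U"
    and bilinear_g: "y \<in> U \<Longrightarrow> bilinear (g y)"
    and g_sym: "y \<in> U \<Longrightarrow> g y v w = g y w v"
    and g_nondeg: "y \<in> U \<Longrightarrow> (\<And>w. g y v w = 0) \<Longrightarrow> v = 0"
    and g_smooth: "smooth_on U (\<lambda>y. g y v w)"
begin

lemma linear_g_right: "y \<in> U \<Longrightarrow> linear (g y v)"
  and linear_g_left: "y \<in> U \<Longrightarrow> linear (\<lambda>v. g y v w)"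
  using bilinear_g by (auto simp: bilinear_def)

lemmas g_add_right = linear_add[OF linear_g_right]
  and g_add_left = linear_add[OF linear_g_left]
  and g_diff_right = linear_diff[OF linear_g_right]
  and g_diff_left = linear_diff[OF linear_g_left]
  and g_neg_right = linear_neg[OF linear_g_right]
  and g_neg_left = linear_neg[OF linear_g_left]
  and g_zero_right = linear_0[OF linear_g_right]
  and g_zero_left = linear_0[OF linear_g_left]
  and g_scale_right = linear_cmul[OF linear_g_right, unfolded real_scaleR_def]
  and g_scale_left = linear_cmul[OF linear_g_left, unfolded real_scaleR_def]

lemmas g_linear = g_add_right g_add_left g_diff_right g_diff_left g_neg_right g_neg_left
  g_zero_right g_zero_left g_scale_right g_scale_left

lemma g_eqI: "y \<in> U \<Longrightarrow> (\<And>w. g y v w = g y v' w) \<Longrightarrow> v = v'"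
  using g_nondeg[of y "v - v'"] by (simp add: g_diff_left)

lemma g_differentiable: "y \<in> U \<Longrightarrow> (\<lambda>y. g y v w) differentiable (at y)"
  using smooth_on_differentiable[OF g_smooth] .

lemma linear_dg_left: "y \<in> U \<Longrightarrow> linear (\<lambda>v. fd (\<lambda>z. g z v w) y u)"
  by (rule linear_fd_family[OF open_U]) (auto simp: linear_g_left g_differentiable)

lemma linear_dg_right: "y \<in> U \<Longrightarrow> linear (\<lambda>w. fd (\<lambda>z. g z v w) y u)"
  by (rule linear_fd_family[OF open_U]) (auto simp: linear_g_right g_differentiable)

lemma linear_dg: "y \<in> U \<Longrightarrow> linear (fd (\<lambda>z. g z v w) y)"
  by (rule linear_frechet_derivative[OF g_differentiable])

lemma dg_sym: "y \<in> U \<Longrightarrow> fd (\<lambda>z. g z v w) y = fd (\<lambda>z. g z w v) y"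
  by (rule fd_cong_open[OF open_U]) (auto simp: g_sym)

text \<open>The right-hand side of the Koszul formula for constant fields, whose brackets vanish.
  The Christoffel symbols are the vectors representing half of it.\<close>

definition koszul :: "'e \<Rightarrow> 'e \<Rightarrow> 'e \<Rightarrow> 'e \<Rightarrow> real" where
  "koszul y v w u = fd (\<lambda>z. g z w u) y v + fd (\<lambda>z. g z v u) y w - fd (\<lambda>z. g z v w) y u"

definition christoffel :: "'e \<Rightarrow> 'e \<Rightarrow> 'e \<Rightarrow> 'e" where
  "christoffel y v w = (THE c. \<forall>u. g y c u = koszul y v w u / 2)"

lemma linear_koszul:
  assumes "y \<in> U"
  shows "linear (koszul y v w)" "linear (\<lambda>w. koszul y v w u)" "linear (\<lambda>v. koszul y v w u)"
  unfolding koszul_def using linear_dg_left linear_dg_right linear_dg assms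
  by (auto intro!: linear_compose_add linear_compose_sub)

lemma koszul_representation:
  assumes "y \<in> U" shows "\<exists>!c. \<forall>u. g y c u = koszul y v w u / 2"
proof -
  have "linear (\<lambda>u. koszul y v w u / 2)"
    using linear_compose_scale_right[OF linear_koszul(1)[OF assms], of "1/2"] by simp
  from nondegenerate_representation[OF bilinear_g[OF assms] g_nondeg[OF assms] this]
  show ?thesis by blast
qed

lemma g_christoffel:
  assumes "y \<in> U" shows "2 * g y (christoffel y v w) u = koszul y v w u"
  using theI'[OF koszul_representation[OF assms]] unfolding christoffel_def by (metis field_sum_of_halves mult_2)

lemma christoffel_unique:
  assumes "y \<in> U" "\<And>u. 2 * g y c u = koszul y v w u" shows "christoffel y v w = c"
  by (rule g_eqI[OF assms(1)]) (use g_christoffel[OF assms(1)] assms(2) in \<open>metis mult_cancel_left zero_neq_numeral\<close>)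

lemma christoffel_sym: "y \<in> U \<Longrightarrow> christoffel y v w = christoffel y w v"
  by (rule christoffel_unique) (auto simp: g_christoffel koszul_def dg_sym)

lemma linear_christoffel_right:
  assumes y: "y \<in> U" shows "linear (christoffel y v)"
proof (rule linearI; rule christoffel_unique[OF y])
  fix b c u r
  show "2 * g y (christoffel y v b + christoffel y v c) u = koszul y v (b + c) u"
    using linear_add[OF linear_koszul(2)[OF y]] g_christoffel[OF y] by (simp add: g_add_left[OF y] distrib_left)
  show "2 * g y (r *\<^sub>R christoffel y v b) u = koszul y v (r *\<^sub>R b) u"
    using linear_cmul[OF linear_koszul(2)[OF y]] g_christoffel[OF y] by (simp add: g_scale_left[OF y] mult.left_commute)
qed

lemma linear_christoffel_left: "y \<in> U \<Longrightarrow> linear (\<lambda>v. christoffel y v w)"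
  using linear_christoffel_right[of y w] christoffel_sym[of y w] by (metis (no_types, lifting) ext)

lemmas christoffel_linear = linear_add[OF linear_christoffel_right] linear_add[OF linear_christoffel_left]
  linear_diff[OF linear_christoffel_right] linear_diff[OF linear_christoffel_left]
  linear_neg[OF linear_christoffel_right] linear_neg[OF linear_christoffel_left]
  linear_0[OF linear_christoffel_right] linear_0[OF linear_christoffel_left]
  linear_cmul[OF linear_christoffel_right] linear_cmul[OF linear_christoffel_left]

lemma dg_christoffel:
  assumes "y \<in> U"
  shows "fd (\<lambda>z. g z v w) y u = g y (christoffel y u v) w + g y v (christoffel y u w)"
  using g_christoffel[OF assms, of u v w] g_christoffel[OF assms, of u w v] g_sym[OF assms]
    dg_sym[OF assms, of w v] dg_sym[OF assms, of v u] dg_sym[OF assms, of w u]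
  by (simp add: koszul_def)

text \<open>The symbols are given by a description, so their regularity has to come from the linear
  system they solve, whose matrix is \<open>form_map (g z)\<close>. One derivative is all that the
  curvature contains.\<close>

lemma christoffel_differentiable:
  assumes y: "y \<in> U" shows "(\<lambda>y. christoffel y v w) differentiable (at y)"
proof (rule differentiable_linear_solution[OF open_U y, where L = "\<lambda>z. form_map (g z)"
      and k = "\<lambda>z. \<Sum>e\<in>Basis. (koszul z v w e / 2) *\<^sub>R e"])
  show "linear (form_map (g z))" if "z \<in> U" for z
    using linear_form_map bilinear_g that by blast
  show "(\<lambda>z. form_map (g z) b) differentiable (at y)" for b
    unfolding form_map_def
    by (intro differentiable_sum ballI differentiable_scaleR_vec g_differentiable y) auto
  have "(\<lambda>z. koszul z v w e) differentiable (at y)" for e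
    unfolding koszul_def
    by (intro differentiable_add differentiable_diff smooth_on_differentiable[OF smooth_on_fd y] g_smooth)
  then show "(\<lambda>z. \<Sum>e\<in>Basis. (koszul z v w e / 2) *\<^sub>R e) differentiable (at y)"
    by (intro differentiable_sum ballI differentiable_scaleR_vec differentiable_divide) auto
  show "inj (form_map (g y))"
    using inj_form_map bilinear_g g_nondeg y by metis
  show "form_map (g z) (christoffel z v w) = (\<Sum>e\<in>Basis. (koszul z v w e / 2) *\<^sub>R e)" if "z \<in> U" for z
    unfolding form_map_def using g_christoffel[OF that, of v w, symmetric] by (intro sum.cong) auto
qed

section \<open>The covariant derivative of a field\<close>

definition cov :: "'e \<Rightarrow> ('e \<Rightarrow> 'e) \<Rightarrow> 'e \<Rightarrow> 'e" where
  "cov v X y = fd X y v + christoffel y v (X y)"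

lemma differentiable_g_field_left:
  "y \<in> U \<Longrightarrow> X differentiable (at y) \<Longrightarrow> (\<lambda>z. g z (X z) w) differentiable (at y)"
  by (rule differentiable_linear_family[OF open_U]) (auto simp: linear_g_left g_differentiable)

lemma fd_g_field_left:
  assumes y: "y \<in> U" and X: "X differentiable (at y)"
  shows "fd (\<lambda>z. g z (X z) w) y u = fd (\<lambda>z. g z (X y) w) y u + g y (fd X y u) w"
  by (rule fd_linear_family[OF open_U y _ _ X, where Q = "\<lambda>z v. g z v w"])
    (auto simp: linear_g_left g_differentiable y)

lemma fd_g_field_right:
  assumes y: "y \<in> U" and X: "X differentiable (at y)"
  shows "fd (\<lambda>z. g z w (X z)) y u = fd (\<lambda>z. g z w (X y)) y u + g y w (fd X y u)"
  by (rule fd_linear_family[OF open_U y _ _ X, where Q = "\<lambda>z v. g z w v"])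
    (auto simp: linear_g_right g_differentiable y)

lemma fd_g_fields:
  assumes y: "y \<in> U" and X: "X differentiable (at y)" and Y: "Y differentiable (at y)"
  shows "fd (\<lambda>z. g z (X z) (Y z)) y u = g y (cov u X y) (Y y) + g y (X y) (cov u Y y)"
proof -
  have "fd (\<lambda>z. g z (X z) (Y z)) y u = fd (\<lambda>z. g z (X z) (Y y)) y u + g y (X y) (fd Y y u)"
    by (rule fd_linear_family[OF open_U y _ _ Y, where Q = "\<lambda>z v. g z (X z) v"])
      (auto simp: linear_g_right differentiable_g_field_left X y)
  then show ?thesis
    by (simp add: fd_g_field_left[OF y X] dg_christoffel[OF y] cov_def g_linear[OF y])
qed

text \<open>The derivatives of \<open>Y\<close> along \<open>v\<close> cancel against a bracket
  term, and two copies of \<open>fd Y y x\<close> remain besides the Koszul expression. Constant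
  first arguments suffice, since \<open>riem\<close> extends tangent vectors by constants.\<close>

lemma levi_civita_const:
  assumes y: "y \<in> U" and Y: "Y differentiable (at y)"
  shows "levi_civita g (\<lambda>_. x) Y y = cov x Y y"
proof -
  let ?rhs = "\<lambda>v. fd (\<lambda>z. g z (Y z) v) y x + fd (\<lambda>z. g z x v) y (Y y)
     - fd (\<lambda>z. g z x (Y z)) y v
     + g y (lie_bracket (\<lambda>_. x) Y y) v - g y (lie_bracket (\<lambda>_. x) (\<lambda>_. v) y) (Y y)
     - g y (lie_bracket Y (\<lambda>_. v) y) x"
  have "?rhs v = koszul y x (Y y) v + 2 * g y (fd Y y x) v" for v
    using g_sym[OF y, of "fd Y y v" x]
    by (simp add: lie_bracket_def fd_g_field_left[OF y Y] fd_g_field_right[OF y Y] koszul_def g_linear[OF y])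
  then have *: "?rhs v = 2 * g y (cov x Y y) v" for v
    by (simp add: cov_def g_add_left[OF y] g_christoffel[OF y] distrib_left)
  have "(THE w. \<forall>v. 2 * g y w v = ?rhs v) = cov x Y y"
    unfolding * using g_eqI[OF y] by (intro the_equality) auto
  then show ?thesis unfolding levi_civita_def by simp
qed

section \<open>The curvature tensor and its symmetries\<close>

definition curv :: "'e \<Rightarrow> 'e \<Rightarrow> 'e \<Rightarrow> 'e \<Rightarrow> 'e" where
  "curv y z w v = fd (\<lambda>x. christoffel x w v) y z + christoffel y z (christoffel y w v)
     - fd (\<lambda>x. christoffel x z v) y w - christoffel y w (christoffel y z v)"

lemma curvature_const:
  assumes y: "y \<in> U"
  shows "curvature g (\<lambda>_. z) (\<lambda>_. w) (\<lambda>_. v) y = curv y z w v"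
proof -
  have 1: "levi_civita g (\<lambda>_. w) (\<lambda>_. v) x = christoffel x w v" if "x \<in> U" for w x
    using levi_civita_const[OF that, of "\<lambda>_. v" w] by (simp add: cov_def)
  have d: "levi_civita g (\<lambda>_. w) (\<lambda>_. v) differentiable (at y)" for w
    by (rule iffD2[OF differentiable_cong_open[OF open_U y 1], rotated]) (rule christoffel_differentiable[OF y])
  have "fd (levi_civita g (\<lambda>_. w) (\<lambda>_. v)) y = fd (\<lambda>x. christoffel x w v) y" for w
    by (rule fd_cong_open[OF open_U y 1])
  then have "levi_civita g (\<lambda>_. z) (levi_civita g (\<lambda>_. w) (\<lambda>_. v)) y
      = fd (\<lambda>x. christoffel x w v) y z + christoffel y z (christoffel y w v)" for z w
    using levi_civita_const[OF y d] 1[OF y] by (simp add: cov_def)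
  moreover have "lie_bracket (\<lambda>_. z) (\<lambda>_. w) = (\<lambda>_. 0)"
    by (auto simp: lie_bracket_def)
  ultimately show ?thesis
    using 1[OF y] christoffel_linear[OF y] by (simp add: curvature_def curv_def)
qed

lemma linear_dchristoffel:
  assumes y: "y \<in> U"
  shows "linear (\<lambda>v. fd (\<lambda>x. christoffel x w v) y z)" "linear (\<lambda>w. fd (\<lambda>x. christoffel x w v) y z)"
    "linear (\<lambda>z. fd (\<lambda>x. christoffel x w v) y z)"
  by (rule linear_fd_family[OF open_U y])
    (auto simp: linear_christoffel_right linear_christoffel_left christoffel_differentiable y
      intro: linear_fd_family[OF open_U y] linear_frechet_derivative)

lemma linear_curv:
  assumes y: "y \<in> U"
  shows "linear (\<lambda>v. curv y z w v)" "linear (\<lambda>w. curv y z w v)" "linear (\<lambda>z. curv y z w v)"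
  unfolding curv_def
  by (intro linear_compose_add linear_compose_sub linear_dchristoffel y
      linear_compose[OF _ linear_christoffel_right[OF y], unfolded o_def]
      linear_christoffel_right linear_christoffel_left
      linear_compose[OF linear_christoffel_right[OF y] linear_christoffel_right[OF y], unfolded o_def]
      linear_compose[OF linear_christoffel_left[OF y] linear_christoffel_right[OF y], unfolded o_def])+

lemma curv_skew: "curv y z w v = - curv y w z v"
  by (simp add: curv_def)

lemma dchristoffel_sym: "y \<in> U \<Longrightarrow> fd (\<lambda>x. christoffel x w v) y = fd (\<lambda>x. christoffel x v w) y"
  by (rule fd_cong_open[OF open_U]) (auto simp: christoffel_sym)

lemma curv_bianchi:
  assumes y: "y \<in> U" shows "curv y z w v + curv y w v z + curv y v z w = 0"
  using dchristoffel_sym[OF y] christoffel_sym[OF y] by (simp add: curv_def)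

text \<open>Second derivatives of \<open>X\<close> commute and the terms with a first derivative of
  \<open>X\<close> are symmetric in \<open>z\<close> and \<open>w\<close>, so only the value of
  \<open>X\<close> survives. Applied to a characteristic field, whose covariant derivative is
  explicit, it yields the curvature on that field.\<close>

lemma ricci_identity:
  assumes y: "y \<in> U" and X: "smooth_on U X"
  shows "cov z (\<lambda>x. cov w X x) y - cov w (\<lambda>x. cov z X x) y = curv y z w (X y)"
proof -
  note dX = smooth_on_differentiable[OF X y] smooth_on_differentiable[OF smooth_on_fd[OF X] y]
  have "(\<lambda>x. christoffel x w (X x)) differentiable (at y)" for w
    by (rule differentiable_linear_family[OF open_U y])
     (auto simp: linear_christoffel_right christoffel_differentiable y dX)
  moreover have "fd (\<lambda>x. christoffel x w (X x)) y z = fd (\<lambda>x. christoffel x w (X y)) y z + christoffel y w (fd X y z)" for w z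
    by (rule fd_linear_family[OF open_U y])
     (auto simp: linear_christoffel_right christoffel_differentiable y dX)
  ultimately have "cov z (\<lambda>x. cov w X x) y = fd (\<lambda>x. fd X x w) y z
     + (fd (\<lambda>x. christoffel x w (X y)) y z + christoffel y w (fd X y z))
     + christoffel y z (fd X y w) + christoffel y z (christoffel y w (X y))" for z w
    unfolding cov_def[of z] cov_def[of w]
    by (simp add: fd_add dX christoffel_linear[OF y])
  then show ?thesis
    using fd_commute[OF open_U y X, of z w] by (simp add: curv_def)
qed

text \<open>The metric coefficient \<open>g x v u\<close> is differentiated twice using metric
  compatibility. Commuting second derivatives then equate the two orders, and the mixed Christoffel
  products cancel.\<close>

lemma g_curv_skew:
  assumes y: "y \<in> U" shows "g y (curv y z w v) u = - g y (curv y z w u) v"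
proof -
  have d: "(\<lambda>x. g x (christoffel x w v) u) differentiable (at y)" for w v u
    by (rule differentiable_g_field_left[OF y christoffel_differentiable[OF y]])
  have *: "fd (\<lambda>x. g x (christoffel x w v) u) y z = g y (cov z (\<lambda>x. christoffel x w v) y) u
      + g y (christoffel y w v) (christoffel y z u)" for z w v u
    using fd_g_fields[OF y christoffel_differentiable[OF y] differentiable_const, of w v u z] by (simp add: cov_def)
  have "fd (\<lambda>x. fd (\<lambda>x. g x v u) x w) y z
      = fd (\<lambda>x. g x (christoffel x w v) u + g x (christoffel x w u) v) y z" for z w
    by (rule fd_cong_open[OF open_U y, THEN fun_cong]) (simp add: dg_christoffel g_sym)
  then have "fd (\<lambda>x. fd (\<lambda>x. g x v u) x w) y z
     = g y (cov z (\<lambda>x. christoffel x w v) y) u + g y (christoffel y w v) (christoffel y z u)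
      + g y (cov z (\<lambda>x. christoffel x w u) y) v + g y (christoffel y w u) (christoffel y z v)" for z w
    by (simp add: fd_add d *)
  then show ?thesis
    using fd_commute[OF open_U y g_smooth, of v u w z] g_sym[OF y, of "christoffel y w v"]  g_sym[OF y, of "christoffel y z v"]
    by (simp add: curv_def cov_def g_linear[OF y])
qed

text \<open>The classical octahedron argument: four Bianchi sums are combined, and the
  skew-symmetries identify their terms in pairs.\<close>

lemma curv_pair_sym:
  assumes y: "y \<in> U" shows "g y (curv y a b c) d = g y (curv y c d a) b"
proof -
  have B: "g y (curv y a b c) d + g y (curv y b c a) d + g y (curv y c a b) d = 0" for a b c d
    using arg_cong[OF curv_bianchi[OF y, of a b c], of "\<lambda>v. g y v d"] by (simp add: g_linear[OF y])
  have S: "g y (curv y a b c) d = - g y (curv y b a c) d" for a b c d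
    using curv_skew[of y a b c] by (simp add: g_linear[OF y])
  show ?thesis
    using B[of a b c d] B[of b c d a] B[of c d a b] B[of d a b c]
      S[of a b c d] S[of b c a d] S[of c a b d] S[of b c d a] S[of c d b a] S[of d b c a]
      S[of c d a b] S[of d a c b] S[of a c d b] S[of d a b c] S[of a b d c] S[of b d a c]
      g_curv_skew[OF y, of a b c d] g_curv_skew[OF y, of b c a d] g_curv_skew[OF y, of c a b d]
      g_curv_skew[OF y, of b c d a] g_curv_skew[OF y, of c d b a] g_curv_skew[OF y, of d b c a]
      g_curv_skew[OF y, of c d a b] g_curv_skew[OF y, of d a c b] g_curv_skew[OF y, of a c d b]
      g_curv_skew[OF y, of d a b c] g_curv_skew[OF y, of a b d c] g_curv_skew[OF y, of b d a c]
    by linarith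
qed

end

section \<open>S-structures at a point\<close>

locale sym_form =
  fixes g :: "'e::euclidean_space \<Rightarrow> 'e \<Rightarrow> real"
  assumes bilinear_g: "bilinear g" and g_sym: "g v w = g w v"
    and g_nondeg: "(\<And>w. g v w = 0) \<Longrightarrow> v = 0"
begin

lemma linear_g_right: "linear (g v)"
  and linear_g_left: "linear (\<lambda>v. g v w)"
  using bilinear_g by (auto simp: bilinear_def)

lemmas g_linear = linear_add[OF linear_g_right] linear_add[OF linear_g_left]
  linear_diff[OF linear_g_right] linear_diff[OF linear_g_left]
  linear_neg[OF linear_g_right] linear_neg[OF linear_g_left]
  linear_0[OF linear_g_right] linear_0[OF linear_g_left]
  linear_cmul[OF linear_g_right, unfolded real_scaleR_def]
  linear_cmul[OF linear_g_left, unfolded real_scaleR_def]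
  linear_sum[OF linear_g_right] linear_sum[OF linear_g_left]

lemma g_eqI: "(\<And>w. g v w = g v' w) \<Longrightarrow> v = v'"
  using g_nondeg[of "v - v'"] by (simp add: g_linear)

end

text \<open>The one-forms are eliminated by \<eta>^\<alpha> = \<epsilon>_\<alpha> g(-,
  \<xi>_\<alpha>), a consequence of compatibility. Differentiating the frame identities then
  produces only \<nabla>\<phi> and \<nabla>\<xi>.\<close>

locale frame_point = sym_form g
  for g :: "'e::euclidean_space \<Rightarrow> 'e \<Rightarrow> real" +
  fixes \<phi> :: "'e \<Rightarrow> 'e" and \<xi> :: "'s::finite \<Rightarrow> 'e" and \<epsilon> :: "'s \<Rightarrow> real"
  assumes linear_\<phi>: "linear \<phi>" and \<phi>_\<xi>: "\<phi> (\<xi> \<alpha>) = 0"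
    and \<phi>_\<phi>: "\<phi> (\<phi> v) = - v + (\<Sum>\<alpha>\<in>UNIV. (\<epsilon> \<alpha> * g v (\<xi> \<alpha>)) *\<^sub>R \<xi> \<alpha>)"
    and \<phi>_skew: "g (\<phi> v) w = - g v (\<phi> w)"
    and g_\<xi>_\<xi>: "g (\<xi> \<alpha>) (\<xi> \<beta>) = (if \<alpha> = \<beta> then \<epsilon> \<alpha> else 0)"
    and \<epsilon>: "\<epsilon> \<alpha> * \<epsilon> \<alpha> = 1"
begin

lemmas \<phi>_linear = linear_add[OF linear_\<phi>] linear_diff[OF linear_\<phi>] linear_neg[OF linear_\<phi>]
  linear_0[OF linear_\<phi>] linear_cmul[OF linear_\<phi>] linear_sum[OF linear_\<phi>]

lemma g_\<phi>_\<xi>: "g (\<phi> v) (\<xi> \<alpha>) = 0" "g (\<xi> \<alpha>) (\<phi> v) = 0"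
  using \<phi>_skew[of v "\<xi> \<alpha>"] g_sym[of "\<xi> \<alpha>"] by (simp_all add: \<phi>_\<xi> g_linear)

text \<open>By \<open>hor_\<phi>\<close> and \<open>\<phi>_\<phi>_hor\<close> these vectors form the
  range of \<phi>; linear equations are the more convenient description.\<close>

definition hor :: "'e \<Rightarrow> bool" where
  "hor x \<longleftrightarrow> (\<forall>\<alpha>. g x (\<xi> \<alpha>) = 0)"

lemma hor_\<phi>: "hor (\<phi> v)"
  by (simp add: hor_def g_\<phi>_\<xi>)

lemma \<phi>_\<phi>_hor: "hor x \<Longrightarrow> \<phi> (\<phi> x) = - x"
  by (simp add: hor_def \<phi>_\<phi>)

lemma \<epsilon>_nonzero: "\<epsilon> \<alpha> \<noteq> 0"
  using \<epsilon>[of \<alpha>] by auto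

lemma zero_if_hor_kernel: "hor v \<Longrightarrow> \<phi> v = 0 \<Longrightarrow> v = 0"
  using \<phi>_\<phi>_hor[of v] by (simp add: \<phi>_linear)

lemma zero_if_orth_hor:
  assumes "\<And>z. hor z \<Longrightarrow> g v z = 0" "hor v" shows "v = 0"
proof (rule zero_if_hor_kernel[OF assms(2)])
  show "\<phi> v = 0" by (rule g_nondeg) (simp add: \<phi>_skew assms(1) hor_\<phi>)
qed

end

text \<open>\<open>T z w\<close> stands for \<open>(\<nabla>\<^sub>z \<phi>) w\<close> and \<open>B \<alpha> z\<close> for \<open>\<nabla>\<^sub>z \<xi>\<^sub>\<alpha>\<close> at the point. The assumptions express, in
  this order, normality, \<open>d\<eta>\<^sup>\<alpha> = \<Phi>\<close>, \<open>d\<Phi> = 0\<close>, and the derivatives of the identities for \<open>\<phi>\<^sup>2\<close>, \<open>\<phi> \<xi>\<^sub>\<alpha>\<close>,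
  the skew-symmetry of \<open>\<phi>\<close> and \<open>g(\<xi>\<^sub>\<alpha>,\<xi>\<^sub>\<beta>)\<close>.\<close>
locale S_point = frame_point g \<phi> \<xi> \<epsilon>
  for g :: "'e::euclidean_space \<Rightarrow> 'e \<Rightarrow> real" and \<phi> and \<xi> :: "'s::finite \<Rightarrow> 'e" and \<epsilon> +
  fixes T :: "'e \<Rightarrow> 'e \<Rightarrow> 'e" and B :: "'s \<Rightarrow> 'e \<Rightarrow> 'e"
  assumes linear_T: "linear (T z)" "linear (\<lambda>z. T z w)" and linear_B: "linear (B \<alpha>)"
    and normality: "T (\<phi> v) w - T (\<phi> w) v + \<phi> (T w v) - \<phi> (T v w)
        + (2 * g v (\<phi> w)) *\<^sub>R (\<Sum>\<alpha>\<in>UNIV. \<xi> \<alpha>) = 0"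
    and d\<eta>: "\<epsilon> \<alpha> * (g w (B \<alpha> v) - g v (B \<alpha> w)) = 2 * g v (\<phi> w)"
    and d\<Phi>: "g v (T u w) + g w (T v u) + g u (T w v) = 0"
    and T_\<phi>: "T z (\<phi> w) + \<phi> (T z w)
        = (\<Sum>\<alpha>\<in>UNIV. (\<epsilon> \<alpha> * g w (B \<alpha> z)) *\<^sub>R \<xi> \<alpha> + (\<epsilon> \<alpha> * g w (\<xi> \<alpha>)) *\<^sub>R B \<alpha> z)"
    and T_\<xi>: "T z (\<xi> \<alpha>) = - \<phi> (B \<alpha> z)"
    and T_skew: "g (T z v) w = - g v (T z w)"
    and B_\<xi>: "g (B \<alpha> z) (\<xi> \<beta>) + g (\<xi> \<alpha>) (B \<beta> z) = 0"
begin

lemma T_zero: "T 0 w = 0"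
  using linear_0[OF linear_T(2)] .

text \<open>The Lie derivative of \<open>\<phi>\<close> along \<open>\<xi>\<^sub>\<alpha>\<close> vanishes.\<close>
lemma lie_\<phi>: "T (\<xi> \<alpha>) w = B \<alpha> (\<phi> w) - \<phi> (B \<alpha> w)"
proof -
  let ?L = "T (\<xi> \<alpha>) w - B \<alpha> (\<phi> w) + \<phi> (B \<alpha> w)"
  have "\<phi> (T (\<xi> \<alpha>) w) = \<phi> (B \<alpha> (\<phi> w)) - \<phi> (\<phi> (B \<alpha> w))"
    using normality[of "\<xi> \<alpha>" w] by (simp add: \<phi>_\<xi> T_zero T_\<xi> g_\<phi>_\<xi> \<phi>_linear)
  then have "\<phi> ?L = 0"
    by (simp add: \<phi>_linear)
  \<comment> \<open>Normality controls \<open>?L\<close> only after \<phi> has been applied. The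
    vertical components are settled by d\<eta>^\<beta> on the pair \<open>\<phi> w\<close>,
    \<open>\<xi> \<alpha>\<close>, where \<Phi> vanishes.\<close>
  moreover have "hor ?L"
    unfolding hor_def
  proof
    fix \<beta>
    have 1: "g (T (\<xi> \<alpha>) w) (\<xi> \<beta>) = - g (B \<beta> (\<xi> \<alpha>)) (\<phi> w)"
      using T_skew[of "\<xi> \<alpha>" w "\<xi> \<beta>"] \<phi>_skew[of "B \<beta> (\<xi> \<alpha>)" w] g_sym by (simp add: T_\<xi> g_linear)
    have 2: "g (B \<alpha> (\<phi> w)) (\<xi> \<beta>) = - g (\<xi> \<alpha>) (B \<beta> (\<phi> w))"
      using B_\<xi>[of \<alpha> "\<phi> w" \<beta>] by simp
    have "g (\<phi> w) (B \<beta> (\<xi> \<alpha>)) - g (\<xi> \<alpha>) (B \<beta> (\<phi> w)) = 0"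
      using d\<eta>[of \<beta> "\<phi> w" "\<xi> \<alpha>"] \<epsilon>_nonzero[of \<beta>] by (simp add: g_\<phi>_\<xi>)
    then show "g ?L (\<xi> \<beta>) = 0"
      using 1 2 g_sym[of "\<phi> w"] by (simp add: g_linear g_\<phi>_\<xi>)
  qed
  ultimately have "?L = 0" using zero_if_hor_kernel by blast
  then show ?thesis by (simp add: algebra_simps)
qed

text \<open>\<open>S\<close> is the Lie derivative of the metric along \<xi>_\<alpha>. Closedness of
  \<Phi> and invariance of \<phi> under the flow make it vanish as soon as one argument lies in the
  range of \<phi>; pairs of characteristic vectors are treated separately, and \<open>dec\<close>
  splits a general vector into these two kinds.\<close>

lemma killing: "g (B \<alpha> v) w = - g v (B \<alpha> w)"
proof -
  define S where "S v w = g (B \<alpha> v) w + g v (B \<alpha> w)" for v w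
  have S_sym: "S v w = S w v" for v w
    unfolding S_def using g_sym by simp
  have S_\<phi>: "S v (\<phi> w) = 0" for v w
  proof -
    have "g v (T (\<xi> \<alpha>) w) - g w (\<phi> (B \<alpha> v)) + g (\<phi> (B \<alpha> w)) v = 0"
      using d\<Phi>[of v "\<xi> \<alpha>" w] T_skew[of w v "\<xi> \<alpha>"] g_sym[of "\<xi> \<alpha>" "T w v"] g_sym[of v "\<phi> (B \<alpha> w)"]
      by (simp add: T_\<xi> g_linear)
    moreover have "g w (\<phi> (B \<alpha> v)) = - g (\<phi> w) (B \<alpha> v)"
      using \<phi>_skew[of w "B \<alpha> v"] by simp
    ultimately show ?thesis
      unfolding S_def lie_\<phi> using g_sym[of v "\<phi> (B \<alpha> w)"] g_sym[of "B \<alpha> v"] by (simp add: g_linear)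
  qed
  have sym: "g v (B \<alpha> (\<xi> \<beta>)) = g (\<xi> \<beta>) (B \<alpha> v)" for \<alpha> \<beta> v
    using d\<eta>[of \<alpha> v "\<xi> \<beta>"] \<epsilon>_nonzero[of \<alpha>] by (simp add: g_\<phi>_\<xi>)
  \<comment> \<open>The expression g(\<xi>_\<beta>, B_\<alpha> \<xi>_\<gamma>) is skew in \<alpha>,
    \<beta> because the frame is orthonormal and symmetric in \<beta>, \<gamma> by
    \<open>sym\<close>. Such an array is zero.\<close>
  have S_\<xi>_\<xi>: "S (\<xi> \<gamma>) (\<xi> \<beta>) = 0" for \<beta> \<gamma>
  proof -
    have skew: "g (\<xi> \<beta>) (B \<alpha> (\<xi> \<gamma>)) = - g (\<xi> \<alpha>) (B \<beta> (\<xi> \<gamma>))" for \<alpha> \<beta> \<gamma>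
      using B_\<xi>[of \<alpha> "\<xi> \<gamma>" \<beta>] g_sym[of "B \<alpha> (\<xi> \<gamma>)"] by simp
    have "g (\<xi> \<beta>) (B \<alpha> (\<xi> \<gamma>)) = 0"
      using skew[of \<beta> \<alpha> \<gamma>] sym[of "\<xi> \<alpha>" \<beta> \<gamma>] skew[of \<gamma> \<beta> \<alpha>] sym[of "\<xi> \<beta>" \<gamma> \<alpha>] skew[of \<alpha> \<gamma> \<beta>] sym[of "\<xi> \<gamma>" \<alpha> \<beta>]
      by linarith
    then show ?thesis
      unfolding S_def using sym[of "\<xi> \<gamma>" \<alpha> \<beta>] g_sym[of "B \<alpha> (\<xi> \<gamma>)"] by simp
  qed
  have lin: "linear (S v)" for v
    unfolding S_def using linear_g_right linear_compose[OF linear_B linear_g_right]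
    by (intro linear_compose_add) (auto simp: o_def)
  have dec: "w = - \<phi> (\<phi> w) + (\<Sum>\<beta>\<in>UNIV. (\<epsilon> \<beta> * g w (\<xi> \<beta>)) *\<^sub>R \<xi> \<beta>)" for w
    by (simp add: \<phi>_\<phi>)
  have expand: "S v w = (\<Sum>\<beta>\<in>UNIV. \<epsilon> \<beta> * g w (\<xi> \<beta>) * S v (\<xi> \<beta>))" for v w
    using arg_cong[OF dec[of w], of "S v"]
    by (simp add: linear_add[OF lin] linear_diff[OF lin] linear_neg[OF lin] linear_sum[OF lin] linear_cmul[OF lin] S_\<phi>)
  have "S (\<xi> \<beta>) w = 0" for \<beta> w
    using expand[of "\<xi> \<beta>" w] by (simp add: S_\<xi>_\<xi>)
  then have "S v w = 0"
    using expand[of v w] S_sym by simp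
  then show ?thesis unfolding S_def by simp
qed

text \<open>For a Killing field the derivative is skew, so the antisymmetrisation in d\<eta> loses
  nothing and d\<eta> = \<Phi> determines \<nabla>\<xi> completely.\<close>

lemma nabla_\<xi>: "B \<alpha> v = - (\<epsilon> \<alpha> *\<^sub>R \<phi> v)"
proof (rule g_eqI)
  fix w
  have k: "g v (B \<alpha> w) = - g (B \<alpha> v) w"
    using killing[of \<alpha> v w] by linarith
  have "2 * (\<epsilon> \<alpha> * g (B \<alpha> v) w) = 2 * g v (\<phi> w)"
    using d\<eta>[of \<alpha> w v] unfolding g_sym[of w "B \<alpha> v"] k
    by (simp only: diff_minus_eq_add distrib_left mult_2)
  then have *: "\<epsilon> \<alpha> * g (B \<alpha> v) w = g v (\<phi> w)"
    by simp
  have "g (B \<alpha> v) w = \<epsilon> \<alpha> * \<epsilon> \<alpha> * g (B \<alpha> v) w"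
    unfolding \<epsilon> by simp
  also have "\<dots> = \<epsilon> \<alpha> * g v (\<phi> w)"
    unfolding mult.assoc * by (rule refl)
  finally show "g (B \<alpha> v) w = g (- (\<epsilon> \<alpha> *\<^sub>R \<phi> v)) w"
    by (simp add: g_linear \<phi>_skew)
qed

lemma T_\<xi>_left: "T (\<xi> \<alpha>) w = 0"
  by (simp add: lie_\<phi> nabla_\<xi> \<phi>_linear)

lemma T_\<xi>_right: "T z (\<xi> \<alpha>) = \<epsilon> \<alpha> *\<^sub>R \<phi> (\<phi> z)"
  by (simp add: T_\<xi> nabla_\<xi> \<phi>_linear)

text \<open>The horizontal part of \<open>\<nabla>\<phi>\<close> vanishes, as for the complex structure of a Kaehler manifold:
  normality makes \<open>S\<close> symmetric in its first two arguments, and it is skew in the last two.\<close>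
lemma T_hor_hor:
  assumes X: "hor X" and Y: "hor Y" and Z: "hor Z"
  shows "g (T X Y) Z = 0"
proof -
  have a: "g (T X (\<phi> Y)) Z = g (T X Y) (\<phi> Z)" if "hor Y" "hor Z" for X Y Z
  proof -
    have "g (T X (\<phi> Y) + \<phi> (T X Y)) Z = 0"
      unfolding T_\<phi> using that g_sym[of _ Z] by (simp add: hor_def g_linear)
    then show ?thesis by (simp add: g_linear \<phi>_skew)
  qed
  have b: "g (T X Y) Z = - g (T X Z) Y" for X Y Z
    using T_skew[of X Y Z] g_sym[of Y] by simp
  define S where "S X Y Z = g (T (\<phi> X) Y) Z + g (T X Y) (\<phi> Z)" for X Y Z
  have S_sym: "S X Y Z = S Y X Z" if "hor Z" for X Y Z
  proof -
    have "g (\<Sum>\<alpha>\<in>UNIV. \<xi> \<alpha>) Z = 0"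
      using that g_sym[of _ Z] by (simp add: g_linear hor_def)
    then show ?thesis
      using arg_cong[OF normality[of X Y], of "\<lambda>v. g v Z"] unfolding S_def
      by (simp add: g_linear \<phi>_skew)
  qed
  have S_skew: "S X Y Z = - S X Z Y" if "hor Y" "hor Z" for X Y Z
    unfolding S_def using b[of "\<phi> X" Y Z] b[of X Y "\<phi> Z"] a[OF that(2,1), of X] by simp
  have S0: "g (T (\<phi> X) Y) Z = - g (T X Y) (\<phi> Z)" if "hor X" "hor Y" "hor Z" for X Y Z
  proof -
    have "S X Y Z = 0"
      using S_sym[OF that(3), of X Y] S_skew[OF that(1,3), of Y] S_sym[OF that(1), of Y Z]
        S_skew[OF that(2,1), of Z] S_sym[OF that(2), of Z X] S_skew[OF that(3,2), of X] by linarith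
    then show ?thesis unfolding S_def by simp
  qed
  define Q where "Q X Y Z = g (T X Y) (\<phi> Z)" for X Y Z
  have Q: "Q X Y Z + Q Y Z X - Q Z X Y = 0" if "hor X" "hor Y" "hor Z" for X Y Z
    using d\<Phi>[of Y X "\<phi> Z"] T_skew[of X Y "\<phi> Z"] g_sym[of "\<phi> Z" "T Y X"] b[of Y X "\<phi> Z"]
      a[OF that(3,1), of Y] g_sym[of X "T (\<phi> Z) Y"] S0[OF that(3,2,1)] b[of Z Y "\<phi> X"] a[OF that(1,2), of Z]
    unfolding Q_def by linarith
  \<comment> \<open>The three cyclic instances of \<open>Q\<close> read a + b = c, b + c = a and c +
    a = b, so all three vanish. \<open>\<phi> Z\<close> replaces \<open>Z\<close> because
    \<open>Q\<close> applies \<phi> to its last argument once more.\<close>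
  have "Q X Y (\<phi> Z) = 0"
    using Q[OF X Y hor_\<phi>[of Z]] Q[OF Y hor_\<phi>[of Z] X] Q[OF hor_\<phi>[of Z] X Y] by linarith
  then show ?thesis
    unfolding Q_def \<phi>_\<phi>_hor[OF Z] by (simp add: g_linear)
qed

text \<open>The horizontal part of \<open>T X Y\<close> is zero, and its component along
  \<xi>_\<beta> is a multiple of \<open>g Y X\<close>, hence symmetric. This is why the curvature of
  two horizontal vectors kills every \<xi>_\<alpha>.\<close>

lemma T_hor_sym:
  assumes X: "hor X" and Y: "hor Y" shows "T X Y = T Y X"
proof -
  have "g (T X Y) (\<xi> \<beta>) = \<epsilon> \<beta> * g Y X" if "hor X" for X Y \<beta>
    using T_skew[of X Y "\<xi> \<beta>"] unfolding T_\<xi>_right \<phi>_\<phi>_hor[OF that] by (simp add: g_linear)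
  then have "hor (T X Y - T Y X)"
    unfolding hor_def[of "T X Y - T Y X"] using X Y g_sym[of X Y] by (simp add: g_linear)
  then have "T X Y - T Y X = 0"
    by (intro zero_if_orth_hor) (auto simp: g_linear T_hor_hor X Y)
  then show ?thesis by simp
qed

end

section \<open>S-structures in a chart\<close>

text \<open>Normality and d\<eta>^\<alpha> = \<Phi> are recorded for constant coordinate fields,
  where all brackets of the arguments disappear; being tensorial, they lose no information.\<close>

locale S_chart = metric_chart U g
  for U :: "'e::euclidean_space set" and g +
  fixes \<phi> :: "'e \<Rightarrow> 'e \<Rightarrow> 'e" and \<xi> :: "'s::finite \<Rightarrow> 'e \<Rightarrow> 'e" and \<eta> :: "'s \<Rightarrow> 'e \<Rightarrow> 'e \<Rightarrow> real"
    and \<epsilon> :: "'s \<Rightarrow> real"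
  assumes frame: "y \<in> U \<Longrightarrow> frame_point (g y) (\<phi> y) (\<lambda>\<alpha>. \<xi> \<alpha> y) \<epsilon>"
    and \<phi>_smooth: "smooth_on U (\<lambda>y. \<phi> y v)"
    and \<xi>_smooth: "smooth_on U (\<xi> \<alpha>)"
    and \<eta>_smooth: "smooth_on U (\<lambda>y. \<eta> \<alpha> y v)"
    and \<eta>_eq: "y \<in> U \<Longrightarrow> \<eta> \<alpha> y v = \<epsilon> \<alpha> * g y v (\<xi> \<alpha> y)"
    and d\<eta>: "y \<in> U \<Longrightarrow> fd (\<lambda>z. \<eta> \<alpha> z w) y v - fd (\<lambda>z. \<eta> \<alpha> z v) y w = 2 * g y v (\<phi> y w)"
    and normal: "y \<in> U \<Longrightarrow> fd (\<lambda>z. \<phi> z w) y (\<phi> y v) - fd (\<lambda>z. \<phi> z v) y (\<phi> y w)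
        + \<phi> y (fd (\<lambda>z. \<phi> z v) y w) - \<phi> y (fd (\<lambda>z. \<phi> z w) y v)
        + (2 * g y v (\<phi> y w)) *\<^sub>R (\<Sum>\<alpha>\<in>UNIV. \<xi> \<alpha> y) = 0"
begin

lemma linear_\<phi>: "y \<in> U \<Longrightarrow> linear (\<phi> y)"
  using frame_point.linear_\<phi>[OF frame] .

lemmas \<phi>_differentiable = smooth_on_differentiable[OF \<phi>_smooth]
  and \<xi>_differentiable = smooth_on_differentiable[OF \<xi>_smooth]
  and \<eta>_differentiable = smooth_on_differentiable[OF \<eta>_smooth]

lemma cov_cong: "y \<in> U \<Longrightarrow> (\<And>x. x \<in> U \<Longrightarrow> X x = Y x) \<Longrightarrow> cov z X y = cov z Y y"
  unfolding cov_def using fd_cong_open[OF open_U, of y X Y] by simp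

lemma cov_const: "cov z (\<lambda>_. v) y = christoffel y z v"
  by (simp add: cov_def)

definition T :: "'e \<Rightarrow> 'e \<Rightarrow> 'e \<Rightarrow> 'e" where
  "T y z w = fd (\<lambda>x. \<phi> x w) y z + christoffel y z (\<phi> y w) - \<phi> y (christoffel y z w)"

lemma cov_\<phi>_field:
  assumes y: "y \<in> U" and X: "X differentiable (at y)"
  shows "cov z (\<lambda>x. \<phi> x (X x)) y = T y z (X y) + \<phi> y (cov z X y)"
proof -
  have "fd (\<lambda>x. \<phi> x (X x)) y z = fd (\<lambda>x. \<phi> x (X y)) y z + \<phi> y (fd X y z)"
    by (rule fd_linear_family[OF open_U y]) (auto simp: linear_\<phi> \<phi>_differentiable X y)
  then show ?thesis
    by (simp add: cov_def T_def linear_add[OF linear_\<phi>[OF y]])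
qed

lemma cov_\<phi>: "y \<in> U \<Longrightarrow> cov z (\<lambda>x. \<phi> x w) y = T y z w + \<phi> y (christoffel y z w)"
  using cov_\<phi>_field[of y "\<lambda>_. w"] by (simp add: cov_const)

lemma d\<eta>_cov:
  assumes y: "y \<in> U"
  shows "fd (\<lambda>x. \<eta> \<alpha> x w) y z = \<epsilon> \<alpha> * (g y (christoffel y z w) (\<xi> \<alpha> y) + g y w (cov z (\<xi> \<alpha>) y))"
proof -
  have "(\<lambda>x. g x w (\<xi> \<alpha> x)) differentiable (at y)"
    by (rule differentiable_linear_family[OF open_U y])
      (auto simp: linear_g_right g_differentiable y \<xi>_differentiable)
  then have "fd (\<lambda>x. \<epsilon> \<alpha> * g x w (\<xi> \<alpha> x)) y z = \<epsilon> \<alpha> * fd (\<lambda>x. g x w (\<xi> \<alpha> x)) y z"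
    by (rule fd_mult_const)
  moreover have "fd (\<lambda>x. \<eta> \<alpha> x w) y = fd (\<lambda>x. \<epsilon> \<alpha> * g x w (\<xi> \<alpha> x)) y"
    by (rule fd_cong_open[OF open_U y]) (simp add: \<eta>_eq)
  ultimately show ?thesis
    using fd_g_fields[OF y, of "\<lambda>_. w" "\<xi> \<alpha>" z] \<xi>_differentiable[OF y] by (simp add: cov_const)
qed

lemma linear_T:
  assumes y: "y \<in> U" shows "linear (T y z)" "linear (\<lambda>z. T y z w)"
proof -
  have "linear (\<lambda>w. fd (\<lambda>x. \<phi> x w) y z)"
    by (rule linear_fd_family[OF open_U y]) (auto simp: linear_\<phi> \<phi>_differentiable y)
  moreover have "linear (\<lambda>w. christoffel y z (\<phi> y w))"
    using linear_compose[OF linear_\<phi>[OF y] linear_christoffel_right[OF y]] by (simp add: o_def)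
  moreover have "linear (\<lambda>w. \<phi> y (christoffel y z w))"
    using linear_compose[OF linear_christoffel_right[OF y] linear_\<phi>[OF y]] by (simp add: o_def)
  ultimately have "linear (\<lambda>w. T y z w)"
    unfolding T_def by (intro linear_compose_add linear_compose_sub)
  then show "linear (T y z)" by simp
  have "linear (\<lambda>z. fd (\<lambda>x. \<phi> x w) y z)"
    using linear_frechet_derivative[OF \<phi>_differentiable[OF y]] by simp
  moreover have "linear (\<lambda>z. \<phi> y (christoffel y z w))"
    using linear_compose[OF linear_christoffel_left[OF y] linear_\<phi>[OF y]] by (simp add: o_def)
  ultimately show "linear (\<lambda>z. T y z w)"
    unfolding T_def by (intro linear_compose_add linear_compose_sub linear_christoffel_left[OF y])
qed

text \<open>The coefficients of 2\<Phi> are antisymmetrised first derivatives of a one-form, so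
  d\<Phi> = 0 by commuting second derivatives. The Christoffel terms cancel because the connection
  is torsion-free.\<close>

lemma closed_fundamental_form:
  assumes y: "y \<in> U"
  shows "g y v (T y u w) + g y w (T y v u) + g y u (T y w v) = 0"
proof -
  interpret P: frame_point "g y" "\<phi> y" "\<lambda>\<alpha>. \<xi> \<alpha> y" \<epsilon> by (rule frame[OF y])
  \<comment> \<open>Any index serves, since all the d\<eta>^\<alpha> coincide; one exists because
    types are inhabited, which reflects s \<ge> 1.\<close>
  fix \<alpha> :: 's
  define D where "D u v w = fd (\<lambda>x. fd (\<lambda>z. \<eta> \<alpha> z w) x v) y u" for u v w
  have D_sym: "D u v w = D v u w" for u v w
    unfolding D_def by (rule fd_commute[OF open_U y \<eta>_smooth])
  have "(\<lambda>x. g x v (\<phi> x w)) differentiable (at y)" for v w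
    by (rule differentiable_linear_family[OF open_U y])
      (auto simp: linear_g_right g_differentiable \<phi>_differentiable y)
  then have "2 * fd (\<lambda>x. g x v (\<phi> x w)) y u = fd (\<lambda>x. 2 * g x v (\<phi> x w)) y u" for u v w
    by (simp add: fd_mult_const)
  also have "\<dots> u v w = fd (\<lambda>x. fd (\<lambda>z. \<eta> \<alpha> z w) x v - fd (\<lambda>z. \<eta> \<alpha> z v) x w) y u" for u v w
    by (rule fd_cong_open[OF open_U y, THEN fun_cong]) (simp add: d\<eta>)
  also have "\<dots> u v w = D u v w - D u w v" for u v w
    unfolding D_def by (intro fd_diff smooth_on_differentiable[OF smooth_on_fd[OF \<eta>_smooth] y])
  finally have 1: "2 * fd (\<lambda>x. g x v (\<phi> x w)) y u = D u v w - D u w v" for u v w .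
  have "fd (\<lambda>x. g x v (\<phi> x w)) y u = g y (christoffel y u v) (\<phi> y w) + g y v (T y u w)
      - g y (christoffel y u w) (\<phi> y v)" for u v w
    using fd_g_fields[OF y, of "\<lambda>_. v" "\<lambda>x. \<phi> x w" u] \<phi>_differentiable[OF y]
      P.\<phi>_skew[of v "christoffel y u w"] g_sym[OF y, of "\<phi> y v" "christoffel y u w"]
    by (simp add: cov_const cov_\<phi>[OF y] g_linear[OF y])
  then show ?thesis
    using 1[of v w u] 1[of w u v] 1[of u v w] D_sym[of u v w] D_sym[of v w u] D_sym[of w u v]
      christoffel_sym[OF y, of u v] christoffel_sym[OF y, of v w] christoffel_sym[OF y, of w u]
    by simp
qed

lemma S_point:
  assumes y: "y \<in> U"
  shows "S_point (g y) (\<phi> y) (\<lambda>\<alpha>. \<xi> \<alpha> y) \<epsilon> (T y) (\<lambda>\<alpha> z. cov z (\<xi> \<alpha>) y)"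
proof -
  interpret P: frame_point "g y" "\<phi> y" "\<lambda>\<alpha>. \<xi> \<alpha> y" \<epsilon> by (rule frame[OF y])
  show ?thesis
  proof (intro S_point.intro S_point_axioms.intro)
    show "frame_point (g y) (\<phi> y) (\<lambda>\<alpha>. \<xi> \<alpha> y) \<epsilon>" by (rule frame[OF y])
    fix z w v u :: 'e and \<alpha> \<beta> :: 's
    show "linear (T y z)" "linear (\<lambda>z. T y z w)" by (fact linear_T[OF y])+
    show "linear (\<lambda>z. cov z (\<xi> \<alpha>) y)"
      unfolding cov_def using linear_frechet_derivative[OF \<xi>_differentiable[OF y]]
      by (intro linear_compose_add linear_christoffel_left y)
    show "T y (\<phi> y v) w - T y (\<phi> y w) v + \<phi> y (T y w v) - \<phi> y (T y v w)
        + (2 * g y v (\<phi> y w)) *\<^sub>R (\<Sum>\<alpha>\<in>UNIV. \<xi> \<alpha> y) = 0"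
      using normal[OF y, of w v] christoffel_sym[OF y, of "\<phi> y v" "\<phi> y w"]
        christoffel_sym[OF y, of "\<phi> y v" w] christoffel_sym[OF y, of v "\<phi> y w"] christoffel_sym[OF y, of v w]
      by (simp add: T_def P.\<phi>_linear algebra_simps)
    show "\<epsilon> \<alpha> * (g y w (cov v (\<xi> \<alpha>) y) - g y v (cov w (\<xi> \<alpha>) y)) = 2 * g y v (\<phi> y w)"
      using d\<eta>[OF y, of \<alpha> w v] christoffel_sym[OF y, of v w]
      by (simp add: d\<eta>_cov[OF y] algebra_simps)
    show "g y v (T y u w) + g y w (T y v u) + g y u (T y w v) = 0"
      by (rule closed_fundamental_form[OF y])
    show "T y z (\<xi> \<alpha> y) = - \<phi> y (cov z (\<xi> \<alpha>) y)"
    proof -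
      have "cov z (\<lambda>x. \<phi> x (\<xi> \<alpha> x)) y = cov z (\<lambda>_. 0) y"
        by (rule cov_cong[OF y]) (simp add: frame_point.\<phi>_\<xi>[OF frame])
      then show ?thesis
        using cov_\<phi>_field[OF y \<xi>_differentiable[OF y]]
        by (simp add: cov_const christoffel_linear[OF y] eq_neg_iff_add_eq_0)
    qed
    have d\<phi>: "(\<lambda>x. \<phi> x w) differentiable (at y)" for w
      using \<phi>_differentiable[OF y] .
    show "g y (T y z v) w = - g y v (T y z w)"
    proof -
      have dg: "(\<lambda>x. g x v (\<phi> x w)) differentiable (at y)"
        by (rule differentiable_linear_family[OF open_U y])
          (auto simp: linear_g_right g_differentiable \<phi>_differentiable y)
      have "fd (\<lambda>x. g x (\<phi> x v) w) y z = fd (\<lambda>x. (- 1) * g x v (\<phi> x w)) y z"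
        by (rule fd_cong_open[OF open_U y, THEN fun_cong]) (simp add: frame_point.\<phi>_skew[OF frame])
      also have "\<dots> = (- 1) * fd (\<lambda>x. g x v (\<phi> x w)) y z"
        by (rule fd_mult_const[OF dg])
      finally show ?thesis
        using fd_g_fields[OF y d\<phi> differentiable_const, of v w z] fd_g_fields[OF y differentiable_const d\<phi>, of v w z]
          P.\<phi>_skew[of "christoffel y z v" w] P.\<phi>_skew[of v "christoffel y z w"]
        by (simp add: cov_const cov_\<phi>[OF y] g_linear[OF y])
    qed
    show "g y (cov z (\<xi> \<alpha>) y) (\<xi> \<beta> y) + g y (\<xi> \<alpha> y) (cov z (\<xi> \<beta>) y) = 0"
    proof -
      have "fd (\<lambda>x. g x (\<xi> \<alpha> x) (\<xi> \<beta> x)) y = fd (\<lambda>_. if \<alpha> = \<beta> then \<epsilon> \<alpha> else 0) y"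
        by (rule fd_cong_open[OF open_U y]) (simp add: frame_point.g_\<xi>_\<xi>[OF frame])
      then show ?thesis
        using fd_g_fields[OF y \<xi>_differentiable[OF y] \<xi>_differentiable[OF y], of \<alpha> \<beta> z] by simp
    qed
    show "T y z (\<phi> y w) + \<phi> y (T y z w)
        = (\<Sum>\<alpha>\<in>UNIV. (\<epsilon> \<alpha> * g y w (cov z (\<xi> \<alpha>) y)) *\<^sub>R \<xi> \<alpha> y
           + (\<epsilon> \<alpha> * g y w (\<xi> \<alpha> y)) *\<^sub>R cov z (\<xi> \<alpha>) y)"
    proof -
      have 1: "((\<lambda>x. \<eta> \<alpha> x w *\<^sub>R \<xi> \<alpha> x) has_derivative
          (\<lambda>z. \<eta> \<alpha> y w *\<^sub>R fd (\<xi> \<alpha>) y z + fd (\<lambda>x. \<eta> \<alpha> x w) y z *\<^sub>R \<xi> \<alpha> y)) (at y)" for \<alpha>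
        by (intro has_derivative_scaleR differentiable_has_fd \<eta>_differentiable \<xi>_differentiable y)
      have "((\<lambda>x. - w + (\<Sum>\<alpha>\<in>UNIV. \<eta> \<alpha> x w *\<^sub>R \<xi> \<alpha> x)) has_derivative
          (\<lambda>z. 0 + (\<Sum>\<alpha>\<in>UNIV. \<eta> \<alpha> y w *\<^sub>R fd (\<xi> \<alpha>) y z + fd (\<lambda>x. \<eta> \<alpha> x w) y z *\<^sub>R \<xi> \<alpha> y))) (at y)"
        by (intro has_derivative_add has_derivative_sum has_derivative_const 1)
      from fd_eq[OF this]
      have 2: "fd (\<lambda>x. - w + (\<Sum>\<alpha>\<in>UNIV. \<eta> \<alpha> x w *\<^sub>R \<xi> \<alpha> x)) y z
          = (\<Sum>\<alpha>\<in>UNIV. \<eta> \<alpha> y w *\<^sub>R fd (\<xi> \<alpha>) y z + fd (\<lambda>x. \<eta> \<alpha> x w) y z *\<^sub>R \<xi> \<alpha> y)"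
        by simp
      have "cov z (\<lambda>x. \<phi> x (\<phi> x w)) y = cov z (\<lambda>x. - w + (\<Sum>\<alpha>\<in>UNIV. \<eta> \<alpha> x w *\<^sub>R \<xi> \<alpha> x)) y"
        by (rule cov_cong[OF y]) (simp add: frame_point.\<phi>_\<phi>[OF frame] \<eta>_eq)
      also have "\<dots> = - christoffel y z w
         + (\<Sum>\<alpha>\<in>UNIV. \<eta> \<alpha> y w *\<^sub>R cov z (\<xi> \<alpha>) y + fd (\<lambda>x. \<eta> \<alpha> x w) y z *\<^sub>R \<xi> \<alpha> y)"
        unfolding cov_def 2
        by (simp add: christoffel_linear[OF y] linear_sum[OF linear_christoffel_right[OF y]] sum.distrib
            scaleR_add_right)
      also have "\<dots> = \<phi> y (\<phi> y (christoffel y z w))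
         + (\<Sum>\<alpha>\<in>UNIV. (\<epsilon> \<alpha> * g y w (cov z (\<xi> \<alpha>) y)) *\<^sub>R \<xi> \<alpha> y
           + (\<epsilon> \<alpha> * g y w (\<xi> \<alpha> y)) *\<^sub>R cov z (\<xi> \<alpha>) y)"
        by (simp add: P.\<phi>_\<phi> \<eta>_eq[OF y] d\<eta>_cov[OF y] sum.distrib distrib_left scaleR_add_left)
      finally show ?thesis
        using cov_\<phi>_field[OF y d\<phi>, of z w] by (simp add: cov_\<phi>[OF y] P.\<phi>_linear add.assoc)
    qed
  qed
qed

lemma cov_\<xi>: "y \<in> U \<Longrightarrow> cov z (\<xi> \<alpha>) y = - \<epsilon> \<alpha> *\<^sub>R \<phi> y z"
  using S_point.nabla_\<xi>[OF S_point] by simp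

text \<open>Since \<nabla>\<xi>_\<alpha> = -\<epsilon>_\<alpha> \<phi>, the second covariant
  derivative of \<xi>_\<alpha> is -\<epsilon>_\<alpha> \<nabla>\<phi>, and the Ricci identity
  antisymmetrises it.\<close>

lemma curv_\<xi>:
  assumes y: "y \<in> U"
  shows "curv y z w (\<xi> \<alpha> y) = - \<epsilon> \<alpha> *\<^sub>R (T y z w - T y w z)"
proof -
  have "cov z (\<lambda>x. cov w (\<xi> \<alpha>) x) y = - \<epsilon> \<alpha> *\<^sub>R (T y z w + \<phi> y (christoffel y z w))" for z w
  proof -
    have "cov z (\<lambda>x. cov w (\<xi> \<alpha>) x) y = cov z (\<lambda>x. - \<epsilon> \<alpha> *\<^sub>R \<phi> x w) y"
      by (rule cov_cong[OF y]) (simp add: cov_\<xi>)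
    also have "\<dots> = - \<epsilon> \<alpha> *\<^sub>R cov z (\<lambda>x. \<phi> x w) y"
      unfolding cov_def fd_scaleR_const[OF \<phi>_differentiable[OF y]]
      by (simp add: christoffel_linear[OF y] algebra_simps)
    finally show ?thesis by (simp add: cov_\<phi>[OF y])
  qed
  then have "curv y z w (\<xi> \<alpha> y) = - \<epsilon> \<alpha> *\<^sub>R (T y z w + \<phi> y (christoffel y z w))
      - - \<epsilon> \<alpha> *\<^sub>R (T y w z + \<phi> y (christoffel y w z))"
    unfolding ricci_identity[OF y \<xi>_smooth, symmetric] by simp
  then show ?thesis
    unfolding christoffel_sym[OF y, of w z] by (simp add: algebra_simps)
qed

definition hor :: "'e \<Rightarrow> 'e \<Rightarrow> bool" where
  "hor y x \<longleftrightarrow> (\<forall>\<alpha>. g y x (\<xi> \<alpha> y) = 0)"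

lemma curv_hor_hor_\<xi>:
  assumes y: "y \<in> U" and x: "hor y x" "hor y z"
  shows "curv y x z (\<xi> \<alpha> y) = 0"
proof -
  interpret P: S_point "g y" "\<phi> y" "\<lambda>\<alpha>. \<xi> \<alpha> y" \<epsilon> "T y" "\<lambda>\<alpha> z. cov z (\<xi> \<alpha>) y"
    by (rule S_point[OF y])
  show ?thesis
    using P.T_hor_sym[of x z] x by (simp add: curv_\<xi>[OF y] P.hor_def hor_def)
qed

lemma curv_hor_\<xi>_\<xi>:
  assumes y: "y \<in> U" and x: "hor y x"
  shows "curv y x (\<xi> \<beta> y) (\<xi> \<alpha> y) = (\<epsilon> \<alpha> * \<epsilon> \<beta>) *\<^sub>R x"
proof -
  interpret P: S_point "g y" "\<phi> y" "\<lambda>\<alpha>. \<xi> \<alpha> y" \<epsilon> "T y" "\<lambda>\<alpha> z. cov z (\<xi> \<alpha>) y"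
    by (rule S_point[OF y])
  show ?thesis
    using P.\<phi>_\<phi>_hor[of x] x by (simp add: curv_\<xi>[OF y] P.hor_def hor_def P.T_\<xi>_left P.T_\<xi>_right)
qed

lemma curv_\<xi>_\<xi>_\<xi>:
  assumes y: "y \<in> U"
  shows "curv y (\<xi> \<gamma> y) (\<xi> \<beta> y) (\<xi> \<alpha> y) = 0"
proof -
  interpret P: S_point "g y" "\<phi> y" "\<lambda>\<alpha>. \<xi> \<alpha> y" \<epsilon> "T y" "\<lambda>\<alpha> z. cov z (\<xi> \<alpha>) y"
    by (rule S_point[OF y])
  show ?thesis
    by (simp add: curv_\<xi>[OF y] P.T_\<xi>_left)
qed

end

section \<open>The curvature of the base\<close>

lemma fd_compose:
  assumes "h differentiable (at (f y))" "f differentiable (at y)"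
  shows "fd (\<lambda>x. h (f x)) y z = fd h (f y) (fd f y z)" "(\<lambda>x. h (f x)) differentiable (at y)"
  using has_derivative_compose[OF differentiable_has_fd[OF assms(2)] differentiable_has_fd[OF assms(1)]]
  by (auto simp: fd_eq differentiable_def)

text \<open>\<phi> kills vertical vectors and preserves the metric on horizontal ones, so g(\<phi>
  v, \<phi> w) is the product of the horizontal parts. In this form the isometry condition holds for
  all vectors and can be differentiated with constant \<open>v\<close> and \<open>w\<close>.\<close>

locale submersion_chart = S_chart U g \<phi> \<xi> \<eta> \<epsilon> + N: metric_chart V G
  for U :: "'e::euclidean_space set" and g \<phi> and \<xi> :: "'s::finite \<Rightarrow> 'e \<Rightarrow> 'e" and \<eta> \<epsilon>
    and V :: "'h::euclidean_space set" and G +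
  fixes F :: "'e \<Rightarrow> 'h"
  assumes F_smooth: "smooth_on U F" and F_in: "y \<in> U \<Longrightarrow> F y \<in> V"
    and F_isometry: "y \<in> U \<Longrightarrow> G (F y) (fd F y v) (fd F y w) = g y (\<phi> y v) (\<phi> y w)"
    and F_surj: "y \<in> U \<Longrightarrow> surj (fd F y)"
begin

lemma F_differentiable: "y \<in> U \<Longrightarrow> F differentiable (at y)"
  using smooth_on_differentiable[OF F_smooth] .

lemma dF_differentiable: "y \<in> U \<Longrightarrow> (\<lambda>x. fd F x v) differentiable (at y)"
  using smooth_on_differentiable[OF smooth_on_fd[OF F_smooth]] .

lemma linear_dF: "y \<in> U \<Longrightarrow> linear (fd F y)"
  using linear_frechet_derivative[OF F_differentiable] .

lemmas dF_linear = linear_add[OF linear_dF] linear_diff[OF linear_dF] linear_neg[OF linear_dF]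
  linear_0[OF linear_dF] linear_cmul[OF linear_dF]

text \<open>In terms of the structure this is the sum of \<epsilon>_\<alpha> \<eta>^\<alpha>. Since
  \<nabla>\<xi>_\<alpha> = -\<epsilon>_\<alpha> \<phi> for every \<alpha>, the characteristic fields
  enter the Hessian of the projection only through this sum.\<close>

definition \<theta> :: "'e \<Rightarrow> 'e \<Rightarrow> real" where
  "\<theta> y v = (\<Sum>\<alpha>\<in>UNIV. g y v (\<xi> \<alpha> y))"

text \<open>The connection on the total space for which the projection is affine.\<close>
definition christoffel' :: "'e \<Rightarrow> 'e \<Rightarrow> 'e \<Rightarrow> 'e" where
  "christoffel' y z v = christoffel y z v + \<theta> y v *\<^sub>R \<phi> y z + \<theta> y z *\<^sub>R \<phi> y v"

lemma d_pullback:
  assumes y: "y \<in> U"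
  shows "fd (\<lambda>x. G (F x) (fd F x v) (fd F x w)) y z
    = G (F y) (fd (\<lambda>x. fd F x v) y z + N.christoffel (F y) (fd F y z) (fd F y v)) (fd F y w)
    + G (F y) (fd F y v) (fd (\<lambda>x. fd F x w) y z + N.christoffel (F y) (fd F y z) (fd F y w))"
proof -
  note Fy = F_in[OF y]
  have d1: "(\<lambda>x. G (F x) a b) differentiable (at y)" for a b
    using fd_compose(2)[OF N.g_differentiable[OF Fy] F_differentiable[OF y]] .
  have d2: "(\<lambda>x. G (F x) (fd F x v) b) differentiable (at y)" for b
    by (rule differentiable_linear_family[where Q="\<lambda>x v. G (F x) v b", OF open_U y _ d1 dF_differentiable[OF y]])
      (auto intro: N.linear_g_left F_in)
  have "fd (\<lambda>x. G (F x) (fd F x v) (fd F x w)) y z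
      = fd (\<lambda>x. G (F x) (fd F x v) (fd F y w)) y z + G (F y) (fd F y v) (fd (\<lambda>x. fd F x w) y z)"
    by (rule fd_linear_family[where Q="\<lambda>x b. G (F x) (fd F x v) b", OF open_U y _ d2 dF_differentiable[OF y]])
      (auto intro: N.linear_g_right F_in)
  also have "fd (\<lambda>x. G (F x) (fd F x v) (fd F y w)) y z
      = fd (\<lambda>x. G (F x) (fd F y v) (fd F y w)) y z + G (F y) (fd (\<lambda>x. fd F x v) y z) (fd F y w)"
    by (rule fd_linear_family[where Q="\<lambda>x v. G (F x) v (fd F y w)", OF open_U y _ d1 dF_differentiable[OF y]])
      (auto intro: N.linear_g_left F_in)
  also have "fd (\<lambda>x. G (F x) (fd F y v) (fd F y w)) y z = fd (\<lambda>q. G q (fd F y v) (fd F y w)) (F y) (fd F y z)"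
    using fd_compose(1)[OF N.g_differentiable[OF Fy] F_differentiable[OF y]] .
  finally show ?thesis
    by (simp add: N.dg_christoffel[OF Fy] N.g_linear[OF Fy])
qed

text \<open>\<open>S\<close> is the Hessian of the projection. It is symmetric, and the derivative
  of the isometry condition prescribes G(S(z,v), dF w) + G(dF v, S(z,w)); three permuted copies
  isolate \<open>S\<close> as in the Koszul formula. Surjectivity of dF supplies enough test
  vectors.\<close>

lemma hessian_F:
  assumes y: "y \<in> U"
  shows "fd (\<lambda>x. fd F x v) y z = fd F y (christoffel' y z v) - N.christoffel (F y) (fd F y z) (fd F y v)"
proof -
  note Fy = F_in[OF y]
  interpret P: S_point "g y" "\<phi> y" "\<lambda>\<alpha>. \<xi> \<alpha> y" \<epsilon> "T y" "\<lambda>\<alpha> z. cov z (\<xi> \<alpha>) y"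
    by (rule S_point[OF y])
  define S where "S z v = fd (\<lambda>x. fd F x v) y z + N.christoffel (F y) (fd F y z) (fd F y v)
     - fd F y (christoffel y z v)" for z v
  have S_sym: "S z v = S v z" for z v
    unfolding S_def using fd_commute[OF open_U y F_smooth, of v z] N.christoffel_sym[OF Fy]
      christoffel_sym[OF y, of z v] by simp
  define M where "M z v w = g y w (\<phi> y z) * \<theta> y v + \<theta> y w * g y v (\<phi> y z)" for z v w
  have SM: "G (F y) (S z v) (fd F y w) + G (F y) (fd F y v) (S z w) = M z v w" for z v w
  proof -
    have "fd (\<lambda>x. G (F x) (fd F x v) (fd F x w)) y z = fd (\<lambda>x. g x (\<phi> x v) (\<phi> x w)) y z"
      by (rule fd_cong_open[OF open_U y, THEN fun_cong]) (simp add: F_isometry)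
    also have "\<dots> = g y (T y z v) (\<phi> y w) + g y (\<phi> y v) (T y z w)
        + g y (\<phi> y (christoffel y z v)) (\<phi> y w) + g y (\<phi> y v) (\<phi> y (christoffel y z w))"
      using fd_g_fields[OF y \<phi>_differentiable[OF y] \<phi>_differentiable[OF y], of v w z]
      by (simp add: cov_\<phi>[OF y] g_linear[OF y])
    finally have "G (F y) (S z v) (fd F y w) + G (F y) (fd F y v) (S z w)
        = g y (T y z v) (\<phi> y w) + g y (\<phi> y v) (T y z w)"
      unfolding S_def d_pullback[OF y] by (simp add: N.g_linear[OF Fy] F_isometry[OF y])
    also have "\<dots> = - g y v (T y z (\<phi> y w) + \<phi> y (T y z w))"
      by (simp add: P.T_skew P.\<phi>_skew g_linear[OF y])
    also have "\<dots> = (\<Sum>\<alpha>\<in>UNIV. g y w (\<phi> y z) * g y v (\<xi> \<alpha> y) + g y w (\<xi> \<alpha> y) * g y v (\<phi> y z))"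
    proof -
      have e1: "\<epsilon> \<alpha> * (- \<epsilon> \<alpha> * c) = - c" for \<alpha> c
        using arg_cong[OF P.\<epsilon>[of \<alpha>], of "\<lambda>t. - (t * c)"] by (simp add: mult.assoc)
      have e2: "(\<epsilon> \<alpha> * c) *\<^sub>R (- \<epsilon> \<alpha> *\<^sub>R u) = - c *\<^sub>R u" for \<alpha> c and u :: 'e
        unfolding scaleR_scaleR using e1[of \<alpha> c] by (simp add: mult.commute mult.left_commute)
      have "T y z (\<phi> y w) + \<phi> y (T y z w)
        = (\<Sum>\<alpha>\<in>UNIV. - g y w (\<phi> y z) *\<^sub>R \<xi> \<alpha> y + - g y w (\<xi> \<alpha> y) *\<^sub>R \<phi> y z)"
        unfolding P.T_\<phi> cov_\<xi>[OF y] g_scale_right[OF y] e1 e2 ..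
      then show ?thesis
        by (simp add: P.g_linear sum_negf sum.distrib sum_subtractf)
    qed
    finally show ?thesis
      unfolding M_def \<theta>_def by (simp add: sum.distrib sum_distrib_left sum_distrib_right)
  qed
  have "2 * G (F y) (S z v) (fd F y w) = M z v w + M v z w - M w z v" for w
    using SM[of z v w] SM[of v z w, unfolded S_sym[of v z]] SM[of w z v, unfolded S_sym[of w z] S_sym[of w v]]
      N.g_sym[OF Fy, of "fd F y v" "S z w"] by linarith
  also have "\<dots> w = 2 * (g y w (\<phi> y z) * \<theta> y v + g y w (\<phi> y v) * \<theta> y z)" for w
  proof -
    have s: "g y a (\<phi> y b) = - g y b (\<phi> y a)" for a b
      using P.\<phi>_skew[of a b] g_sym[OF y, of b "\<phi> y a"] by simp
    show ?thesis
      unfolding M_def s[of z v] s[of z w] s[of v w] by (simp add: algebra_simps)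
  qed
  finally have "2 * G (F y) (S z v) (fd F y w) = 2 * (g y w (\<phi> y z) * \<theta> y v + g y w (\<phi> y v) * \<theta> y z)" for w .
  then have 1: "G (F y) (S z v) (fd F y w) = g y w (\<phi> y z) * \<theta> y v + g y w (\<phi> y v) * \<theta> y z" for w
    by (metis mult_cancel_left zero_neq_numeral)
  have 2: "G (F y) (fd F y (\<phi> y a)) (fd F y w) = g y w (\<phi> y a)" for a w
  proof -
    have "g y (\<phi> y (\<phi> y a)) (\<phi> y w) = - g y (\<phi> y (\<phi> y (\<phi> y a))) w"
      unfolding P.\<phi>_skew[of "\<phi> y (\<phi> y a)" w] by simp
    also have "\<dots> = g y (\<phi> y a) w"
      unfolding P.\<phi>_\<phi>_hor[OF P.hor_\<phi>] by (simp add: g_linear[OF y])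
    finally show ?thesis
      unfolding F_isometry[OF y] g_sym[OF y, of w "\<phi> y a"] .
  qed
  have "S z v = fd F y (\<theta> y v *\<^sub>R \<phi> y z + \<theta> y z *\<^sub>R \<phi> y v)"
  proof (rule N.g_eqI[OF Fy])
    fix b
    obtain w where "b = fd F y w" using F_surj[OF y] by (metis surjD)
    then show "G (F y) (S z v) b = G (F y) (fd F y (\<theta> y v *\<^sub>R \<phi> y z + \<theta> y z *\<^sub>R \<phi> y v)) b"
      by (simp add: 1 2 dF_linear[OF y] N.g_linear[OF Fy] mult.commute)
  qed
  then have "fd (\<lambda>x. fd F x v) y z = fd F y (\<theta> y v *\<^sub>R \<phi> y z + \<theta> y z *\<^sub>R \<phi> y v)
      + fd F y (christoffel y z v) - N.christoffel (F y) (fd F y z) (fd F y v)"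
    unfolding S_def by (simp only: diff_eq_eq eq_diff_eq)
  moreover have "fd F y (christoffel' y z v) = fd F y (christoffel y z v)
      + fd F y (\<theta> y v *\<^sub>R \<phi> y z + \<theta> y z *\<^sub>R \<phi> y v)"
    unfolding christoffel'_def add.assoc by (rule linear_add[OF linear_dF[OF y]])
  ultimately show ?thesis by simp
qed

lemma g_\<xi>_differentiable: "y \<in> U \<Longrightarrow> (\<lambda>x. g x v (\<xi> \<alpha> x)) differentiable (at y)"
  by (rule differentiable_linear_family[OF open_U])
    (auto simp: linear_g_right g_differentiable \<xi>_differentiable)

lemma \<theta>_differentiable: "y \<in> U \<Longrightarrow> (\<lambda>x. \<theta> x v) differentiable (at y)"
  unfolding \<theta>_def by (intro differentiable_sum ballI g_\<xi>_differentiable) simp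

lemma d\<theta>:
  assumes y: "y \<in> U"
  shows "fd (\<lambda>x. \<theta> x v) y z = \<theta> y (christoffel y z v) - (\<Sum>\<alpha>\<in>UNIV. \<epsilon> \<alpha>) * g y v (\<phi> y z)"
proof -
  have "fd (\<lambda>x. \<theta> x v) y z = (\<Sum>\<alpha>\<in>UNIV. fd (\<lambda>x. g x v (\<xi> \<alpha> x)) y z)"
    unfolding \<theta>_def by (rule fd_sum[OF g_\<xi>_differentiable[OF y]])
  also have "\<dots> = (\<Sum>\<alpha>\<in>UNIV. g y (christoffel y z v) (\<xi> \<alpha> y) - \<epsilon> \<alpha> * g y v (\<phi> y z))"
    using fd_g_fields[OF y differentiable_const \<xi>_differentiable[OF y], of v _ z]
    by (intro sum.cong) (simp_all add: cov_const cov_\<xi>[OF y] g_linear[OF y])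
  finally show ?thesis by (simp add: \<theta>_def sum_subtractf sum_distrib_right)
qed

lemma christoffel'_has_derivative:
  assumes y: "y \<in> U"
  shows "((\<lambda>x. christoffel' x w v) has_derivative
    (\<lambda>z. fd (\<lambda>x. christoffel x w v) y z
       + (\<theta> y v *\<^sub>R fd (\<lambda>x. \<phi> x w) y z + fd (\<lambda>x. \<theta> x v) y z *\<^sub>R \<phi> y w)
       + (\<theta> y w *\<^sub>R fd (\<lambda>x. \<phi> x v) y z + fd (\<lambda>x. \<theta> x w) y z *\<^sub>R \<phi> y v))) (at y)"
  unfolding christoffel'_def
  by (intro has_derivative_add has_derivative_scaleR differentiable_has_fd christoffel_differentiable
      \<phi>_differentiable \<theta>_differentiable y)

text \<open>The argument of dF on the right is the curvature of \<open>christoffel'\<close>. The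
  formula is the integrability condition of \<open>hessian_F\<close>: its derivative is a third
  derivative of \<open>F\<close>, which is symmetric in \<open>z\<close> and
  \<open>w\<close>.\<close>

lemma curv_pushforward:
  assumes y: "y \<in> U"
  shows "N.curv (F y) (fd F y z) (fd F y w) (fd F y v)
    = fd F y (fd (\<lambda>x. christoffel' x w v) y z + christoffel' y z (christoffel' y w v)
       - fd (\<lambda>x. christoffel' x z v) y w - christoffel' y w (christoffel' y z v))"
proof -
  note Fy = F_in[OF y]
  have d: "fd (\<lambda>x. fd (\<lambda>x. fd F x v) x w) y z
      = fd F y (christoffel' y z (christoffel' y w v)) - N.christoffel (F y) (fd F y z) (fd F y (christoffel' y w v))
      + fd F y (fd (\<lambda>x. christoffel' x w v) y z)
      - fd (\<lambda>q. N.christoffel q (fd F y w) (fd F y v)) (F y) (fd F y z)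
      - N.christoffel (F y) (fd (\<lambda>x. fd F x w) y z) (fd F y v)
      - N.christoffel (F y) (fd F y w) (fd (\<lambda>x. fd F x v) y z)" for z w
  proof -
    have dc': "(\<lambda>x. christoffel' x w v) differentiable (at y)"
      using christoffel'_has_derivative[OF y] differentiable_def by blast
    have d1: "(\<lambda>x. N.christoffel (F x) a b) differentiable (at y)" for a b
      using fd_compose(2)[OF N.christoffel_differentiable[OF Fy] F_differentiable[OF y]] .
    have d2: "(\<lambda>x. N.christoffel (F x) (fd F x w) b) differentiable (at y)" for b
      by (rule differentiable_linear_family[where Q="\<lambda>x v. N.christoffel (F x) v b", OF open_U y _ d1 dF_differentiable[OF y]])
        (auto intro: N.linear_christoffel_left F_in)
    have d3: "(\<lambda>x. N.christoffel (F x) (fd F x w) (fd F x v)) differentiable (at y)"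
      by (rule differentiable_linear_family[OF open_U y _ d2 dF_differentiable[OF y]])
        (auto intro: N.linear_christoffel_right F_in)
    have d4: "(\<lambda>x. fd F x (christoffel' x w v)) differentiable (at y)"
      by (rule differentiable_linear_family[OF open_U y _ dF_differentiable[OF y] dc'])
        (auto intro: linear_dF)
    have e3: "fd (\<lambda>x. N.christoffel (F x) (fd F x w) (fd F x v)) y z
      = fd (\<lambda>q. N.christoffel q (fd F y w) (fd F y v)) (F y) (fd F y z)
       + N.christoffel (F y) (fd (\<lambda>x. fd F x w) y z) (fd F y v)
       + N.christoffel (F y) (fd F y w) (fd (\<lambda>x. fd F x v) y z)"
    proof -
      have "fd (\<lambda>x. N.christoffel (F x) (fd F x w) (fd F x v)) y z
        = fd (\<lambda>x. N.christoffel (F x) (fd F x w) (fd F y v)) y z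
         + N.christoffel (F y) (fd F y w) (fd (\<lambda>x. fd F x v) y z)"
        by (rule fd_linear_family[where Q="\<lambda>x b. N.christoffel (F x) (fd F x w) b", OF open_U y _ d2 dF_differentiable[OF y]])
          (auto intro: N.linear_christoffel_right F_in)
      also have "fd (\<lambda>x. N.christoffel (F x) (fd F x w) (fd F y v)) y z
        = fd (\<lambda>x. N.christoffel (F x) (fd F y w) (fd F y v)) y z
         + N.christoffel (F y) (fd (\<lambda>x. fd F x w) y z) (fd F y v)"
        by (rule fd_linear_family[where Q="\<lambda>x v'. N.christoffel (F x) v' (fd F y v)", OF open_U y _ d1 dF_differentiable[OF y]])
          (auto intro: N.linear_christoffel_left F_in)
      also have "fd (\<lambda>x. N.christoffel (F x) (fd F y w) (fd F y v)) y z
        = fd (\<lambda>q. N.christoffel q (fd F y w) (fd F y v)) (F y) (fd F y z)"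
        using fd_compose(1)[OF N.christoffel_differentiable[OF Fy] F_differentiable[OF y]] .
      finally show ?thesis .
    qed
    have e4: "fd (\<lambda>x. fd F x (christoffel' x w v)) y z
       = fd (\<lambda>x. fd F x (christoffel' y w v)) y z + fd F y (fd (\<lambda>x. christoffel' x w v) y z)"
      by (rule fd_linear_family[where Q="\<lambda>x. fd F x", OF open_U y _ dF_differentiable[OF y] dc'])
        (auto intro: linear_dF)
    have "fd (\<lambda>x. fd (\<lambda>x. fd F x v) x w) y z
      = fd (\<lambda>x. fd F x (christoffel' x w v) - N.christoffel (F x) (fd F x w) (fd F x v)) y z"
      by (rule fd_cong_open[OF open_U y, THEN fun_cong]) (simp add: hessian_F)
    also have "\<dots> = fd (\<lambda>x. fd F x (christoffel' x w v)) y z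
       - fd (\<lambda>x. N.christoffel (F x) (fd F x w) (fd F x v)) y z"
      by (rule fd_diff[OF d4 d3])
    finally show ?thesis
      unfolding e3 e4 hessian_F[OF y, of "christoffel' y w v"] by simp
  qed
  have D: "fd (\<lambda>x. fd (\<lambda>x. fd F x v) x w) y z = fd (\<lambda>x. fd (\<lambda>x. fd F x v) x z) y w"
    by (rule fd_commute[OF open_U y smooth_on_fd[OF F_smooth]])
  have sym: "fd (\<lambda>x. fd F x w) y z = fd (\<lambda>x. fd F x z) y w"
    by (rule fd_commute[OF open_U y F_smooth])
  \<comment> \<open>Bookkeeping in the group \<open>'h\<close>: \<open>k\<close>, \<open>p\<close>
    and \<open>q\<close> occur in both orders of differentiation and drop out, leaving the base
    curvature on one side and images under dF on the other.\<close>
  have cancel: "c + t - c' - r = x1 + x2 - x3 - x4"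
    if "x2 - p + x1 - c - k - (q - r) = x4 - q + x3 - c' - k - (p - t)" for x1 x2 x3 x4 c c' k p q r t :: 'h
  proof -
    have "(x1 + x2 - x3 - x4) - (c + t - c' - r)
        = (x2 - p + x1 - c - k - (q - r)) - (x4 - q + x3 - c' - k - (p - t))"
      by (simp add: algebra_simps)
    then show ?thesis using that by simp
  qed
  note D[unfolded d[of w z] d[of z w] sym hessian_F[OF y, of v] linear_diff[OF N.linear_christoffel_right[OF Fy]]]
  from cancel[OF this] show ?thesis
    unfolding N.curv_def linear_diff[OF linear_dF[OF y]] linear_add[OF linear_dF[OF y]] .
qed

text \<open>O'Neill's formula for the Jacobi operators.\<close>
lemma jacobi_pushforward:
  assumes y: "y \<in> U" and x: "hor y x" and z: "hor y z"
  shows "N.curv (F y) (fd F y z) (fd F y x) (fd F y x)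
    = fd F y (curv y z x x + (3 * (\<Sum>\<alpha>\<in>UNIV. \<epsilon> \<alpha>) * g y z (\<phi> y x)) *\<^sub>R \<phi> y x)"
proof -
  interpret P: S_point "g y" "\<phi> y" "\<lambda>\<alpha>. \<xi> \<alpha> y" \<epsilon> "T y" "\<lambda>\<alpha> z. cov z (\<xi> \<alpha>) y"
    by (rule S_point[OF y])
  have \<theta>0: "\<theta> y x = 0" "\<theta> y z = 0"
    using x z by (simp_all add: \<theta>_def hor_def)
  have g0: "g y x (\<phi> y x) = 0"
    using P.\<phi>_skew[of x x] g_sym[OF y, of x "\<phi> y x"] by simp
  have gs: "g y x (\<phi> y z) = - g y z (\<phi> y x)"
    using P.\<phi>_skew[of x z] g_sym[OF y, of z "\<phi> y x"] by simp
  define s where "s = (\<Sum>\<alpha>\<in>UNIV. \<epsilon> \<alpha>)"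
  \<comment> \<open>As \<theta> vanishes on \<open>x\<close> and \<open>z\<close>, the corrections
    come from d\<theta> and from \<theta> of Christoffel vectors. The latter are \<open>b\<close>
    and \<open>c\<close> and cancel. \<open>a\<close> arises twice in the derivative along
    \<open>z\<close> and once, with two minus signs, in the derivative along \<open>x\<close>, which
    makes the factor 3.\<close>
  define a where "a = s * g y z (\<phi> y x)"
  define b where "b = \<theta> y (christoffel y z x)"
  define c where "c = \<theta> y (christoffel y x x)"
  have bs: "\<theta> y (christoffel y x z) = b"
    unfolding b_def christoffel_sym[OF y, of x z] ..
  have 1: "fd (\<lambda>u. christoffel' u x x) y z
      = fd (\<lambda>u. christoffel u x x) y z + (b + a) *\<^sub>R \<phi> y x + (b + a) *\<^sub>R \<phi> y x"
    unfolding fd_eq[OF christoffel'_has_derivative[OF y]] d\<theta>[OF y] \<theta>0 gs s_def[symmetric] b_def[symmetric]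
    by (simp add: a_def)
  have 2: "fd (\<lambda>u. christoffel' u z x) y x
      = fd (\<lambda>u. christoffel u z x) y x + c *\<^sub>R \<phi> y z + (b - a) *\<^sub>R \<phi> y x"
    unfolding fd_eq[OF christoffel'_has_derivative[OF y]] d\<theta>[OF y] \<theta>0 g0 bs s_def[symmetric] c_def[symmetric]
    by (simp add: a_def)
  have 3: "christoffel' y x x = christoffel y x x" "christoffel' y z x = christoffel y z x"
    "christoffel' y z (christoffel y x x) = christoffel y z (christoffel y x x) + c *\<^sub>R \<phi> y z"
    "christoffel' y x (christoffel y z x) = christoffel y x (christoffel y z x) + b *\<^sub>R \<phi> y x"
    by (simp_all add: christoffel'_def \<theta>0 b_def c_def)
  have 4: "(3 * s * g y z (\<phi> y x)) *\<^sub>R \<phi> y x = a *\<^sub>R \<phi> y x + a *\<^sub>R \<phi> y x + a *\<^sub>R \<phi> y x"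
    unfolding a_def by (simp only: scaleR_add_left[symmetric]) simp
  show ?thesis
    unfolding curv_pushforward[OF y] 1 2 3 4 s_def[symmetric] curv_def
    by (rule arg_cong[of _ _ "fd F y"]) (simp add: scaleR_add_left scaleR_diff_left)
qed

end

section \<open>Eigenspaces of the Jacobi operators\<close>

text \<open>Applying \<open>L\<close> minus the newly inserted eigenvalue removes that eigenvector
  from the relation and multiplies the others by non-zero factors.\<close>

lemma eigenvectors_sum_zero:
  fixes L :: "'a::real_vector \<Rightarrow> 'a"
  assumes L: "linear L" and "finite F"
    and v: "\<And>\<mu>. \<mu> \<in> F \<Longrightarrow> v \<mu> \<noteq> 0 \<and> L (v \<mu>) = \<mu> *\<^sub>R v \<mu>"
    and "(\<Sum>\<mu>\<in>F. a \<mu> *\<^sub>R v \<mu>) = 0" "\<mu> \<in> F"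
  shows "a \<mu> = (0::real)"
  using assms(2-)
proof (induction F arbitrary: a \<mu>)
  case empty
  then show ?case by simp
next
  case (insert \<mu>\<^sub>0 F)
  have s: "a \<mu>\<^sub>0 *\<^sub>R v \<mu>\<^sub>0 + (\<Sum>\<mu>\<in>F. a \<mu> *\<^sub>R v \<mu>) = 0"
    using insert by simp
  have "0 = L (a \<mu>\<^sub>0 *\<^sub>R v \<mu>\<^sub>0 + (\<Sum>\<mu>\<in>F. a \<mu> *\<^sub>R v \<mu>)) - \<mu>\<^sub>0 *\<^sub>R (a \<mu>\<^sub>0 *\<^sub>R v \<mu>\<^sub>0 + (\<Sum>\<mu>\<in>F. a \<mu> *\<^sub>R v \<mu>))"
    unfolding s by (simp add: linear_0[OF L])
  also have "\<dots> = (\<Sum>\<mu>\<in>F. a \<mu> *\<^sub>R L (v \<mu>)) - (\<Sum>\<mu>\<in>F. \<mu>\<^sub>0 *\<^sub>R a \<mu> *\<^sub>R v \<mu>)"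
    using insert.prems(1)[of \<mu>\<^sub>0]
    by (simp add: linear_add[OF L] linear_cmul[OF L] linear_sum[OF L] scaleR_add_right scaleR_sum_right mult.commute)
  also have "\<dots> = (\<Sum>\<mu>\<in>F. (a \<mu> * (\<mu> - \<mu>\<^sub>0)) *\<^sub>R v \<mu>)"
    unfolding sum_subtractf[symmetric] using insert.prems(1) by (intro sum.cong) (auto simp: algebra_simps)
  finally have "a \<mu> * (\<mu> - \<mu>\<^sub>0) = 0" if "\<mu> \<in> F" for \<mu>
    using insert.IH[of "\<lambda>\<mu>. a \<mu> * (\<mu> - \<mu>\<^sub>0)" \<mu>] insert.prems(1) that by simp
  then have F0: "a \<mu> = 0" if "\<mu> \<in> F" for \<mu>
    using that insert.hyps(2) by fastforce
  then have "a \<mu>\<^sub>0 *\<^sub>R v \<mu>\<^sub>0 = 0"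
    using s by simp
  then show ?case
    using insert.prems F0 by auto
qed

lemma finite_eigenvalues:
  fixes L :: "'a::euclidean_space \<Rightarrow> 'a"
  assumes L: "linear L"
  shows "finite {\<mu>. \<exists>v. v \<noteq> 0 \<and> L v = \<mu> *\<^sub>R v}" (is "finite ?\<Lambda>")
proof (rule ccontr)
  assume "infinite ?\<Lambda>"
  then obtain F where F: "F \<subseteq> ?\<Lambda>" "finite F" "card F = Suc DIM('a)"
    using infinite_arbitrarily_large by blast
  then have "\<forall>\<mu>\<in>F. \<exists>v. v \<noteq> 0 \<and> L v = \<mu> *\<^sub>R v" by blast
  then obtain v where v: "\<And>\<mu>. \<mu> \<in> F \<Longrightarrow> v \<mu> \<noteq> 0 \<and> L (v \<mu>) = \<mu> *\<^sub>R v \<mu>"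
    by metis
  have inj: "inj_on v F"
    by (rule inj_onI) (metis v scaleR_cancel_right)
  have "independent (v ` F)"
  proof (rule independent_if_scalars_zero)
    show "finite (v ` F)" using F by simp
    fix f x assume "(\<Sum>x\<in>v ` F. f x *\<^sub>R x) = 0" "x \<in> v ` F"
    then show "f x = 0"
      using eigenvectors_sum_zero[OF L F(2) v, of "\<lambda>\<mu>. f (v \<mu>)"] by (auto simp: sum.reindex[OF inj])
  qed
  then have "card (v ` F) \<le> DIM('a)"
    using independent_bound by blast
  then show False using F(3) card_image[OF inj] by simp
qed

lemma dim_direct_sum:
  fixes S T :: "'a::euclidean_space set"
  assumes "subspace S" "subspace T" "S \<inter> T = {0}"
  shows "dim {x + y |x y. x \<in> S \<and> y \<in> T} = dim S + dim T"
  using dim_sums_Int[OF assms(1,2)] assms(3) by simp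

text \<open>The linear algebra that remains at one point: \<open>R\<close> and \<open>RN\<close> are
  the curvature tensors of total space and base, and \<open>P\<close> is d\<pi>.
  \<open>dim_base\<close> is there to make the unit sphere connected.\<close>

locale jacobi_point = frame_point g \<phi> \<xi> \<epsilon> + N: sym_form G
  for g :: "'e::euclidean_space \<Rightarrow> 'e \<Rightarrow> real" and \<phi> and \<xi> :: "'s::finite \<Rightarrow> 'e" and \<epsilon>
    and G :: "'h::euclidean_space \<Rightarrow> 'h \<Rightarrow> real" +
  fixes \<alpha>\<^sub>1 :: 's and R :: "'e \<Rightarrow> 'e \<Rightarrow> 'e \<Rightarrow> 'e" and RN :: "'h \<Rightarrow> 'h \<Rightarrow> 'h \<Rightarrow> 'h" and P :: "'e \<Rightarrow> 'h"
  assumes linear_R: "linear (\<lambda>v. R z w v)" "linear (\<lambda>w. R z w v)" "linear (\<lambda>z. R z w v)"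
    and R_anti: "R a b c = - R b a c"
    and R_skew: "g (R a b c) d = - g (R a b d) c"
    and R_pair: "g (R a b c) d = g (R c d a) b"
    and R_hor_hor: "hor x \<Longrightarrow> hor y \<Longrightarrow> R x y (\<xi> \<alpha>) = 0"
    and R_hor_\<xi>: "hor x \<Longrightarrow> R x (\<xi> \<beta>) (\<xi> \<alpha>) = (\<epsilon> \<alpha> * \<epsilon> \<beta>) *\<^sub>R x"
    and R_\<xi>_\<xi>: "R (\<xi> \<gamma>) (\<xi> \<beta>) (\<xi> \<alpha>) = 0"
    and \<epsilon>_1: "\<epsilon> \<alpha>\<^sub>1 = - 1"
    and linear_P: "linear P" and surj_P: "surj P"
    and P_isometry: "G (P v) (P w) = g (\<phi> v) (\<phi> w)"
    and G_pos: "q \<noteq> 0 \<Longrightarrow> G q q > 0"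
    and oneill: "hor x \<Longrightarrow> hor z \<Longrightarrow>
      RN (P z) (P x) (P x) = P (R z x x + (3 * (\<Sum>\<alpha>\<in>UNIV. \<epsilon> \<alpha>) * g z (\<phi> x)) *\<^sub>R \<phi> x)"
    and eigenvector: "hor x \<Longrightarrow> g x x = 1 \<Longrightarrow> \<exists>\<mu>. R (\<phi> x) x x = \<mu> *\<^sub>R \<phi> x"
    and dim_base: "DIM('h) \<ge> 2"
begin

lemmas R_linear = linear_add[OF linear_R(1)] linear_add[OF linear_R(2)] linear_add[OF linear_R(3)]
  linear_diff[OF linear_R(1)] linear_diff[OF linear_R(2)] linear_diff[OF linear_R(3)]
  linear_cmul[OF linear_R(1)] linear_cmul[OF linear_R(2)] linear_cmul[OF linear_R(3)]
  linear_0[OF linear_R(1)] linear_0[OF linear_R(2)] linear_0[OF linear_R(3)]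
  linear_sum[OF linear_R(1)] linear_sum[OF linear_R(2)] linear_sum[OF linear_R(3)]

lemmas P_linear = linear_add[OF linear_P] linear_diff[OF linear_P] linear_neg[OF linear_P]
  linear_0[OF linear_P] linear_cmul[OF linear_P]

lemma hor_linear: "hor 0" "hor x \<Longrightarrow> hor y \<Longrightarrow> hor (x + y)" "hor x \<Longrightarrow> hor y \<Longrightarrow> hor (x - y)"
  "hor x \<Longrightarrow> hor (c *\<^sub>R x)"
  by (auto simp: hor_def g_linear)

lemma R_self: "R a a c = 0"
  using R_anti[of a a c] by (simp add: eq_neg_iff_add_eq_0 flip: scaleR_2)

lemma jacobi_sym: "g (R a x x) b = g (R b x x) a"
  using R_pair[of a x x b] R_skew[of x b a x] R_anti[of x b x] by (simp add: g_linear)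

lemma g_x_\<phi>: "g x (\<phi> x) = 0"
  using \<phi>_skew[of x x] g_sym[of x "\<phi> x"] by simp

lemma g_\<phi>_\<phi>: "hor x \<Longrightarrow> g (\<phi> x) (\<phi> y) = g x y"
  using \<phi>_skew[of "\<phi> x" y] \<phi>_\<phi>_hor[of x] by (simp add: g_linear)

lemma hor_jacobi: "hor x \<Longrightarrow> hor h \<Longrightarrow> hor (R h x x)"
  unfolding hor_def[of "R h x x"] using R_skew[of h x x] R_hor_hor[of h x] by (simp add: g_linear)

section \<open>Splitting off the eigenvector \<phi> x\<close>

definition unit_hor :: "'e set" where
  "unit_hor = {x. hor x \<and> g x x = 1}"

text \<open>For \<open>c = 0\<close> this is an eigenspace of the Jacobi operator of the total space; for
  \<open>c = 3 \<Sum>\<epsilon>\<^sub>\<alpha>\<close> it is isometric to an eigenspace of the Jacobi operator of the base.\<close>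
definition eigsp :: "real \<Rightarrow> 'e \<Rightarrow> real \<Rightarrow> 'e set" where
  "eigsp c x \<mu> = {h. hor h \<and> g h x = 0 \<and> R h x x + (c * g h (\<phi> x)) *\<^sub>R \<phi> x = \<mu> *\<^sub>R h}"

text \<open>The part of an eigenspace that is also orthogonal to \<phi> x. There the perturbation by
  \<open>c\<close> vanishes, so it is common to all \<open>eigsp c x \<mu>\<close>.\<close>

definition eigsp' :: "'e \<Rightarrow> real \<Rightarrow> 'e set" where
  "eigsp' x \<mu> = {h. hor h \<and> g h x = 0 \<and> g h (\<phi> x) = 0 \<and> R h x x = \<mu> *\<^sub>R h}"

text \<open>The eigenvalue as a Rayleigh quotient, with denominator 1 for unit \<open>x\<close>. The
  explicit formula makes its continuity in \<open>x\<close> evident.\<close>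

definition eigval :: "'e \<Rightarrow> real" where
  "eigval x = g (R (\<phi> x) x x) (\<phi> x)"

lemma subspace_eigsp: "subspace (eigsp c x \<mu>)"
proof -
  let ?L = "\<lambda>h. R h x x + (c * g h (\<phi> x)) *\<^sub>R \<phi> x - \<mu> *\<^sub>R h"
  have L: "linear ?L"
    by (rule linearI) (auto simp: R_linear g_linear algebra_simps)
  have "eigsp c x \<mu> = {h. hor h \<and> g h x = 0 \<and> ?L h = 0}"
    by (auto simp: eigsp_def)
  moreover have "subspace {h. hor h \<and> g h x = 0 \<and> ?L h = 0}"
    by (rule subspaceI)
      (simp_all only: mem_Collect_eq linear_add[OF L] linear_cmul[OF L] linear_0[OF L], simp_all add: hor_linear g_linear)
  ultimately show ?thesis by simp
qed

lemma subspace_eigsp': "subspace (eigsp' x \<mu>)"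
  by (rule subspaceI) (auto simp: eigsp'_def hor_linear g_linear R_linear scaleR_add_right)

lemma eigval:
  assumes x: "x \<in> unit_hor" shows "R (\<phi> x) x x = eigval x *\<^sub>R \<phi> x"
proof -
  obtain \<mu> where \<mu>: "R (\<phi> x) x x = \<mu> *\<^sub>R \<phi> x"
    using eigenvector x by (auto simp: unit_hor_def)
  then have "eigval x = \<mu>"
    using x g_\<phi>_\<phi>[of x x] by (simp add: eigval_def g_linear unit_hor_def)
  then show ?thesis using \<mu> by simp
qed

text \<open>The Jacobi operator is self-adjoint, so the complement of its eigenvector \<phi> x is
  invariant and every eigenspace splits. The perturbation only moves the eigenvalue on the line of
  \<phi> x by \<open>c\<close>.\<close>

lemma dim_eigsp:
  assumes x: "x \<in> unit_hor"
  shows "dim (eigsp c x \<mu>) = dim (eigsp' x \<mu>) + (if \<mu> = eigval x + c then 1 else 0)"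
proof -
  have hx: "hor x" and gx: "g x x = 1" using x by (auto simp: unit_hor_def)
  have gp: "g (\<phi> x) (\<phi> x) = 1" using g_\<phi>_\<phi>[OF hx] gx by simp
  have gpx: "g (\<phi> x) x = 0" using g_x_\<phi>[of x] g_sym[of x] by simp
  have nz: "\<phi> x \<noteq> 0" using gp by (auto simp: g_linear)
  \<comment> \<open>The line of \<phi> x if \<open>\<mu>\<close> is its perturbed eigenvalue and
    zero otherwise, written as one set.\<close>
  let ?L = "{a *\<^sub>R \<phi> x |a. a * (eigval x + c - \<mu>) = 0}"
  have sub: "eigsp' x \<mu> \<subseteq> eigsp c x \<mu>"
    by (auto simp: eigsp_def eigsp'_def)
  have eig: "a *\<^sub>R \<phi> x \<in> eigsp c x \<mu> \<longleftrightarrow> a * (eigval x + c - \<mu>) = 0" for a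
  proof -
    have "R (a *\<^sub>R \<phi> x) x x + (c * g (a *\<^sub>R \<phi> x) (\<phi> x)) *\<^sub>R \<phi> x - \<mu> *\<^sub>R a *\<^sub>R \<phi> x
        = (a * (eigval x + c - \<mu>)) *\<^sub>R \<phi> x"
      by (simp add: R_linear g_linear gp eigval[OF x] algebra_simps)
    then have "R (a *\<^sub>R \<phi> x) x x + (c * g (a *\<^sub>R \<phi> x) (\<phi> x)) *\<^sub>R \<phi> x = \<mu> *\<^sub>R a *\<^sub>R \<phi> x
        \<longleftrightarrow> (a * (eigval x + c - \<mu>)) *\<^sub>R \<phi> x = 0"
      by (metis eq_iff_diff_eq_0)
    then show ?thesis
      using nz by (simp add: eigsp_def hor_linear hor_\<phi> g_linear gpx)
  qed
  have decomp: "eigsp c x \<mu> = {a + b |a b. a \<in> eigsp' x \<mu> \<and> b \<in> ?L}"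
  proof (intro equalityI subsetI)
    fix h assume h: "h \<in> eigsp c x \<mu>"
    define a where "a = g h (\<phi> x)"
    define h' where "h' = h - a *\<^sub>R \<phi> x"
    have hh: "hor h" "g h x = 0" and eq: "R h x x + (c * a) *\<^sub>R \<phi> x = \<mu> *\<^sub>R h"
      using h by (auto simp: eigsp_def a_def)
    have "g (R h x x + (c * a) *\<^sub>R \<phi> x) (\<phi> x) = \<mu> * a"
      unfolding eq by (simp add: g_linear a_def)
    moreover have "g (R h x x) (\<phi> x) = eigval x * a"
      unfolding jacobi_sym[of h x "\<phi> x"] eigval[OF x] by (simp add: g_linear a_def g_sym[of "\<phi> x" h])
    ultimately have a0: "a * (eigval x + c - \<mu>) = 0"
      by (simp add: g_linear gp algebra_simps)
    then have "h' \<in> eigsp c x \<mu>"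
      unfolding h'_def using h eig subspace_eigsp subspace_diff by blast
    moreover have "g h' (\<phi> x) = 0" by (simp add: h'_def g_linear gp a_def)
    ultimately have "h' \<in> eigsp' x \<mu>" by (auto simp: eigsp_def eigsp'_def)
    moreover have "h = h' + a *\<^sub>R \<phi> x" by (simp add: h'_def)
    ultimately show "h \<in> {a + b |a b. a \<in> eigsp' x \<mu> \<and> b \<in> ?L}" using a0 by blast
  next
    fix h assume "h \<in> {a + b |a b. a \<in> eigsp' x \<mu> \<and> b \<in> ?L}"
    then obtain u a where "h = u + a *\<^sub>R \<phi> x" "u \<in> eigsp' x \<mu>" "a * (eigval x + c - \<mu>) = 0"
      by blast
    then show "h \<in> eigsp c x \<mu>"
      using sub eig subspace_add[OF subspace_eigsp] by blast
  qed
  have subL: "subspace ?L"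
  proof (cases "eigval x + c - \<mu> = 0")
    case True
    then have "?L = range (\<lambda>a. a *\<^sub>R \<phi> x)" by auto
    then show ?thesis using subspace_span[of "{\<phi> x}"] by (simp add: span_singleton)
  next
    case False
    then have "?L = {0}" by auto
    then show ?thesis by simp
  qed
  have int: "eigsp' x \<mu> \<inter> ?L = {0}"
    using subspace_0[OF subspace_eigsp'] by (auto simp: eigsp'_def g_linear gp)
  have dimL: "dim ?L = (if \<mu> = eigval x + c then 1 else 0)"
  proof (cases "\<mu> = eigval x + c")
    case True
    then have "?L = span {\<phi> x}" by (auto simp: span_singleton)
    then show ?thesis using True nz dim_eq_card[of "{\<phi> x}" "span {\<phi> x}"] by simp
  next
    case False
    then have "?L = {0}" by auto
    then show ?thesis using False by simp
  qed
  show ?thesis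
    unfolding decomp dim_direct_sum[OF subspace_eigsp' subL int] dimL ..
qed

section \<open>Horizontal lifts and the horizontal unit sphere\<close>

lemma P_zero: assumes "\<phi> w = 0" shows "P w = 0"
  using P_isometry[of w w] G_pos[of "P w"] assms by (auto simp: g_linear)

lemma P_hor_inj: assumes "hor w" "P w = 0" shows "w = 0"
proof (rule zero_if_orth_hor[OF _ assms(1)])
  fix v show "g w v = 0"
    using P_isometry[of w v] assms g_\<phi>_\<phi>[of w v] by (simp add: N.g_linear)
qed

lemma lift_exists: "\<exists>lift. linear lift \<and> (\<forall>z. hor (lift z) \<and> P (lift z) = z) \<and> (\<forall>x. hor x \<longrightarrow> lift (P x) = x)"
proof -
  obtain L where L: "linear L" "P \<circ> L = id"
    using linear_surjective_right_inverse[OF linear_P surj_P] by blast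
  \<comment> \<open>Minus the square of \<phi> is the projection onto the horizontal vectors; it
    turns an arbitrary linear right inverse of \<open>P\<close> into the horizontal lift.\<close>
  define lift where "lift z = - \<phi> (\<phi> (L z))" for z
  have "linear lift"
    unfolding lift_def using linear_compose[OF linear_compose[OF L(1) linear_\<phi>] linear_\<phi>]
    by (intro linear_compose_neg) (simp add: o_def)
  moreover have hor: "hor (lift z)" for z
    unfolding lift_def using hor_linear(4)[OF hor_\<phi>, of "-1"] by simp
  moreover have P: "P (lift z) = z" for z
  proof -
    have "P (lift z - L z) = 0"
      by (rule P_zero) (simp add: lift_def \<phi>_linear \<phi>_\<phi>_hor[OF hor_\<phi>])
    then show ?thesis using fun_cong[OF L(2), of z] by (simp add: P_linear)
  qed
  moreover have "lift (P x) = x" if "hor x" for x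
  proof -
    have "lift (P x) - x = 0"
      by (rule P_hor_inj) (simp_all add: hor_linear hor that P_linear P)
    then show ?thesis by simp
  qed
  ultimately show ?thesis by blast
qed

text \<open>The sphere is the image of the punctured tangent space of the base, connected in
  dimension at least two, under lifting and normalising. Positivity of \<open>G\<close> is what
  permits the normalisation, the metric upstairs being indefinite.\<close>

lemma connected_unit_hor: "connected unit_hor"
proof -
  obtain lift where lift: "linear lift" "\<And>z. hor (lift z)" "\<And>z. P (lift z) = z" "\<And>x. hor x \<Longrightarrow> lift (P x) = x"
    using lift_exists by blast
  have gl: "g (lift z) (lift z) = G z z" for z
    using P_isometry[of "lift z" "lift z"] lift g_\<phi>_\<phi>[of "lift z"] by simp
  let ?f = "\<lambda>z. (1 / sqrt (G z z)) *\<^sub>R lift z"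
  have "continuous_on (- {0}) (\<lambda>z. G z z)"
    by (rule continuous_on_linear_family)
      (auto intro: N.linear_g_right linear_continuous_on N.linear_g_left[unfolded linear_conv_bounded_linear])
  then have "continuous_on (- {0}) (\<lambda>z. sqrt (G z z))"
    by (rule continuous_on_real_sqrt)
  moreover have "continuous_on (- {0}) lift"
    using lift(1) linear_continuous_on linear_conv_bounded_linear by blast
  moreover have "\<forall>z\<in>- {0}. sqrt (G z z) \<noteq> 0" using G_pos by fastforce
  ultimately have "continuous_on (- {0}) ?f"
    by (intro continuous_on_scaleR continuous_on_divide continuous_on_const)
  then have "connected (?f ` (- {0}))"
    using connected_continuous_image connected_punctured_universe[OF dim_base] by blast
  moreover have "?f ` (- {0}) = unit_hor"
  proof (intro equalityI subsetI)
    fix x assume "x \<in> ?f ` (- {0})"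
    then obtain z where z: "z \<noteq> 0" "x = ?f z" by auto
    have "g x x = (1 / sqrt (G z z)) * (1 / sqrt (G z z)) * G z z"
      unfolding z(2) by (simp add: g_linear gl)
    also have "\<dots> = 1" using G_pos[OF z(1)] by simp
    finally show "x \<in> unit_hor" using lift(2) z(2) by (simp add: unit_hor_def hor_linear)
  next
    fix x assume x: "x \<in> unit_hor"
    then have "G (P x) (P x) = 1" using P_isometry[of x x] g_\<phi>_\<phi>[of x x] by (simp add: unit_hor_def)
    then have "?f (P x) = x" "P x \<noteq> 0" using lift(4)[of x] x by (auto simp: unit_hor_def N.g_linear)
    then show "x \<in> ?f ` (- {0})" by (intro rev_image_eqI[of "P x"]) simp_all
  qed
  ultimately show ?thesis by simp
qed

lemma continuous_eigval: "continuous_on S eigval"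
proof -
  have lin: "continuous_on S f" if "linear f" for S :: "'e set" and f :: "'e \<Rightarrow> 'b::real_normed_vector"
    using that linear_continuous_on linear_conv_bounded_linear by blast
  have "continuous_on S (\<lambda>x. R (\<phi> x) x v)" for v
    by (rule continuous_on_linear_family)
      (auto intro!: linear_R lin linear_compose[OF linear_\<phi> linear_R(3), unfolded o_def])
  then have 1: "continuous_on S (\<lambda>x. R (\<phi> x) x x)"
    by (rule continuous_on_linear_family[rotated]) (auto intro: linear_R)
  have "continuous_on S (\<lambda>x. g (R (\<phi> x) x x) v)" for v
    using continuous_on_compose2[OF lin[OF linear_g_left, of UNIV] 1] by simp
  then have "continuous_on S (\<lambda>x. g (R (\<phi> x) x x) (\<phi> x))"
    by (rule continuous_on_linear_family[rotated]) (auto intro: linear_g_right lin linear_\<phi>)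
  then show ?thesis unfolding eigval_def .
qed

definition const_dims :: "real \<Rightarrow> bool" where
  "const_dims c \<longleftrightarrow> (\<forall>x\<in>unit_hor. \<forall>x'\<in>unit_hor. \<forall>\<mu>. dim (eigsp c x \<mu>) = dim (eigsp c x' \<mu>))"

text \<open>\<open>eigval\<close> is continuous on a connected set and takes only finitely many values.\<close>
lemma eigval_const:
  assumes "const_dims c" "x \<in> unit_hor" "x' \<in> unit_hor"
  shows "eigval x = eigval x'"
proof -
  let ?L = "\<lambda>h. R h x x + (c * g h (\<phi> x)) *\<^sub>R \<phi> x"
  have "linear ?L"
    by (rule linearI) (auto simp: R_linear g_linear algebra_simps)
  then have fin: "finite {\<mu>. \<exists>v. v \<noteq> 0 \<and> ?L v = \<mu> *\<^sub>R v}" by (rule finite_eigenvalues)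
  \<comment> \<open>This number is an eigenvalue at \<open>y\<close>; constancy of the dimensions
    makes it an eigenvalue at the fixed vector \<open>x\<close>, whose operator has finitely
    many.\<close>
  have "eigval y + c \<in> {\<mu>. \<exists>v. v \<noteq> 0 \<and> ?L v = \<mu> *\<^sub>R v}" if "y \<in> unit_hor" for y
  proof -
    have "dim (eigsp c x (eigval y + c)) = dim (eigsp c y (eigval y + c))"
      using assms that unfolding const_dims_def by blast
    also have "\<dots> \<noteq> 0" by (simp add: dim_eigsp[OF that])
    finally obtain v where "v \<in> eigsp c x (eigval y + c)" "v \<noteq> 0"
      using dim_eq_0 by (metis singletonI subsetI)
    then show ?thesis by (auto simp: eigsp_def)
  qed
  then have "eigval ` unit_hor \<subseteq> (\<lambda>\<mu>. \<mu> - c) ` {\<mu>. \<exists>v. v \<noteq> 0 \<and> ?L v = \<mu> *\<^sub>R v}"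
    by force
  then have "finite (eigval ` unit_hor)"
    using fin finite_surj by blast
  then have "eigval constant_on unit_hor"
    using continuous_finite_range_constant[OF connected_unit_hor continuous_eigval] by blast
  then show ?thesis using assms unfolding constant_on_def by metis
qed

text \<open>Once \<open>eigval\<close> is constant, the extra 1 in \<open>dim_eigsp\<close> occurs
  at the same \<open>\<mu>\<close> for all \<open>x\<close>, so the dimensions of
  \<open>eigsp'\<close> are constant. These do not involve \<open>c\<close>, which can then be
  replaced by \<open>d\<close>.\<close>

lemma const_dims_imp:
  assumes "const_dims c" shows "const_dims d"
  unfolding const_dims_def
proof (intro ballI allI)
  fix x x' \<mu> assume x: "x \<in> unit_hor" "x' \<in> unit_hor"
  have "eigval x = eigval x'" using eigval_const[OF assms x] .
  moreover have "dim (eigsp c x \<mu>) = dim (eigsp c x' \<mu>)"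
    using assms x unfolding const_dims_def by blast
  ultimately show "dim (eigsp d x \<mu>) = dim (eigsp d x' \<mu>)"
    unfolding dim_eigsp[OF x(1)] dim_eigsp[OF x(2)] by (simp split: if_splits)
qed

text \<open>\<open>P\<close> maps horizontal vectors isomorphically and isometrically onto the base
  tangent space, and O'Neill's formula says that it intertwines the perturbed operator for c = 3
  \<Sum>\<epsilon> with the Jacobi operator of the base.\<close>

lemma dim_base_eigenspace:
  assumes x: "x \<in> unit_hor"
  shows "dim {y. G y (P x) = 0 \<and> RN y (P x) (P x) = \<mu> *\<^sub>R y} = dim (eigsp (3 * (\<Sum>\<alpha>\<in>UNIV. \<epsilon> \<alpha>)) x \<mu>)"
proof -
  let ?c = "3 * (\<Sum>\<alpha>\<in>UNIV. \<epsilon> \<alpha>)"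
  obtain lift where lift: "linear lift" "\<And>z. hor (lift z)" "\<And>z. P (lift z) = z" "\<And>x. hor x \<Longrightarrow> lift (P x) = x"
    using lift_exists by blast
  have hx: "hor x" using x by (simp add: unit_hor_def)
  have eq: "P h \<in> {y. G y (P x) = 0 \<and> RN y (P x) (P x) = \<mu> *\<^sub>R y} \<longleftrightarrow> h \<in> eigsp ?c x \<mu>" if h: "hor h" for h
  proof -
    let ?w = "R h x x + (?c * g h (\<phi> x)) *\<^sub>R \<phi> x - \<mu> *\<^sub>R h"
    have "hor ?w" by (intro hor_linear hor_jacobi hx h hor_\<phi>)
    then have "P ?w = 0 \<longleftrightarrow> ?w = 0" using P_hor_inj linear_0[OF linear_P] by metis
    moreover have "P ?w = RN (P h) (P x) (P x) - \<mu> *\<^sub>R P h"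
      unfolding oneill[OF hx h] linear_diff[OF linear_P] linear_cmul[OF linear_P] ..
    ultimately have "RN (P h) (P x) (P x) = \<mu> *\<^sub>R P h \<longleftrightarrow> R h x x + (?c * g h (\<phi> x)) *\<^sub>R \<phi> x = \<mu> *\<^sub>R h"
      by simp
    then show ?thesis
      using P_isometry[of h x] g_\<phi>_\<phi>[OF h, of x] h by (simp add: eigsp_def)
  qed
  have "{y. G y (P x) = 0 \<and> RN y (P x) (P x) = \<mu> *\<^sub>R y} = P ` eigsp ?c x \<mu>" (is "?A = _")
  proof (intro equalityI subsetI)
    fix y assume "y \<in> ?A"
    then have "lift y \<in> eigsp ?c x \<mu>" using eq[OF lift(2), of y] lift(3) by simp
    then show "y \<in> P ` eigsp ?c x \<mu>" using lift(3) by (metis image_eqI)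
  next
    fix y assume "y \<in> P ` eigsp ?c x \<mu>"
    then show "y \<in> ?A" using eq by (auto simp: eigsp_def)
  qed
  moreover have "inj_on P (span (eigsp ?c x \<mu>))"
    unfolding span_eq_iff[THEN iffD2, OF subspace_eigsp]
    by (rule inj_on_inverseI[where g=lift]) (use lift(4) in \<open>auto simp: eigsp_def\<close>)
  ultimately show ?thesis using dim_image_eq[OF linear_P] by simp
qed

lemma osserman_base:
  "(\<forall>z z'. G z z = 1 \<longrightarrow> G z' z' = 1 \<longrightarrow>
      (\<forall>\<mu>. dim {y. G y z = 0 \<and> RN y z z = \<mu> *\<^sub>R y} = dim {y. G y z' = 0 \<and> RN y z' z' = \<mu> *\<^sub>R y}))
    \<longleftrightarrow> const_dims (3 * (\<Sum>\<alpha>\<in>UNIV. \<epsilon> \<alpha>))" (is "?l \<longleftrightarrow> ?r")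
proof -
  have 1: "G (P x) (P x) = 1" if "x \<in> unit_hor" for x
    using that P_isometry[of x x] g_\<phi>_\<phi>[of x x] by (simp add: unit_hor_def)
  have 2: "\<exists>x\<in>unit_hor. z = P x" if "G z z = 1" for z
  proof -
    obtain x where "hor x" "P x = z" using lift_exists by metis
    then show ?thesis using that P_isometry[of x x] g_\<phi>_\<phi>[of x x] by (auto simp: unit_hor_def)
  qed
  show ?thesis
  proof
    assume l: ?l
    show ?r
      unfolding const_dims_def
    proof (intro ballI allI)
      fix x x' \<mu> assume x: "x \<in> unit_hor" "x' \<in> unit_hor"
      show "dim (eigsp (3 * (\<Sum>\<alpha>\<in>UNIV. \<epsilon> \<alpha>)) x \<mu>) = dim (eigsp (3 * (\<Sum>\<alpha>\<in>UNIV. \<epsilon> \<alpha>)) x' \<mu>)"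
        using l[rule_format, OF 1[OF x(1)] 1[OF x(2)], of \<mu>]
        unfolding dim_base_eigenspace[OF x(1)] dim_base_eigenspace[OF x(2)] .
    qed
  next
    assume r: ?r
    show ?l
    proof (intro allI impI)
      fix z z' \<mu> assume z: "G z z = 1" "G z' z' = 1"
      obtain x where x: "x \<in> unit_hor" "z = P x" using 2[OF z(1)] by blast
      obtain x' where x': "x' \<in> unit_hor" "z' = P x'" using 2[OF z(2)] by blast
      show "dim {y. G y z = 0 \<and> RN y z z = \<mu> *\<^sub>R y} = dim {y. G y z' = 0 \<and> RN y z' z' = \<mu> *\<^sub>R y}"
        unfolding x(2) x'(2) dim_base_eigenspace[OF x(1)] dim_base_eigenspace[OF x'(1)]
        using r x(1) x'(1) unfolding const_dims_def by blast
    qed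
  qed
qed

section \<open>The null Jacobi operator\<close>

definition \<kappa> :: 'e where "\<kappa> = (\<Sum>\<alpha>\<in>UNIV. \<xi> \<alpha>) - \<xi> \<alpha>\<^sub>1"

text \<open>The eigenspaces of the part of the null Jacobi operator acting on the remaining
  characteristic vectors; it does not depend on the null vector.\<close>
definition eigsp_\<xi> :: "real \<Rightarrow> 'e set" where
  "eigsp_\<xi> \<mu> = {k. \<phi> k = 0 \<and> g k (\<xi> \<alpha>\<^sub>1) = 0 \<and> (\<Sum>\<beta>\<in>UNIV. g k (\<xi> \<beta>)) *\<^sub>R \<kappa> = \<mu> *\<^sub>R k}"

lemma subspace_eigsp_\<xi>: "subspace (eigsp_\<xi> \<mu>)"
proof -
  let ?L = "\<lambda>k. (\<Sum>\<beta>\<in>UNIV. g k (\<xi> \<beta>)) *\<^sub>R \<kappa> - \<mu> *\<^sub>R k"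
  have L: "linear ?L"
    by (rule linearI) (simp_all add: g_linear sum.distrib algebra_simps flip: sum_distrib_left)
  have "eigsp_\<xi> \<mu> = {k. \<phi> k = 0 \<and> g k (\<xi> \<alpha>\<^sub>1) = 0 \<and> ?L k = 0}"
    by (auto simp: eigsp_\<xi>_def)
  moreover have "subspace {k. \<phi> k = 0 \<and> g k (\<xi> \<alpha>\<^sub>1) = 0 \<and> ?L k = 0}"
    by (rule subspaceI)
      (simp_all only: mem_Collect_eq linear_add[OF L] linear_cmul[OF L] linear_0[OF L], simp_all add: \<phi>_linear g_linear)
  ultimately show ?thesis by simp
qed

lemma vertical_expand:
  assumes "\<phi> k = 0" shows "k = (\<Sum>\<beta>\<in>UNIV. (\<epsilon> \<beta> * g k (\<xi> \<beta>)) *\<^sub>R \<xi> \<beta>)"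
  using \<phi>_\<phi>[of k] assms by (simp add: \<phi>_linear)

lemma eq_if_inner_eq:
  assumes "\<And>w. hor w \<Longrightarrow> g a w = g b w" "\<And>\<beta>. g a (\<xi> \<beta>) = g b (\<xi> \<beta>)"
  shows "a = b"
proof -
  have "a - b = 0"
    by (rule zero_if_orth_hor) (use assms in \<open>auto simp: g_linear hor_def\<close>)
  then show ?thesis by simp
qed

lemma g_sum_\<xi>: "g (\<Sum>\<alpha>\<in>UNIV. \<xi> \<alpha>) (\<xi> \<beta>) = \<epsilon> \<beta>"
  by (simp add: g_linear g_\<xi>_\<xi>)

lemma g_vertical_hor: "\<phi> k = 0 \<Longrightarrow> hor w \<Longrightarrow> g k w = 0"
  by (subst vertical_expand) (auto simp: g_linear g_sym[of "\<xi> _"] hor_def)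

text \<open>Curvature is known when a characteristic vector stands in the last slot. Pair symmetry
  and skewness bring one there from any other slot, and \<open>eq_if_inner_eq\<close> reassembles
  the vector; the next two lemmas proceed likewise.\<close>

lemma R_hor_\<xi>_hor:
  assumes "hor h" "hor x" "g h x = 0"
  shows "R h (\<xi> \<alpha>) x = 0"
proof (rule eq_if_inner_eq)
  show "g (R h (\<xi> \<alpha>) x) w = g 0 w" if "hor w" for w
    using R_pair[of h "\<xi> \<alpha>" x w] R_skew[of x w h "\<xi> \<alpha>"] R_hor_hor[OF assms(2) that] by (simp add: g_linear)
  show "g (R h (\<xi> \<alpha>) x) (\<xi> \<beta>) = g 0 (\<xi> \<beta>)" for \<beta>
    using R_skew[of h "\<xi> \<alpha>" x "\<xi> \<beta>"] R_hor_\<xi>[OF assms(1)] assms(3) by (simp add: g_linear)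
qed

lemma R_\<xi>_\<xi>_hor: "hor x \<Longrightarrow> R (\<xi> \<beta>) (\<xi> \<alpha>) x = 0"
proof (rule eq_if_inner_eq)
  assume x: "hor x"
  show "g (R (\<xi> \<beta>) (\<xi> \<alpha>) x) w = g 0 w" if "hor w" for w
    using R_pair[of "\<xi> \<beta>" "\<xi> \<alpha>" x w] R_hor_hor[OF x that] by (simp add: g_linear)
  show "g (R (\<xi> \<beta>) (\<xi> \<alpha>) x) (\<xi> \<gamma>) = g 0 (\<xi> \<gamma>)" for \<gamma>
    using R_skew[of "\<xi> \<beta>" "\<xi> \<alpha>" x "\<xi> \<gamma>"] by (simp add: g_linear R_\<xi>_\<xi>)
qed

lemma R_\<xi>_hor_hor:
  assumes x: "x \<in> unit_hor"
  shows "R (\<xi> \<beta>) x x = \<epsilon> \<beta> *\<^sub>R (\<Sum>\<alpha>\<in>UNIV. \<xi> \<alpha>)"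
proof (rule eq_if_inner_eq)
  have hx: "hor x" "g x x = 1" using x by (auto simp: unit_hor_def)
  show "g (R (\<xi> \<beta>) x x) w = g (\<epsilon> \<beta> *\<^sub>R (\<Sum>\<alpha>\<in>UNIV. \<xi> \<alpha>)) w" if "hor w" for w
    using R_pair[of "\<xi> \<beta>" x x w] R_hor_hor[OF hx(1) that] that
    by (simp add: g_linear g_sym[of "\<xi> _"] hor_def)
  show "g (R (\<xi> \<beta>) x x) (\<xi> \<gamma>) = g (\<epsilon> \<beta> *\<^sub>R (\<Sum>\<alpha>\<in>UNIV. \<xi> \<alpha>)) (\<xi> \<gamma>)" for \<gamma>
    using R_pair[of "\<xi> \<beta>" x x "\<xi> \<gamma>"] R_hor_\<xi>[OF hx(1)] hx(2) by (simp add: g_linear g_sum_\<xi> g_\<xi>_\<xi>)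
qed

lemma null_jacobi_hor:
  assumes x: "x \<in> unit_hor" and h: "hor h" "g h x = 0"
  shows "R h (\<xi> \<alpha>\<^sub>1 + x) (\<xi> \<alpha>\<^sub>1 + x) = h + R h x x"
  using R_hor_\<xi>[OF h(1)] R_hor_hor[OF h(1), of x] R_hor_\<xi>_hor[OF h(1) _ h(2)] x
  by (simp add: R_linear \<epsilon>_1 unit_hor_def)

text \<open>Modulo u = \<open>\<xi> \<alpha>\<^sub>1 + x\<close> every \<xi>_\<beta> is sent to
  \<epsilon>_\<beta> \<kappa>, which is where \<kappa> comes from. The representative on the right
  displays the multiple of u that the quotient discards.\<close>

lemma null_jacobi_\<xi>:
  assumes x: "x \<in> unit_hor"
  shows "R (\<xi> \<beta>) (\<xi> \<alpha>\<^sub>1 + x) (\<xi> \<alpha>\<^sub>1 + x) = \<epsilon> \<beta> *\<^sub>R (\<xi> \<alpha>\<^sub>1 + x + \<kappa>)"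
proof -
  have hx: "hor x" using x by (simp add: unit_hor_def)
  have "R (\<xi> \<beta>) x (\<xi> \<alpha>\<^sub>1) = \<epsilon> \<beta> *\<^sub>R x"
    using R_anti[of "\<xi> \<beta>" x "\<xi> \<alpha>\<^sub>1"] R_hor_\<xi>[OF hx] by (simp add: \<epsilon>_1)
  then show ?thesis
    using R_\<xi>_\<xi>_hor[OF hx] R_\<xi>_hor_hor[OF x] by (simp add: R_linear R_\<xi>_\<xi> \<kappa>_def scaleR_add_right)
qed

lemma null_jacobi_vertical:
  assumes x: "x \<in> unit_hor" and k: "\<phi> k = 0"
  shows "R k (\<xi> \<alpha>\<^sub>1 + x) (\<xi> \<alpha>\<^sub>1 + x) = (\<Sum>\<beta>\<in>UNIV. g k (\<xi> \<beta>)) *\<^sub>R (\<xi> \<alpha>\<^sub>1 + x + \<kappa>)"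
proof -
  let ?u = "\<xi> \<alpha>\<^sub>1 + x"
  have e: "c * \<epsilon> \<beta> * \<epsilon> \<beta> = c" for c \<beta>
    unfolding mult.assoc \<epsilon> by simp
  have "R k ?u ?u = (\<Sum>\<beta>\<in>UNIV. (\<epsilon> \<beta> * g k (\<xi> \<beta>)) *\<^sub>R R (\<xi> \<beta>) ?u ?u)"
    by (subst vertical_expand[OF k]) (simp only: linear_sum[OF linear_R(3)] linear_cmul[OF linear_R(3)])
  also have "\<dots> = (\<Sum>\<beta>\<in>UNIV. g k (\<xi> \<beta>) *\<^sub>R (?u + \<kappa>))"
    unfolding null_jacobi_\<xi>[OF x] scaleR_scaleR mult.commute[of "\<epsilon> _" "g k _"] e ..
  finally show ?thesis by (simp only: scaleR_sum_left)
qed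

lemma \<phi>_\<kappa>: "\<phi> \<kappa> = 0" and g_\<kappa>_\<xi>: "g \<kappa> (\<xi> \<alpha>\<^sub>1) = 0"
  by (simp_all add: \<kappa>_def \<phi>_linear \<phi>_\<xi> g_linear g_sum_\<xi> g_\<xi>_\<xi>)

text \<open>The set is the preimage in the orthogonal space of \<open>u\<close> of an eigenspace of
  the quotient, so it contains the line of \<open>u\<close>, counted by the summand 1. The shift to
  \<open>\<mu> - 1\<close> comes from the summand \<open>h\<close> in
  \<open>null_jacobi_hor\<close>.\<close>

lemma dim_null_eigenspace:
  assumes x: "x \<in> unit_hor"
  defines "u \<equiv> \<xi> \<alpha>\<^sub>1 + x"
  shows "dim {y. g y u = 0 \<and> R y u u - \<mu> *\<^sub>R y \<in> span {u}} = 1 + dim (eigsp 0 x (\<mu> - 1)) + dim (eigsp_\<xi> \<mu>)"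
proof -
  have hx: "hor x" and gx: "g x x = 1" using x by (auto simp: unit_hor_def)
  have x\<xi>: "g x (\<xi> \<beta>) = 0" "g (\<xi> \<beta>) x = 0" for \<beta> using hx g_sym[of x] by (auto simp: hor_def)
  have u\<xi>: "g u (\<xi> \<alpha>\<^sub>1) = - 1" "g (\<xi> \<alpha>\<^sub>1) u = - 1" and ux: "g u x = 1" "g x u = 1" and uu: "g u u = 0"
    by (simp_all add: u_def g_linear g_\<xi>_\<xi> \<epsilon>_1 x\<xi> gx)
  have u0: "u \<noteq> 0" using ux by (auto simp: g_linear)
  define E where "E = eigsp 0 x (\<mu> - 1)"
  define K where "K = eigsp_\<xi> \<mu>"
  have E: "h \<in> E \<longleftrightarrow> hor h \<and> g h x = 0 \<and> R h x x = (\<mu> - 1) *\<^sub>R h" for h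
    by (simp add: E_def eigsp_def)
  \<comment> \<open>Every vector orthogonal to \<open>u\<close> has this form. Modulo
    \<open>u\<close> the operator preserves the horizontal and the vertical summand, so the
    eigenvalue equation decouples.\<close>
  have crit: "t *\<^sub>R u + h + k \<in> {y. g y u = 0 \<and> R y u u - \<mu> *\<^sub>R y \<in> span {u}} \<longleftrightarrow> h \<in> E \<and> k \<in> K"
    if h: "hor h" "g h x = 0" and k: "\<phi> k = 0" "g k (\<xi> \<alpha>\<^sub>1) = 0" for t h k
  proof -
    let ?s = "\<Sum>\<beta>\<in>UNIV. g k (\<xi> \<beta>)"
    let ?a = "R h x x - (\<mu> - 1) *\<^sub>R h" and ?b = "?s *\<^sub>R \<kappa> - \<mu> *\<^sub>R k"
    have orth: "g (t *\<^sub>R u + h + k) u = 0"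
      using h k g_vertical_hor[OF k(1) hx] by (simp add: g_linear uu) (simp add: u_def g_linear hor_def)
    have "R (t *\<^sub>R u + h + k) u u = h + R h x x + ?s *\<^sub>R (u + \<kappa>)"
      using null_jacobi_hor[OF x h] null_jacobi_vertical[OF x k(1)]
      by (simp add: R_linear R_self flip: u_def)
    then have "R (t *\<^sub>R u + h + k) u u - \<mu> *\<^sub>R (t *\<^sub>R u + h + k) = (?s - \<mu> * t) *\<^sub>R u + (?a + ?b)"
      by (simp add: algebra_simps)
    moreover have "(?s - \<mu> * t) *\<^sub>R u \<in> span {u}" by (intro span_mul span_base) simp
    ultimately have "R (t *\<^sub>R u + h + k) u u - \<mu> *\<^sub>R (t *\<^sub>R u + h + k) \<in> span {u} \<longleftrightarrow> ?a + ?b \<in> span {u}"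
      using span_add_eq by metis
    \<comment> \<open>\<open>?a + ?b\<close> is orthogonal to \<open>\<xi> \<alpha>\<^sub>1\<close>
      but \<open>u\<close> is not, so its multiple is zero. Then \<open>?a = - ?b\<close> is both
      horizontal and in the kernel of \<phi>.\<close>
    also have "\<dots> \<longleftrightarrow> ?a = 0 \<and> ?b = 0"
    proof
      have ha: "hor ?a" by (intro hor_linear hor_jacobi hx h)
      have hb: "\<phi> ?b = 0" by (simp add: \<phi>_linear \<phi>_\<kappa> k)
      assume "?a + ?b \<in> span {u}"
      then obtain c where c: "?a + ?b = c *\<^sub>R u" by (auto simp: span_singleton)
      have "g (?a + ?b) (\<xi> \<alpha>\<^sub>1) = 0"
        using ha k(2) g_\<kappa>_\<xi> by (simp only: linear_add[OF linear_g_left] hor_def) (simp add: g_linear)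
      then have "c = 0" unfolding c by (simp add: g_linear u\<xi>)
      then have ab: "?a = - ?b" using c by (intro eq_neg_iff_add_eq_0[THEN iffD2]) simp
      have "\<phi> ?a = 0" unfolding ab linear_neg[OF linear_\<phi>] hb by simp
      then have "?a = 0" using zero_if_hor_kernel[OF ha] by blast
      then show "?a = 0 \<and> ?b = 0" using ab by simp
    qed (simp add: span_0)
    finally show ?thesis
      using orth h k by (simp add: E K_def eigsp_\<xi>_def)
  qed
  have decomp: "{y. g y u = 0 \<and> R y u u - \<mu> *\<^sub>R y \<in> span {u}} = {a + k |a k. a \<in> {t + h |t h. t \<in> span {u} \<and> h \<in> E} \<and> k \<in> K}" (is "?W = ?S")
  proof (intro equalityI subsetI)
    fix y assume y: "y \<in> ?W"
    \<comment> \<open>The coefficient of \<open>u\<close> is read off from the timelike component,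
      with a minus sign as \<open>\<epsilon> \<alpha>\<^sub>1 = - 1\<close>. \<open>h\<close> and
      \<open>k\<close> are the horizontal and vertical parts of what remains.\<close>
    define t where "t = - g y (\<xi> \<alpha>\<^sub>1)"
    define h where "h = - \<phi> (\<phi> y) - t *\<^sub>R x"
    define k where "k = y + \<phi> (\<phi> y) - t *\<^sub>R \<xi> \<alpha>\<^sub>1"
    have yt: "y = t *\<^sub>R u + h + k" by (simp add: h_def k_def u_def algebra_simps)
    have hh: "hor h"
      unfolding h_def using hor_linear(4)[OF hor_\<phi>, of "-1"] by (intro hor_linear hx) simp
    have k1: "\<phi> k = 0"
      by (simp add: k_def \<phi>_linear \<phi>_\<xi> \<phi>_\<phi>_hor[OF hor_\<phi>])
    have k2: "g k (\<xi> \<alpha>\<^sub>1) = 0"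
      by (simp add: k_def t_def g_linear g_\<phi>_\<xi> g_\<xi>_\<xi> \<epsilon>_1)
    have "g y x = t"
      using y by (simp add: u_def g_linear t_def)
    then have "g h x = 0"
      using g_\<phi>_\<phi>[OF hx, of y] \<phi>_skew[of "\<phi> y" x] g_sym[of x y] g_sym[of "\<phi> x" "\<phi> y"]
      by (simp add: h_def g_linear gx)
    then have "h \<in> E \<and> k \<in> K" using crit[OF hh _ k1 k2, of t] y yt by simp
    then show "y \<in> ?S" unfolding yt by (blast intro: span_mul[OF span_base])
  next
    fix y assume "y \<in> ?S"
    then obtain s h k where s: "y = s + h + k" "s \<in> span {u}" "h \<in> E" "k \<in> K" by blast
    obtain t where "s = t *\<^sub>R u" using s(2) by (auto simp: span_singleton)
    moreover have "\<phi> k = 0" "g k (\<xi> \<alpha>\<^sub>1) = 0" using s(4) by (auto simp: K_def eigsp_\<xi>_def)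
    ultimately show "y \<in> ?W" using crit[of h k t] s E by simp
  qed
  have sE: "subspace E" and sK: "subspace K"
    unfolding E_def K_def by (rule subspace_eigsp, rule subspace_eigsp_\<xi>)
  have uE: "span {u} \<inter> E = {0}"
  proof -
    have "c = 0" if "c *\<^sub>R u \<in> E" for c
      using that E[of "c *\<^sub>R u"] u\<xi> by (auto simp: hor_def g_linear)
    then show ?thesis using subspace_0[OF sE] by (auto simp: span_singleton)
  qed
  have sub1: "subspace {t + h |t h. t \<in> span {u} \<and> h \<in> E}"
    using subspace_sums[OF subspace_span sE] .
  have int: "{t + h |t h. t \<in> span {u} \<and> h \<in> E} \<inter> K = {0}"
  proof -
    have "t + h = 0" if t: "t \<in> span {u}" and h: "h \<in> E" and k: "t + h \<in> K" for t h
    proof -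
      obtain c where c: "t = c *\<^sub>R u" using t by (auto simp: span_singleton)
      have "g (t + h) (\<xi> \<alpha>\<^sub>1) = 0" "\<phi> (t + h) = 0" using k by (auto simp: K_def eigsp_\<xi>_def)
      moreover have "g (t + h) (\<xi> \<alpha>\<^sub>1) = - c"
        using h E by (simp add: c g_linear u\<xi> hor_def)
      ultimately have "t = 0" "\<phi> h = 0" using c by auto
      then show ?thesis using zero_if_hor_kernel[of h] h E by simp
    qed
    then show ?thesis
      using subspace_0[OF sub1] subspace_0[OF sK] by blast
  qed
  have "dim ?W = dim (span {u}) + dim E + dim K"
    unfolding decomp dim_direct_sum[OF sub1 sK int] dim_direct_sum[OF subspace_span sE uE] ..
  moreover have "dim (span {u}) = 1"
    using u0 dim_eq_card[of "{u}" "span {u}"] by simp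
  ultimately show ?thesis by (simp add: E_def K_def)
qed

text \<open>Subtracting 1 passes to the quotient by the null line and is never truncated, by
  \<open>dim_null_eigenspace\<close>. The contribution \<open>eigsp_\<xi>\<close> is the same for
  all \<open>x\<close>, and \<open>\<mu> - 1\<close> runs through all reals, so the left side is
  \<open>const_dims 0\<close>; \<open>const_dims_imp\<close> exchanges 0 and 3 \<Sum>\<epsilon> in
  both directions.\<close>

theorem null_osserman_iff_base_osserman:
  "(\<forall>x\<in>unit_hor. \<forall>x'\<in>unit_hor. \<forall>\<mu>.
      dim {y. g y (\<xi> \<alpha>\<^sub>1 + x) = 0 \<and> R y (\<xi> \<alpha>\<^sub>1 + x) (\<xi> \<alpha>\<^sub>1 + x) - \<mu> *\<^sub>R y \<in> span {\<xi> \<alpha>\<^sub>1 + x}} - 1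
    = dim {y. g y (\<xi> \<alpha>\<^sub>1 + x') = 0 \<and> R y (\<xi> \<alpha>\<^sub>1 + x') (\<xi> \<alpha>\<^sub>1 + x') - \<mu> *\<^sub>R y \<in> span {\<xi> \<alpha>\<^sub>1 + x'}} - 1)
  \<longleftrightarrow> (\<forall>z z'. G z z = 1 \<longrightarrow> G z' z' = 1 \<longrightarrow>
      (\<forall>\<mu>. dim {y. G y z = 0 \<and> RN y z z = \<mu> *\<^sub>R y} = dim {y. G y z' = 0 \<and> RN y z' z' = \<mu> *\<^sub>R y}))"
  (is "?l \<longleftrightarrow> ?r")
proof -
  have "?l \<longleftrightarrow> const_dims 0"
  proof -
    have "(\<forall>\<mu>. dim (eigsp 0 x (\<mu> - 1)) = dim (eigsp 0 x' (\<mu> - 1))) \<longleftrightarrow> (\<forall>\<mu>. dim (eigsp 0 x \<mu>) = dim (eigsp 0 x' \<mu>))" for x x'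
      by (metis add_diff_cancel_right')
    then show ?thesis
      unfolding const_dims_def by (simp add: dim_null_eigenspace)
  qed
  also have "\<dots> \<longleftrightarrow> ?r"
    unfolding osserman_base using const_dims_imp by blast
  finally show ?thesis .
qed

end

section \<open>Coordinate expressions on manifolds\<close>

lemma Ck_on_subset: "Ck_on k S f \<Longrightarrow> T \<subseteq> S \<Longrightarrow> Ck_on k T f"
  by (induction k arbitrary: f) (auto intro: continuous_on_subset)

lemma smooth_on_subset: "smooth_on S f \<Longrightarrow> T \<subseteq> S \<Longrightarrow> smooth_on T f"
  by (auto simp: smooth_on_def intro: Ck_on_subset)

locale manifold =
  fixes A :: "('m::{t2_space, second_countable_topology}, 'e::euclidean_space) atlas"
  assumes manifold: "smooth_manifold A"
begin

lemma chart_at: "chart_at A q \<in> A" "q \<in> fst (chart_at A q)"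
proof -
  have "\<exists>\<kappa>. \<kappa> \<in> A \<and> q \<in> fst \<kappa>"
    using manifold unfolding smooth_manifold_def by blast
  then have "chart_at A q \<in> A \<and> q \<in> fst (chart_at A q)"
    unfolding chart_at_def by (rule someI_ex)
  then show "chart_at A q \<in> A" "q \<in> fst (chart_at A q)" by auto
qed

lemma chart:
  assumes "\<kappa> \<in> A"
  shows open_domain: "open (fst \<kappa>)" and open_chart_image: "open (chart_image \<kappa>)"
    and chart_homeo: "homeomorphism (fst \<kappa>) (chart_image \<kappa>) (snd \<kappa>) (chart_inv \<kappa>)"
  using assms manifold unfolding smooth_manifold_def is_chart_def by auto

lemma chart_inv_chart: "\<kappa> \<in> A \<Longrightarrow> q \<in> fst \<kappa> \<Longrightarrow> chart_inv \<kappa> (snd \<kappa> q) = q"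
  using chart_homeo homeomorphism_apply1 by metis

lemma chart_chart_inv: "\<kappa> \<in> A \<Longrightarrow> y \<in> chart_image \<kappa> \<Longrightarrow> snd \<kappa> (chart_inv \<kappa> y) = y"
  using chart_homeo homeomorphism_apply2 by metis

lemma chart_inv_in: "\<kappa> \<in> A \<Longrightarrow> y \<in> chart_image \<kappa> \<Longrightarrow> chart_inv \<kappa> y \<in> fst \<kappa>"
  using homeomorphism_image2[OF chart_homeo, of \<kappa>] by blast

lemma open_image_chart:
  assumes "\<kappa> \<in> A" "open S" shows "open (snd \<kappa> ` (fst \<kappa> \<inter> S))"
proof -
  have "openin (top_of_set (fst \<kappa>)) (fst \<kappa> \<inter> S)"
    using assms(2) by (rule openin_open_Int)
  then have "openin (top_of_set (chart_image \<kappa>)) (snd \<kappa> ` (fst \<kappa> \<inter> S))"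
    using homeomorphism_imp_open_map[OF chart_homeo[OF assms(1)]] by blast
  then show ?thesis
    using open_chart_image[OF assms(1)] openin_open_trans by blast
qed

lemma transition_differentiable:
  assumes "\<kappa> \<in> A" "\<kappa>' \<in> A" "q \<in> fst \<kappa>" "q \<in> fst \<kappa>'"
  shows "(snd \<kappa>' \<circ> chart_inv \<kappa>) differentiable (at (snd \<kappa> q))"
proof -
  have "compatible \<kappa> \<kappa>'" using manifold assms unfolding smooth_manifold_def by blast
  then have "smooth_on (snd \<kappa> ` (fst \<kappa> \<inter> fst \<kappa>')) (snd \<kappa>' \<circ> chart_inv \<kappa>)"
    by (simp add: compatible_def)
  then show ?thesis
    using smooth_on_differentiable assms(3,4) by blast
qed

lemma transition_self:
  assumes "\<kappa> \<in> A" "q \<in> fst \<kappa>"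
  shows "fd (snd \<kappa> \<circ> chart_inv \<kappa>) (snd \<kappa> q) = (\<lambda>v. v)"
proof -
  have "fd (snd \<kappa> \<circ> chart_inv \<kappa>) (snd \<kappa> q) = fd (\<lambda>y. y) (snd \<kappa> q)"
    by (rule fd_cong_open[OF open_chart_image[OF assms(1)]])
      (use assms chart_chart_inv in \<open>auto simp: chart_image_def\<close>)
  then show ?thesis by simp
qed

text \<open>Two transition maps are mutually inverse on the overlap of the domains, which has an
  open image in either chart; the chain rule makes their derivatives inverse too.\<close>

lemma to_from_chart:
  assumes \<kappa>: "\<kappa> \<in> A" and q: "q \<in> fst \<kappa>"
  shows linear_to_chart: "linear (to_chart A \<kappa> q)" and linear_from_chart: "linear (from_chart A \<kappa> q)"
    and to_from: "to_chart A \<kappa> q (from_chart A \<kappa> q v) = v"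
    and from_to: "from_chart A \<kappa> q (to_chart A \<kappa> q v) = v"
proof -
  let ?c = "chart_at A q"
  note c = chart_at[of q]
  note d1 = transition_differentiable[OF c(1) \<kappa> c(2) q] and d2 = transition_differentiable[OF \<kappa> c(1) q c(2)]
  show "linear (to_chart A \<kappa> q)" "linear (from_chart A \<kappa> q)"
    unfolding to_chart_def from_chart_def by (intro linear_frechet_derivative d1 d2)+
  have comp: "fd (snd b \<circ> chart_inv a) (snd a q) (fd (snd a \<circ> chart_inv b) (snd b q) v) = v"
    if a: "a \<in> A" "q \<in> fst a" and b: "b \<in> A" "q \<in> fst b" for a b v
  proof -
    have q': "(snd a \<circ> chart_inv b) (snd b q) = snd a q" by (simp add: chart_inv_chart b)
    have d: "(snd b \<circ> chart_inv a) differentiable (at ((snd a \<circ> chart_inv b) (snd b q)))"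
      unfolding q' by (rule transition_differentiable[OF a(1) b(1) a(2) b(2)])
    have "fd (\<lambda>y. (snd b \<circ> chart_inv a) ((snd a \<circ> chart_inv b) y)) (snd b q) v
        = fd (snd b \<circ> chart_inv a) (snd a q) (fd (snd a \<circ> chart_inv b) (snd b q) v)"
      using fd_compose(1)[OF d transition_differentiable[OF b(1) a(1) b(2) a(2)]] unfolding q' .
    moreover have "fd (\<lambda>y. (snd b \<circ> chart_inv a) ((snd a \<circ> chart_inv b) y)) (snd b q) = fd (\<lambda>y. y) (snd b q)"
    proof (rule fd_cong_open[OF open_image_chart[OF b(1) open_domain[OF a(1)]]])
      show "snd b q \<in> snd b ` (fst b \<inter> fst a)" using a b by blast
    qed (auto simp: chart_inv_chart a b)
    ultimately show ?thesis by simp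
  qed
  show "to_chart A \<kappa> q (from_chart A \<kappa> q v) = v"
    unfolding to_chart_def from_chart_def by (rule comp[OF c \<kappa> q])
  show "from_chart A \<kappa> q (to_chart A \<kappa> q v) = v"
    unfolding to_chart_def from_chart_def by (rule comp[OF \<kappa> q c])
qed

lemma from_chart_at: "from_chart A (chart_at A q) q v = v"
  unfolding from_chart_def transition_self[OF chart_at] ..

lemma to_chart_at: "to_chart A (chart_at A q) q v = v"
  unfolding to_chart_def transition_self[OF chart_at] ..

lemma metric_chart_bil_in:
  assumes g: "semi_riemannian_metric A \<nu> g" and \<kappa>: "\<kappa> \<in> A" and U: "open U" "U \<subseteq> chart_image \<kappa>"
  shows "metric_chart U (bil_in A \<kappa> g)"
proof
  show "open U" by (fact U(1))
  fix y assume y: "y \<in> U"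
  define q where "q = chart_inv \<kappa> y"
  have q: "q \<in> fst \<kappa>" using chart_inv_in[OF \<kappa>] y U(2) by (auto simp: q_def)
  have b: "bilinear (g q)" "\<And>v w. g q v w = g q w v" "\<And>v. (\<forall>w. g q v w = 0) \<Longrightarrow> v = 0"
    using g unfolding semi_riemannian_metric_def by auto
  note f = linear_from_chart[OF \<kappa> q]
  show "bilinear (bil_in A \<kappa> g y)"
    unfolding bilinear_def bil_in_def q_def[symmetric]
    using b(1) linear_compose[OF f] unfolding bilinear_def by (auto simp: o_def)
  show "bil_in A \<kappa> g y v w = bil_in A \<kappa> g y w v" for v w
    unfolding bil_in_def q_def[symmetric] by (rule b(2))
  show "v = 0" if "\<And>w. bil_in A \<kappa> g y v w = 0" for v
  proof -
    have "g q (from_chart A \<kappa> q v) w = 0" for w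
      using that[of "to_chart A \<kappa> q w"] by (simp add: bil_in_def q_def[symmetric] from_to[OF \<kappa> q])
    then have "from_chart A \<kappa> q v = 0" using b(3) by blast
    then show ?thesis using to_from[OF \<kappa> q, of v] linear_0[OF linear_to_chart[OF \<kappa> q]] by simp
  qed
next
  show "smooth_on U (\<lambda>y. bil_in A \<kappa> g y v w)" for v w
    using g \<kappa> U(2) unfolding semi_riemannian_metric_def by (blast intro: smooth_on_subset)
qed

lemma riem_curv:
  assumes "metric_chart U (bil_in A (chart_at A p) g)" "snd (chart_at A p) p \<in> U"
  shows "riem A g p z w v = metric_chart.curv (bil_in A (chart_at A p) g) (snd (chart_at A p) p) z w v"
  unfolding riem_def by (rule metric_chart.curvature_const[OF assms])

lemma bil_in_chart_at: "bil_in A (chart_at A p) g (snd (chart_at A p) p) v w = g p v w"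
  unfolding bil_in_def by (simp add: chart_inv_chart chart_at from_chart_at)

end

text \<open>The frame identities are invariant under linear isomorphisms; with the derivative of a
  change of chart they pass to coordinate expressions.\<close>

lemma frame_point_transport:
  assumes "frame_point g \<phi> \<xi> \<epsilon>" and t: "linear t" and f: "linear f"
    and tf: "\<And>v. t (f v) = v" and ft: "\<And>v. f (t v) = v"
  shows "frame_point (\<lambda>v w. g (f v) (f w)) (\<lambda>v. t (\<phi> (f v))) (\<lambda>\<alpha>. t (\<xi> \<alpha>)) \<epsilon>"
proof -
  interpret frame_point g \<phi> \<xi> \<epsilon> by fact
  show ?thesis
  proof (intro frame_point.intro frame_point_axioms.intro sym_form.intro)
    show "bilinear (\<lambda>v w. g (f v) (f w))"
      using linear_compose[OF f linear_g_left] linear_compose[OF f linear_g_right]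
      by (auto simp: bilinear_def o_def)
    fix v w \<alpha> \<beta>
    show "g (f v) (f w) = g (f w) (f v)" by (rule g_sym)
    show "v = 0" if "\<And>w. g (f v) (f w) = 0"
    proof -
      have "g (f v) w = 0" for w using that[of "t w"] by (simp add: ft)
      then have "f v = 0" by (rule g_nondeg)
      then show ?thesis using tf[of v] linear_0[OF t] by simp
    qed
    show "linear (\<lambda>v. t (\<phi> (f v)))"
      using linear_compose[OF linear_compose[OF f linear_\<phi>] t] by (simp add: o_def)
    show "t (\<phi> (f (t (\<xi> \<alpha>)))) = 0" by (simp add: ft \<phi>_\<xi> linear_0[OF t])
    show "t (\<phi> (f (t (\<phi> (f v))))) = - v + (\<Sum>\<alpha>\<in>UNIV. (\<epsilon> \<alpha> * g (f v) (f (t (\<xi> \<alpha>)))) *\<^sub>R t (\<xi> \<alpha>))"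
      by (simp add: ft \<phi>_\<phi> linear_add[OF t] linear_diff[OF t] linear_neg[OF t] linear_sum[OF t] linear_cmul[OF t] tf)
    show "g (f (t (\<phi> (f v)))) (f w) = - g (f v) (f (t (\<phi> (f w))))" by (simp add: ft \<phi>_skew)
    show "g (f (t (\<xi> \<alpha>))) (f (t (\<xi> \<beta>))) = (if \<alpha> = \<beta> then \<epsilon> \<alpha> else 0)" by (simp add: ft g_\<xi>_\<xi>)
    show "\<epsilon> \<alpha> * \<epsilon> \<alpha> = 1" by (rule \<epsilon>)
  qed
qed

text \<open>Index zero forbids negative lines, so the form is semidefinite. A null vector is then
  orthogonal to everything, since otherwise some \<open>w + t *\<^sub>R v\<close> would be negative,
  and nondegeneracy excludes it.\<close>

lemma riemannian_pos_def:
  assumes G: "semi_riemannian_metric B 0 G" and v: "v \<noteq> 0"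
  shows "G q v v > 0"
proof -
  have b: "bilinear (G q)" "\<And>v w. G q v w = G q w v" "\<And>v. (\<forall>w. G q v w = 0) \<Longrightarrow> v = 0"
    and ind: "form_index (G q) = 0"
    using G unfolding semi_riemannian_metric_def by auto
  interpret sym_form "G q" by (rule sym_form.intro) (use b in auto)
  have nonneg: "G q w w \<ge> 0" for w
  proof (rule ccontr)
    assume w: "\<not> ?thesis"
    then have w0: "w \<noteq> 0" by (auto simp: g_linear)
    let ?D = "{dim W |W. subspace W \<and> (\<forall>w\<in>W. w \<noteq> 0 \<longrightarrow> G q w w < 0)}"
    have "G q x x < 0" if x: "x \<in> span {w}" "x \<noteq> 0" for x
    proof -
      obtain c where c: "x = c *\<^sub>R w" using x(1) by (auto simp: span_singleton)
      have "G q x x = (c * c) * G q w w" unfolding c by (simp add: g_linear)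
      moreover have "c * c > 0" using c x(2) by (auto simp: zero_less_mult_iff linorder_neq_iff)
      ultimately show ?thesis using w by (simp add: mult_pos_neg)
    qed
    then have D: "dim (span {w}) \<in> ?D" by blast
    have "dim (span {w}) = 1" using w0 dim_eq_card[of "{w}" "span {w}"] by simp
    \<comment> \<open>\<open>Max\<close> bounds the elements of a set only if the set is
      finite.\<close>
    moreover have "finite ?D"
      by (rule finite_subset[of _ "{..DIM('b)}"]) (auto intro: dim_subset_UNIV)
    from Max_ge[OF this D] have "dim (span {w}) \<le> 0"
      unfolding ind[unfolded form_index_def] .
    ultimately show False by simp
  qed
  show ?thesis
  proof (rule ccontr)
    assume "\<not> ?thesis"
    then have v0: "G q v v = 0" using nonneg[of v] by simp
    have "G q v w = 0" for w
    proof (rule ccontr)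
      assume ne: "G q v w \<noteq> 0"
      \<comment> \<open>Chosen so that the value at \<open>w + t *\<^sub>R v\<close> is exactly
        -1.\<close>
      define t where "t = - (G q w w + 1) / (2 * G q v w)"
      have "G q (w + t *\<^sub>R v) (w + t *\<^sub>R v) = G q w w + 2 * t * G q v w"
        using v0 g_sym[of w v] by (simp add: g_linear)
      also have "\<dots> = - 1" using ne by (simp add: t_def field_simps)
      finally show False using nonneg[of "w + t *\<^sub>R v"] by simp
    qed
    then show False using b(3) v by blast
  qed
qed

text \<open>Putting \<open>w = \<xi> \<alpha> q\<close> into the compatibility condition makes the
  left side vanish and identifies \<eta>^\<alpha> with \<epsilon>_\<alpha> g(-, \<xi>_\<alpha>);
  orthonormality of the frame follows by duality.\<close>

lemma frame_point_of_compatible: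
  assumes gff: "gff_manifold A n \<phi> \<xi> \<eta>" and g: "semi_riemannian_metric A \<nu> g"
    and \<epsilon>: "\<And>\<alpha>. \<epsilon> \<alpha> = 1 \<or> \<epsilon> \<alpha> = - 1"
    and compat: "\<And>v w. g q (\<phi> q v) (\<phi> q w) = g q v w - (\<Sum>\<alpha>\<in>UNIV. \<epsilon> \<alpha> * \<eta> \<alpha> q v * \<eta> \<alpha> q w)"
  shows "frame_point (g q) (\<phi> q) (\<lambda>\<alpha>. \<xi> \<alpha> q) \<epsilon>" (is ?frame)
    and "\<eta> \<alpha> q v = \<epsilon> \<alpha> * g q v (\<xi> \<alpha> q)"
proof -
  have b: "bilinear (g q)" "\<And>v w. g q v w = g q w v" "\<And>v. (\<forall>w. g q v w = 0) \<Longrightarrow> v = 0"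
    using g unfolding semi_riemannian_metric_def by auto
  interpret sym_form "g q" by (rule sym_form.intro) (use b in auto)
  have lin: "linear (\<phi> q)" and lin\<eta>: "linear (\<eta> \<alpha> q)" for \<alpha>
    using gff unfolding gff_manifold_def endo_field_def one_form_def by auto
  have "(\<forall>v. \<phi> q (\<phi> q (\<phi> q v)) + \<phi> q v = 0) \<and> span (range (\<lambda>\<alpha>. \<xi> \<alpha> q)) = {v. \<phi> q v = 0} \<and>
    (\<forall>v. \<phi> q (\<phi> q v) = - v + (\<Sum>\<alpha>\<in>UNIV. \<eta> \<alpha> q v *\<^sub>R \<xi> \<alpha> q)) \<and>
    (\<forall>\<alpha> \<beta>. \<eta> \<alpha> q (\<xi> \<beta> q) = (if \<alpha> = \<beta> then 1 else 0))"
    using gff unfolding gff_manifold_def by blast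
  then have \<phi>3: "\<phi> q (\<phi> q (\<phi> q v)) + \<phi> q v = 0"
    and ker: "span (range (\<lambda>\<alpha>. \<xi> \<alpha> q)) = {v. \<phi> q v = 0}"
    and \<phi>2: "\<phi> q (\<phi> q v) = - v + (\<Sum>\<alpha>\<in>UNIV. \<eta> \<alpha> q v *\<^sub>R \<xi> \<alpha> q)"
    and \<eta>\<xi>: "\<eta> \<alpha> q (\<xi> \<beta> q) = (if \<alpha> = \<beta> then 1 else 0)" for v \<alpha> \<beta>
    by blast+
  have \<phi>\<xi>: "\<phi> q (\<xi> \<alpha> q) = 0" for \<alpha>
  proof -
    have "\<xi> \<alpha> q \<in> span (range (\<lambda>\<alpha>. \<xi> \<alpha> q))" by (rule span_base) simp
    then show ?thesis unfolding ker by simp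
  qed
  have ee: "\<epsilon> \<alpha> * \<epsilon> \<alpha> = 1" for \<alpha> using \<epsilon>[of \<alpha>] by auto
  have g\<xi>: "g q v (\<xi> \<alpha> q) = \<epsilon> \<alpha> * \<eta> \<alpha> q v" for v \<alpha>
    using compat[of v "\<xi> \<alpha> q"] by (simp add: \<phi>\<xi> \<eta>\<xi> g_linear if_distrib cong: if_cong)
  have \<eta>g: "\<eta> \<alpha> q v = \<epsilon> \<alpha> * g q v (\<xi> \<alpha> q)" for v \<alpha>
    unfolding g\<xi> mult.assoc[symmetric] ee by simp
  then show "\<eta> \<alpha> q v = \<epsilon> \<alpha> * g q v (\<xi> \<alpha> q)" .
  \<comment> \<open>Comparing \<phi>^3 = -\<phi> with the formula for \<phi>^2 on the range of
    \<phi> leaves a vanishing combination of the \<xi>_\<beta>, and \<eta>^\<alpha> extracts its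
    coefficients.\<close>
  have \<eta>\<phi>: "\<eta> \<alpha> q (\<phi> q v) = 0" for \<alpha> v
  proof -
    have "(\<Sum>\<beta>\<in>UNIV. \<eta> \<beta> q (\<phi> q v) *\<^sub>R \<xi> \<beta> q) = 0"
      using \<phi>3[of v] \<phi>2[of "\<phi> q v"] by simp
    then have "\<eta> \<alpha> q (\<Sum>\<beta>\<in>UNIV. \<eta> \<beta> q (\<phi> q v) *\<^sub>R \<xi> \<beta> q) = 0"
      by (simp add: linear_0[OF lin\<eta>])
    then show ?thesis
      by (simp add: linear_sum[OF lin\<eta>] linear_cmul[OF lin\<eta>] \<eta>\<xi> if_distrib cong: if_cong)
  qed
  show ?frame
  proof (intro frame_point.intro frame_point_axioms.intro)
    show "sym_form (g q)" by unfold_locales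
    show "linear (\<phi> q)" by (rule lin)
    fix v w \<alpha> \<beta>
    show "\<phi> q (\<xi> \<alpha> q) = 0" by (rule \<phi>\<xi>)
    show "\<phi> q (\<phi> q v) = - v + (\<Sum>\<alpha>\<in>UNIV. (\<epsilon> \<alpha> * g q v (\<xi> \<alpha> q)) *\<^sub>R \<xi> \<alpha> q)"
      unfolding \<phi>2[of v] \<eta>g ..
    \<comment> \<open>g(\<phi> v, \<phi>^2 w) is evaluated twice, by compatibility and by the
      formula for \<phi>^2.\<close>
    show "g q (\<phi> q v) w = - g q v (\<phi> q w)"
    proof -
      have "g q (\<phi> q v) (\<phi> q (\<phi> q w)) = g q v (\<phi> q w)"
        using compat[of v "\<phi> q w"] by (simp add: \<eta>\<phi>)
      moreover have "g q (\<phi> q v) (\<phi> q (\<phi> q w)) = - g q (\<phi> q v) w"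
        unfolding \<phi>2[of w] by (simp add: g_linear g\<xi> \<eta>\<phi>)
      ultimately show ?thesis by simp
    qed
    show "g q (\<xi> \<alpha> q) (\<xi> \<beta> q) = (if \<alpha> = \<beta> then \<epsilon> \<alpha> else 0)"
      by (simp add: g\<xi> \<eta>\<xi>)
    show "\<epsilon> \<alpha> * \<epsilon> \<alpha> = 1" by (rule ee)
  qed
qed

lemma lie_bracket_const: "lie_bracket (\<lambda>_. v) (\<lambda>_. w) y = 0"
  by (simp add: lie_bracket_def)

lemma nijenhuis_const:
  assumes "linear (T y)"
  shows "nijenhuis T (\<lambda>_. v) (\<lambda>_. w) y = fd (\<lambda>z. T z w) y (T y v) - fd (\<lambda>z. T z v) y (T y w)
    + T y (fd (\<lambda>z. T z v) y w) - T y (fd (\<lambda>z. T z w) y v)"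
  unfolding nijenhuis_def lie_bracket_const
  by (simp add: lie_bracket_def linear_0[OF assms] linear_neg[OF assms])

lemma S_chart_of_manifold:
  fixes A :: "('m::{t2_space, second_countable_topology}, 'e::euclidean_space) atlas"
    and \<xi> :: "'s::finite \<Rightarrow> 'm \<Rightarrow> 'e"
  assumes S: "lorentzian_S_manifold A n \<phi> \<xi> \<eta> g \<alpha>\<^sub>1" and \<kappa>: "\<kappa> \<in> A"
    and U: "open U" "U \<subseteq> chart_image \<kappa>"
    and frame: "\<And>q. frame_point (g q) (\<phi> q) (\<lambda>\<alpha>. \<xi> \<alpha> q) \<epsilon>"
    and \<eta>: "\<And>\<alpha> q v. \<eta> \<alpha> q v = \<epsilon> \<alpha> * g q v (\<xi> \<alpha> q)"
  shows "S_chart U (bil_in A \<kappa> g) (endo_in A \<kappa> \<phi>) (\<lambda>\<alpha>. vec_in A \<kappa> (\<xi> \<alpha>))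
    (\<lambda>\<alpha>. form_in A \<kappa> (\<eta> \<alpha>)) \<epsilon>"
proof -
  have gff: "gff_manifold A n \<phi> \<xi> \<eta>" and normal: "normal_gff A \<phi> \<xi> \<eta>"
    and g: "lorentzian_metric A g"
    and d\<eta>: "\<And>\<alpha> X Y y. smooth_on (chart_image \<kappa>) X \<Longrightarrow> smooth_on (chart_image \<kappa>) Y \<Longrightarrow> y \<in> chart_image \<kappa> \<Longrightarrow>
       ext_deriv (form_in A \<kappa> (\<eta> \<alpha>)) X Y y = bil_in A \<kappa> (fundamental_form g \<phi>) y (X y) (Y y)"
    using S \<kappa> unfolding lorentzian_S_manifold_def by blast+
  have M: "smooth_manifold A" and endo: "endo_field A \<phi>" and vec: "vector_field A (\<xi> \<alpha>)"
    and form: "one_form A (\<eta> \<alpha>)" for \<alpha>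
    using gff unfolding gff_manifold_def by auto
  interpret manifold A by (rule manifold.intro[OF M])
  interpret metric_chart U "bil_in A \<kappa> g" by (rule metric_chart_bil_in[OF g \<kappa> U])
  have frame': "frame_point (bil_in A \<kappa> g y) (endo_in A \<kappa> \<phi> y) (\<lambda>\<alpha>. vec_in A \<kappa> (\<xi> \<alpha>) y) \<epsilon>" if "y \<in> U" for y
  proof -
    have q: "chart_inv \<kappa> y \<in> fst \<kappa>" using chart_inv_in[OF \<kappa>] that U(2) by auto
    have "bil_in A \<kappa> g y = (\<lambda>v w. g (chart_inv \<kappa> y) (from_chart A \<kappa> (chart_inv \<kappa> y) v) (from_chart A \<kappa> (chart_inv \<kappa> y) w))"
      "endo_in A \<kappa> \<phi> y = (\<lambda>v. to_chart A \<kappa> (chart_inv \<kappa> y) (\<phi> (chart_inv \<kappa> y) (from_chart A \<kappa> (chart_inv \<kappa> y) v)))"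
      by (intro ext, simp add: bil_in_def endo_in_def)+
    then show ?thesis
      using frame_point_transport[OF frame linear_to_chart[OF \<kappa> q] linear_from_chart[OF \<kappa> q] to_from[OF \<kappa> q] from_to[OF \<kappa> q]]
      by (simp add: vec_in_def)
  qed
  have ext: "ext_deriv (form_in A \<kappa> (\<eta> \<alpha>)) (\<lambda>_. v) (\<lambda>_. w) y = bil_in A \<kappa> g y v (endo_in A \<kappa> \<phi> y w)"
    if y: "y \<in> U" for y \<alpha> v w
  proof -
    have q: "chart_inv \<kappa> y \<in> fst \<kappa>" using chart_inv_in[OF \<kappa>] that U(2) by auto
    have "ext_deriv (form_in A \<kappa> (\<eta> \<alpha>)) (\<lambda>_. v) (\<lambda>_. w) y = bil_in A \<kappa> (fundamental_form g \<phi>) y v w"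
      using d\<eta>[OF smooth_on_const smooth_on_const, of y] y U(2) by blast
    then show ?thesis
      by (simp add: bil_in_def fundamental_form_def endo_in_def from_to[OF \<kappa> q])
  qed
  show ?thesis
  proof (intro S_chart.intro S_chart_axioms.intro)
    show "metric_chart U (bil_in A \<kappa> g)" by unfold_locales
    show "smooth_on U (\<lambda>y. endo_in A \<kappa> \<phi> y v)" for v
      using endo \<kappa> U(2) unfolding endo_field_def by (blast intro: smooth_on_subset)
    show "smooth_on U (vec_in A \<kappa> (\<xi> \<alpha>))" for \<alpha>
      using vec[of \<alpha>] \<kappa> U(2) unfolding vector_field_def by (blast intro: smooth_on_subset)
    show "smooth_on U (\<lambda>y. form_in A \<kappa> (\<eta> \<alpha>) y v)" for \<alpha> v
      using form[of \<alpha>] \<kappa> U(2) unfolding one_form_def by (blast intro: smooth_on_subset)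
    fix y assume y: "y \<in> U"
    have q: "chart_inv \<kappa> y \<in> fst \<kappa>" using chart_inv_in[OF \<kappa>] y U(2) by auto
    show "frame_point (bil_in A \<kappa> g y) (endo_in A \<kappa> \<phi> y) (\<lambda>\<alpha>. vec_in A \<kappa> (\<xi> \<alpha>) y) \<epsilon>"
      by (rule frame'[OF y])
    show "form_in A \<kappa> (\<eta> \<alpha>) y v = \<epsilon> \<alpha> * bil_in A \<kappa> g y v (vec_in A \<kappa> (\<xi> \<alpha>) y)" for \<alpha> v
      by (simp add: form_in_def \<eta> bil_in_def vec_in_def from_to[OF \<kappa> q])
    show "fd (\<lambda>z. form_in A \<kappa> (\<eta> \<alpha>) z w) y v - fd (\<lambda>z. form_in A \<kappa> (\<eta> \<alpha>) z v) y w
        = 2 * bil_in A \<kappa> g y v (endo_in A \<kappa> \<phi> y w)" for \<alpha> v w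
    proof -
      have "form_in A \<kappa> (\<eta> \<alpha>) y 0 = 0"
        using form[of \<alpha>] unfolding one_form_def form_in_def
        by (simp add: linear_0[OF linear_from_chart[OF \<kappa> q]] linear_0)
      then show ?thesis
        using ext[OF y, of \<alpha> v w] unfolding ext_deriv_def lie_bracket_const by simp
    qed
    show "fd (\<lambda>z. endo_in A \<kappa> \<phi> z w) y (endo_in A \<kappa> \<phi> y v) - fd (\<lambda>z. endo_in A \<kappa> \<phi> z v) y (endo_in A \<kappa> \<phi> y w)
        + endo_in A \<kappa> \<phi> y (fd (\<lambda>z. endo_in A \<kappa> \<phi> z v) y w) - endo_in A \<kappa> \<phi> y (fd (\<lambda>z. endo_in A \<kappa> \<phi> z w) y v)
        + (2 * bil_in A \<kappa> g y v (endo_in A \<kappa> \<phi> y w)) *\<^sub>R (\<Sum>\<alpha>\<in>UNIV. vec_in A \<kappa> (\<xi> \<alpha>) y) = 0" for v w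
    proof -
      have yc: "y \<in> chart_image \<kappa>" using y U(2) by blast
      have "nijenhuis (endo_in A \<kappa> \<phi>) (\<lambda>_. v) (\<lambda>_. w) y
           + 2 *\<^sub>R (\<Sum>\<alpha>\<in>UNIV. ext_deriv (form_in A \<kappa> (\<eta> \<alpha>)) (\<lambda>_. v) (\<lambda>_. w) y *\<^sub>R vec_in A \<kappa> (\<xi> \<alpha>) y) = 0"
        using normal[unfolded normal_gff_def, rule_format, OF \<kappa> smooth_on_const smooth_on_const yc] .
      then show ?thesis
        unfolding nijenhuis_const[of "endo_in A \<kappa> \<phi>", OF frame_point.linear_\<phi>[OF frame'[OF y]]] ext[OF y]
        by (simp add: scaleR_sum_right)
    qed
  qed
qed

text \<open>\<open>tangent_map\<close> uses the distinguished charts at \<open>q\<close> and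
  \<open>f q\<close>, which may change with the point, whereas differentiation in a neighbourhood
  needs fixed charts. The chain rule through the two transition maps connects them.\<close>

lemma fd_local_expression:
  fixes A :: "('m::{t2_space, second_countable_topology}, 'e::euclidean_space) atlas"
    and B :: "('n::{t2_space, second_countable_topology}, 'h::euclidean_space) atlas"
  assumes A: "smooth_manifold A" and B: "smooth_manifold B" and f: "smooth_map A B UNIV f"
    and \<kappa>: "\<kappa> \<in> A" "q \<in> fst \<kappa>" and l: "l \<in> B" "f q \<in> fst l"
  shows "linear (tangent_map A B f q)"
    and "fd (snd l \<circ> f \<circ> chart_inv \<kappa>) (snd \<kappa> q) v
      = to_chart B l (f q) (tangent_map A B f q (from_chart A \<kappa> q v))"
proof -
  interpret A: manifold A by (rule manifold.intro[OF A])
  interpret B: manifold B by (rule manifold.intro[OF B])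
  let ?k = "chart_at A q" and ?l = "chart_at B (f q)"
  note k' = A.chart_at[of q] and l' = B.chart_at[of "f q"]
  let ?a = "snd ?k \<circ> chart_inv \<kappa>" and ?b = "snd ?l \<circ> f \<circ> chart_inv ?k" and ?c = "snd l \<circ> chart_inv ?l"
  have da: "?a differentiable (at (snd \<kappa> q))"
    by (rule A.transition_differentiable[OF \<kappa>(1) k'(1) \<kappa>(2) k'(2)])
  have a: "?a (snd \<kappa> q) = snd ?k q" by (simp add: A.chart_inv_chart \<kappa>)
  have "smooth_on (snd ?k ` (UNIV \<inter> fst ?k \<inter> f -` fst ?l)) ?b"
    using f k'(1) l'(1) unfolding smooth_map_def by blast
  then have db0: "?b differentiable (at (snd ?k q))"
    by (rule smooth_on_differentiable) (use k' l' in auto)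
  then show "linear (tangent_map A B f q)"
    unfolding tangent_map_def by (rule linear_frechet_derivative)
  have db: "?b differentiable (at (?a (snd \<kappa> q)))" unfolding a by (rule db0)
  have b: "?b (?a (snd \<kappa> q)) = snd ?l (f q)" unfolding a by (simp add: A.chart_inv_chart k')
  have dc: "?c differentiable (at (?b (?a (snd \<kappa> q))))"
    unfolding b by (rule B.transition_differentiable[OF l'(1) l(1) l'(2) l(2)])
  have cont: "continuous_on UNIV f" using f by (simp add: smooth_map_def)
  \<comment> \<open>On this neighbourhood all four charts are available, so the local expression
    factors through the transitions.\<close>
  have op: "open (fst ?k \<inter> f -` (fst l \<inter> fst ?l))"
    using A.open_domain[OF k'(1)] B.open_domain[OF l(1)] B.open_domain[OF l'(1)] cont
    by (intro open_Int open_vimage)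
  have e1: "fd (snd l \<circ> f \<circ> chart_inv \<kappa>) (snd \<kappa> q) = fd (\<lambda>y. ?c (?b (?a y))) (snd \<kappa> q)"
  proof (rule fd_cong_open[OF A.open_image_chart[OF \<kappa>(1) op]])
    show "snd \<kappa> q \<in> snd \<kappa> ` (fst \<kappa> \<inter> (fst ?k \<inter> f -` (fst l \<inter> fst ?l)))"
      using \<kappa> k' l l' by blast
    fix z assume "z \<in> snd \<kappa> ` (fst \<kappa> \<inter> (fst ?k \<inter> f -` (fst l \<inter> fst ?l)))"
    then obtain r where r: "z = snd \<kappa> r" "r \<in> fst \<kappa>" "r \<in> fst ?k" "f r \<in> fst l" "f r \<in> fst ?l" by blast
    then show "(snd l \<circ> f \<circ> chart_inv \<kappa>) z = ?c (?b (?a z))"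
      by (simp add: A.chart_inv_chart[OF \<kappa>(1)] A.chart_inv_chart[OF k'(1)] B.chart_inv_chart[OF l'(1)])
  qed
  have e2: "fd (\<lambda>y. ?c (?b (?a y))) (snd \<kappa> q) v
      = fd ?c (?b (?a (snd \<kappa> q))) (fd (\<lambda>y. ?b (?a y)) (snd \<kappa> q) v)"
    by (rule fd_compose(1)[where h = ?c and f = "\<lambda>y. ?b (?a y)", OF dc fd_compose(2)[where h = ?b and f = ?a, OF db da]])
  have e3: "fd (\<lambda>y. ?b (?a y)) (snd \<kappa> q) v = fd ?b (?a (snd \<kappa> q)) (fd ?a (snd \<kappa> q) v)"
    by (rule fd_compose(1)[where h = ?b and f = ?a, OF db da])
  show "fd (snd l \<circ> f \<circ> chart_inv \<kappa>) (snd \<kappa> q) v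
      = to_chart B l (f q) (tangent_map A B f q (from_chart A \<kappa> q v))"
    unfolding e1 e2 e3 b unfolding a to_chart_def from_chart_def tangent_map_def ..
qed

section \<open>The Osserman conditions\<close>

lemma null_class_eq_iff: "null_class u a = null_class u b \<longleftrightarrow> a - b \<in> span {u}"
proof
  assume "null_class u a = null_class u b"
  moreover have "a \<in> null_class u a" unfolding null_class_def using span_0 by force
  ultimately have "a \<in> null_class u b" by blast
  then show "a - b \<in> span {u}" by (auto simp: null_class_def)
next
  have "null_class u a \<subseteq> null_class u b" if ab: "a - b \<in> span {u}" for a b
  proof
    fix x assume "x \<in> null_class u a"
    then obtain w where w: "x = a + w" "w \<in> span {u}" by (auto simp: null_class_def)
    then have "x = b + ((a - b) + w)" by simp
    moreover have "(a - b) + w \<in> span {u}" by (rule span_add[OF ab w(2)])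
    ultimately show "x \<in> null_class u b" unfolding null_class_def by blast
  qed
  moreover assume "a - b \<in> span {u}"
  moreover have "b - a \<in> span {u}" using span_neg[OF \<open>a - b \<in> span {u}\<close>] by simp
  ultimately show "null_class u a = null_class u b" by blast
qed

text \<open>The operator kills \<open>u\<close>, so it is well defined on cosets, and the union of
  an eigenspace of cosets is its preimage. The subtracted 1 is the dimension of
  \<open>span {u}\<close>.\<close>

lemma null_jacobi_mult_eq:
  assumes b: "bilinear (g p)" and R: "linear (\<lambda>z. riem A g p z u u)" and Ruu: "riem A g p u u u = 0"
    and u: "u \<noteq> 0" "g p u u = 0"
  shows "null_jacobi_mult A g p u \<mu>
    = dim {y. g p y u = 0 \<and> riem A g p y u u - \<mu> *\<^sub>R y \<in> span {u}} - 1"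
proof -
  have gl: "linear (\<lambda>v. g p v u)" using b by (simp add: bilinear_def)
  have self: "y \<in> null_class u y" for y unfolding null_class_def using span_0 by force
  have mem: "y \<in> null_class u x \<longleftrightarrow> y - x \<in> span {u}" for x y
    unfolding null_class_def by (auto intro!: exI[of _ "y - x"])
  have gu: "g p w u = 0" and Ru: "riem A g p w u u = 0" if "w \<in> span {u}" for w
    using that u(2) Ruu linear_cmul[OF gl] linear_cmul[OF R] by (auto simp: span_singleton)
  have jac: "null_jacobi A g p u (null_class u x) = null_class u (riem A g p x u u)" for x
  proof -
    have "null_class u (riem A g p y u u) = null_class u (riem A g p x u u)" if "y \<in> null_class u x" for y
    proof -
      have "riem A g p (y - x) u u = 0" using Ru that mem by blast
      then show ?thesis by (simp add: linear_diff[OF R])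
    qed
    then show ?thesis unfolding null_jacobi_def using self[of x] by blast
  qed
  have scale: "null_scale u \<mu> (null_class u x) = null_class u (\<mu> *\<^sub>R x)" for x
  proof -
    have "null_class u (\<mu> *\<^sub>R y) = null_class u (\<mu> *\<^sub>R x)" if "y \<in> null_class u x" for y
      unfolding null_class_eq_iff using that span_scale[of "y - x" "{u}" \<mu>] mem[of y x] by (simp add: scaleR_diff_right)
    then show ?thesis unfolding null_scale_def using self[of x] by blast
  qed
  have "\<Union>{C \<in> null_quotient g p u. null_jacobi A g p u C = null_scale u \<mu> C}
    = {y. g p y u = 0 \<and> riem A g p y u u - \<mu> *\<^sub>R y \<in> span {u}}" (is "?l = ?r")
  proof (intro equalityI subsetI)
    fix y assume "y \<in> ?l"
    then obtain x where x: "g p x u = 0" "y \<in> null_class u x"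
      "null_jacobi A g p u (null_class u x) = null_scale u \<mu> (null_class u x)"
      unfolding null_quotient_def orth_def by blast
    have yx: "null_class u y = null_class u x" using x(2) mem null_class_eq_iff by blast
    have "g p (y - x) u = 0" using gu x(2) mem by blast
    then have "g p y u = 0" using x(1) by (simp add: linear_diff[OF gl])
    moreover have "riem A g p y u u - \<mu> *\<^sub>R y \<in> span {u}"
      using x(3) unfolding yx[symmetric] jac scale null_class_eq_iff .
    ultimately show "y \<in> ?r" by blast
  next
    fix y assume y: "y \<in> ?r"
    then have "null_jacobi A g p u (null_class u y) = null_scale u \<mu> (null_class u y)"
      unfolding jac scale null_class_eq_iff by blast
    then show "y \<in> ?l" using y self[of y] unfolding null_quotient_def orth_def by blast
  qed
  moreover have "dim (span {u}) = 1" using u(1) dim_eq_card[of "{u}" "span {u}"] by simp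
  ultimately show ?thesis by (simp only: null_jacobi_mult_def null_dim_def)
qed

theorem proposition4p4:
  fixes A :: "('m::{t2_space, second_countable_topology}, 'e::euclidean_space) atlas"
    and B :: "('n::{t2_space, second_countable_topology}, 'h::euclidean_space) atlas"
    and n :: nat
    and \<phi> :: "'m \<Rightarrow> 'e \<Rightarrow> 'e"
    and \<xi> :: "'s::finite \<Rightarrow> 'm \<Rightarrow> 'e"
    and \<eta> :: "'s \<Rightarrow> 'm \<Rightarrow> 'e \<Rightarrow> real"
    and g :: "'m \<Rightarrow> 'e \<Rightarrow> 'e \<Rightarrow> real"
    and \<alpha>\<^sub>1 :: 's
    and J :: "'n \<Rightarrow> 'h \<Rightarrow> 'h"
    and G :: "'n \<Rightarrow> 'h \<Rightarrow> 'h \<Rightarrow> real"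
    and \<pi> :: "'m \<Rightarrow> 'n"
    and act :: "complex ^ 's \<Rightarrow> 'm \<Rightarrow> 'm"
    and p :: 'm
  assumes "compact (UNIV :: 'm set)"
    and "lorentzian_S_manifold A n \<phi> \<xi> \<eta> g \<alpha>\<^sub>1"
    and "regular_structure A \<xi>"
    and "compact (UNIV :: 'n set)"
    and "kaehler_manifold B J G"
    and "DIM('h) = 2 * n"
    and "principal_torus_bundle A B \<pi> act"
    and "fibrates_by A B \<pi> \<xi>"
    and "semi_riemannian_submersion A B g G \<pi>"
    and "totally_geodesic_fibres A B g \<pi>"
    and "\<forall>x\<in>phi_sphere g \<phi> p (\<xi> \<alpha>\<^sub>1 p). jacobi_eigenvector A g p x (\<phi> p x)"
  shows "phi_null_osserman A g \<phi> p (\<xi> \<alpha>\<^sub>1 p) \<longleftrightarrow> osserman_at B G (\<pi> p)"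
proof -
  note S = assms(2) and eig = assms(11)
  have gff: "gff_manifold A n \<phi> \<xi> \<eta>" and metric: "lorentzian_metric A g"
    and compat: "compatible_metric \<phi> \<xi> \<eta> g" and timelike: "g p (\<xi> \<alpha>\<^sub>1 p) (\<xi> \<alpha>\<^sub>1 p) < 0"
    using S unfolding lorentzian_S_manifold_def by auto
  obtain \<epsilon> :: "'s \<Rightarrow> real" where \<epsilon>: "\<And>\<alpha>. \<epsilon> \<alpha> = 1 \<or> \<epsilon> \<alpha> = -1"
    and compat': "\<And>q v w. g q (\<phi> q v) (\<phi> q w) = g q v w - (\<Sum>\<alpha>\<in>UNIV. \<epsilon> \<alpha> * \<eta> \<alpha> q v * \<eta> \<alpha> q w)"
    using compat unfolding compatible_metric_def by blast
  have frame_q: "frame_point (g q) (\<phi> q) (\<lambda>\<alpha>. \<xi> \<alpha> q) \<epsilon>" for q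
    by (rule frame_point_of_compatible(1)[where \<epsilon> = \<epsilon>, OF gff metric \<epsilon>]) (rule compat')
  have \<eta>: "\<eta> \<alpha> q v = \<epsilon> \<alpha> * g q v (\<xi> \<alpha> q)" for \<alpha> q v
    by (rule frame_point_of_compatible(2)[where \<epsilon> = \<epsilon>, OF gff metric \<epsilon>]) (rule compat')
  have MA: "smooth_manifold A" using gff by (simp add: gff_manifold_def)
  have MB: "smooth_manifold B" and GR: "riemannian_metric B G"
    using assms(5) unfolding kaehler_manifold_def by auto
  interpret A: manifold A by (rule manifold.intro[OF MA])
  interpret B: manifold B by (rule manifold.intro[OF MB])
  have sub: "smooth_map A B UNIV \<pi>" and surj: "\<And>q. surj (tangent_map A B \<pi> q)"
    and iso: "\<And>q v w. v \<in> horizontal A B g \<pi> q \<Longrightarrow> w \<in> horizontal A B g \<pi> q \<Longrightarrow>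
      G (\<pi> q) (tangent_map A B \<pi> q v) (tangent_map A B \<pi> q w) = g q v w"
    using assms(9) unfolding semi_riemannian_submersion_def by auto
  have vert: "vertical A B \<pi> q = char_distribution \<xi> q" for q
    using assms(8) unfolding fibrates_by_def by blast
  have linear_tm: "linear (tangent_map A B \<pi> q)" for q
    by (rule fd_local_expression(1)[OF MA MB sub A.chart_at B.chart_at])
  \<comment> \<open>Replacing \<open>v\<close> by \<open>- \<phi> q (\<phi> q v)\<close> changes it
    by a vertical vector only and makes it horizontal, so the submersion property extends to
    arbitrary vectors.\<close>
  have isometry: "G (\<pi> q) (tangent_map A B \<pi> q v) (tangent_map A B \<pi> q w) = g q (\<phi> q v) (\<phi> q w)" for q v w
  proof -
    interpret frame_point "g q" "\<phi> q" "\<lambda>\<alpha>. \<xi> \<alpha> q" \<epsilon> by (rule frame_q)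
    have tm_\<phi>2: "tangent_map A B \<pi> q (\<phi> q (\<phi> q v)) = - tangent_map A B \<pi> q v" for v
    proof -
      have "v + \<phi> q (\<phi> q v) = (\<Sum>\<alpha>\<in>UNIV. (\<epsilon> \<alpha> * g q v (\<xi> \<alpha> q)) *\<^sub>R \<xi> \<alpha> q)"
        unfolding \<phi>_\<phi> by simp
      also have "\<dots> \<in> char_distribution \<xi> q"
        unfolding char_distribution_def by (intro span_sum span_scale span_base) simp
      finally have "v + \<phi> q (\<phi> q v) \<in> char_distribution \<xi> q" .
      then have "tangent_map A B \<pi> q (v + \<phi> q (\<phi> q v)) = 0"
        unfolding vert[symmetric] vertical_def by simp
      then show ?thesis by (simp add: linear_add[OF linear_tm] eq_neg_iff_add_eq_0 add.commute)
    qed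
    have h: "\<phi> q v \<in> horizontal A B g \<pi> q" for v
      unfolding horizontal_def vert char_distribution_def
    proof safe
      fix w assume "w \<in> span (range (\<lambda>\<alpha>. \<xi> \<alpha> q))"
      then show "g q (\<phi> q v) w = 0"
        by (induction rule: span_induct_alt) (auto simp: g_linear g_\<phi>_\<xi>)
    qed
    have "G (\<pi> q) (tangent_map A B \<pi> q v) (tangent_map A B \<pi> q w)
        = G (\<pi> q) (tangent_map A B \<pi> q (- \<phi> q (\<phi> q v))) (tangent_map A B \<pi> q (- \<phi> q (\<phi> q w)))"
      by (simp add: linear_neg[OF linear_tm] tm_\<phi>2)
    also have "\<dots> = g q (- \<phi> q (\<phi> q v)) (- \<phi> q (\<phi> q w))"
      using h[of "- \<phi> q v"] h[of "- \<phi> q w"] by (intro iso) (simp_all add: \<phi>_linear)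
    also have "\<dots> = - g q (\<phi> q v) (\<phi> q (\<phi> q (\<phi> q w)))"
      by (simp add: g_linear \<phi>_skew)
    also have "\<dots> = g q (\<phi> q v) (\<phi> q w)"
      by (simp add: \<phi>_\<phi>_hor[OF hor_\<phi>] g_linear)
    finally show ?thesis .
  qed
  \<comment> \<open>In the distinguished charts at \<open>p\<close> and \<open>\<pi> p\<close> the
    coordinate tensors at these points are literally the given ones, so no transition derivatives
    are left in the end.\<close>
  define \<kappa> where "\<kappa> = chart_at A p"
  define l where "l = chart_at B (\<pi> p)"
  have \<kappa>: "\<kappa> \<in> A" "p \<in> fst \<kappa>" and l: "l \<in> B" "\<pi> p \<in> fst l"
    using A.chart_at B.chart_at by (auto simp: \<kappa>_def l_def)
  define U where "U = snd \<kappa> ` (fst \<kappa> \<inter> \<pi> -` fst l)"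
  define F where "F = snd l \<circ> \<pi> \<circ> chart_inv \<kappa>"
  define y where "y = snd \<kappa> p"
  have "open (\<pi> -` fst l)"
    using sub B.open_domain[OF l(1)] unfolding smooth_map_def by (metis open_vimage)
  then have open_U: "open U" unfolding U_def by (rule A.open_image_chart[OF \<kappa>(1)])
  have U_sub: "U \<subseteq> chart_image \<kappa>" by (auto simp: U_def chart_image_def)
  have y: "y \<in> U" using \<kappa> l by (auto simp: U_def y_def)
  have Fy: "F y = snd l (\<pi> p)" by (simp add: F_def y_def A.chart_inv_chart \<kappa>)
  note chart_defs = bil_in_def endo_in_def vec_in_def
  interpret submersion_chart U "bil_in A \<kappa> g" "endo_in A \<kappa> \<phi>" "\<lambda>\<alpha>. vec_in A \<kappa> (\<xi> \<alpha>)"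
    "\<lambda>\<alpha>. form_in A \<kappa> (\<eta> \<alpha>)" \<epsilon> "chart_image l" "bil_in B l G" F
  proof (intro submersion_chart.intro submersion_chart_axioms.intro)
    show "S_chart U (bil_in A \<kappa> g) (endo_in A \<kappa> \<phi>) (\<lambda>\<alpha>. vec_in A \<kappa> (\<xi> \<alpha>)) (\<lambda>\<alpha>. form_in A \<kappa> (\<eta> \<alpha>)) \<epsilon>"
      by (rule S_chart_of_manifold[OF S \<kappa>(1) open_U U_sub frame_q \<eta>])
    show "metric_chart (chart_image l) (bil_in B l G)"
      by (rule B.metric_chart_bil_in[OF GR l(1) B.open_chart_image[OF l(1)] order_refl])
    have "smooth_on (snd \<kappa> ` (UNIV \<inter> fst \<kappa> \<inter> \<pi> -` fst l)) (snd l \<circ> \<pi> \<circ> chart_inv \<kappa>)"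
      using sub \<kappa>(1) l(1) unfolding smooth_map_def by blast
    then show "smooth_on U F" unfolding U_def F_def by simp
    fix z assume "z \<in> U"
    then obtain q where q: "z = snd \<kappa> q" "q \<in> fst \<kappa>" "\<pi> q \<in> fst l" by (auto simp: U_def)
    have inv: "chart_inv \<kappa> z = q" using q by (simp add: A.chart_inv_chart \<kappa>)
    have Fz: "F z = snd l (\<pi> q)" by (simp add: F_def inv)
    have invF: "chart_inv l (F z) = \<pi> q" unfolding Fz using q l by (simp add: B.chart_inv_chart)
    show "F z \<in> chart_image l" unfolding Fz chart_image_def using q(3) by (rule imageI)
    have dF: "fd F z v = to_chart B l (\<pi> q) (tangent_map A B \<pi> q (from_chart A \<kappa> q v))" for v
      unfolding F_def q(1) by (rule fd_local_expression(2)[OF MA MB sub \<kappa>(1) q(2) l(1) q(3)])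
    show "bil_in B l G (F z) (fd F z v) (fd F z w) = bil_in A \<kappa> g z (endo_in A \<kappa> \<phi> z v) (endo_in A \<kappa> \<phi> z w)" for v w
      unfolding chart_defs invF inv dF B.from_to[OF l(1) q(3)] A.from_to[OF \<kappa>(1) q(2)] isometry ..
    show "surj (fd F z)"
    proof (rule surjI)
      fix b
      show "fd F z (to_chart A \<kappa> q (inv (tangent_map A B \<pi> q) (from_chart B l (\<pi> q) b))) = b"
        unfolding dF A.from_to[OF \<kappa>(1) q(2)] surj_f_inv_f[OF surj] B.to_from[OF l(1) q(3)] ..
    qed
  qed
  have g_y: "bil_in A \<kappa> g y v w = g p v w" for v w
    unfolding y_def \<kappa>_def by (rule A.bil_in_chart_at)
  have G_y: "bil_in B l G (F y) v w = G (\<pi> p) v w" for v w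
    unfolding Fy l_def by (rule B.bil_in_chart_at)
  have \<phi>_y: "endo_in A \<kappa> \<phi> y v = \<phi> p v" for v
    unfolding endo_in_def y_def A.chart_inv_chart[OF \<kappa>] unfolding \<kappa>_def A.from_chart_at A.to_chart_at ..
  have \<xi>_y: "vec_in A \<kappa> (\<xi> \<alpha>) y = \<xi> \<alpha> p" for \<alpha>
    unfolding vec_in_def y_def A.chart_inv_chart[OF \<kappa>] unfolding \<kappa>_def A.to_chart_at ..
  have R_y: "curv y z w v = riem A g p z w v" for z w v
    unfolding y_def \<kappa>_def
    by (rule A.riem_curv[symmetric, OF metric_chart_axioms[unfolded \<kappa>_def] y[unfolded y_def \<kappa>_def]])
  have RN_y: "N.curv (F y) z w v = riem B G (\<pi> p) z w v" for z w v
    unfolding Fy l_def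
    by (rule B.riem_curv[symmetric, OF N.metric_chart_axioms[unfolded l_def] F_in[OF y, unfolded Fy l_def]])
  have dF_y: "fd F y = tangent_map A B \<pi> p"
    unfolding F_def y_def \<kappa>_def l_def tangent_map_def ..
  interpret P: frame_point "g p" "\<phi> p" "\<lambda>\<alpha>. \<xi> \<alpha> p" \<epsilon> by (rule frame_q)
  have hor_y: "hor y x \<longleftrightarrow> P.hor x" for x
    unfolding hor_def P.hor_def g_y \<xi>_y ..
  have \<epsilon>1: "\<epsilon> \<alpha>\<^sub>1 = - 1" using timelike \<epsilon>[of \<alpha>\<^sub>1] P.g_\<xi>_\<xi>[of \<alpha>\<^sub>1 \<alpha>\<^sub>1] by auto
  \<comment> \<open>Orthogonality to the timelike vector is automatic in the range of
    \<phi>.\<close>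
  have sphere: "x \<in> phi_sphere g \<phi> p (\<xi> \<alpha>\<^sub>1 p) \<longleftrightarrow> P.hor x \<and> g p x x = 1" for x
  proof -
    have "P.hor x \<longleftrightarrow> x \<in> range (\<phi> p)"
    proof
      assume "P.hor x"
      then have "x = \<phi> p (- \<phi> p x)" using P.\<phi>_\<phi>_hor by (simp add: P.\<phi>_linear)
      then show "x \<in> range (\<phi> p)" by blast
    qed (auto simp: P.hor_\<phi>)
    then show ?thesis
      by (auto simp: phi_sphere_def celestial_sphere_def orth_def P.hor_def)
  qed
  \<comment> \<open>\<phi> is nonvanishing, so its rank is positive. The base then has dimension at
    least two, as the connectedness of the sphere requires.\<close>
  have n: "n \<ge> 1"
  proof (rule ccontr)
    assume "\<not> n \<ge> 1"
    then have "dim (range (\<phi> p)) = 0" "\<exists>v. \<phi> p v \<noteq> 0"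
      using gff unfolding gff_manifold_def by auto
    then show False by (simp add: dim_eq_0 image_subset_iff)
  qed
  interpret Q: jacobi_point "g p" "\<phi> p" "\<lambda>\<alpha>. \<xi> \<alpha> p" \<epsilon> "G (\<pi> p)" \<alpha>\<^sub>1 "riem A g p" "riem B G (\<pi> p)"
    "tangent_map A B \<pi> p"
  proof (intro jacobi_point.intro jacobi_point_axioms.intro)
    show "frame_point (g p) (\<phi> p) (\<lambda>\<alpha>. \<xi> \<alpha> p) \<epsilon>" by (rule frame_q)
    show "sym_form (G (\<pi> p))"
      using GR unfolding semi_riemannian_metric_def by (intro sym_form.intro) auto
    show "linear (\<lambda>v. riem A g p z w v)" "linear (\<lambda>v. riem A g p z v w)" "linear (\<lambda>v. riem A g p v z w)" for z w
      using linear_curv[OF y, of z w] linear_curv(2)[OF y, of z w] linear_curv(3)[OF y, of z w] unfolding R_y by auto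
    show "riem A g p a b c = - riem A g p b a c" for a b c
      using curv_skew[of y a b c] unfolding R_y .
    show "g p (riem A g p a b c) d = - g p (riem A g p a b d) c" for a b c d
      using g_curv_skew[OF y, of a b c d] unfolding R_y g_y .
    show "g p (riem A g p a b c) d = g p (riem A g p c d a) b" for a b c d
      using curv_pair_sym[OF y, of a b c d] unfolding R_y g_y .
    show "riem A g p x z (\<xi> \<alpha> p) = 0" if "P.hor x" "P.hor z" for x z \<alpha>
      using curv_hor_hor_\<xi>[OF y, of x z \<alpha>] that unfolding R_y hor_y \<xi>_y by blast
    show "riem A g p x (\<xi> \<beta> p) (\<xi> \<alpha> p) = (\<epsilon> \<alpha> * \<epsilon> \<beta>) *\<^sub>R x" if "P.hor x" for x \<alpha> \<beta>
      using curv_hor_\<xi>_\<xi>[OF y, of x \<beta> \<alpha>] that unfolding R_y hor_y \<xi>_y by blast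
    show "riem A g p (\<xi> \<gamma> p) (\<xi> \<beta> p) (\<xi> \<alpha> p) = 0" for \<alpha> \<beta> \<gamma>
      using curv_\<xi>_\<xi>_\<xi>[OF y, of \<gamma> \<beta> \<alpha>] unfolding R_y \<xi>_y .
    show "\<epsilon> \<alpha>\<^sub>1 = - 1" by (rule \<epsilon>1)
    show "linear (tangent_map A B \<pi> p)" by (rule linear_tm)
    show "surj (tangent_map A B \<pi> p)" by (rule surj)
    show "G (\<pi> p) (tangent_map A B \<pi> p v) (tangent_map A B \<pi> p w) = g p (\<phi> p v) (\<phi> p w)" for v w
      by (rule isometry)
    show "0 < G (\<pi> p) z z" if "z \<noteq> 0" for z by (rule riemannian_pos_def[OF GR that])
    show "riem B G (\<pi> p) (tangent_map A B \<pi> p z) (tangent_map A B \<pi> p x) (tangent_map A B \<pi> p x)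
      = tangent_map A B \<pi> p (riem A g p z x x + (3 * (\<Sum>\<alpha>\<in>UNIV. \<epsilon> \<alpha>) * g p z (\<phi> p x)) *\<^sub>R \<phi> p x)"
      if "P.hor x" "P.hor z" for x z
      using jacobi_pushforward[OF y, of x z] that unfolding RN_y R_y dF_y hor_y g_y \<phi>_y by blast
    show "\<exists>\<mu>. riem A g p (\<phi> p x) x x = \<mu> *\<^sub>R \<phi> p x" if "P.hor x" "g p x x = 1" for x
      using eig sphere that unfolding jacobi_eigenvector_def jacobi_def by blast
    show "2 \<le> DIM('h)" using n assms(6) by simp
  qed
  have u: "u \<in> phi_null_congruence g \<phi> p (\<xi> \<alpha>\<^sub>1 p) \<longleftrightarrow> (\<exists>x\<in>Q.unit_hor. u = \<xi> \<alpha>\<^sub>1 p + x)" for u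
  proof
    assume "u \<in> phi_null_congruence g \<phi> p (\<xi> \<alpha>\<^sub>1 p)"
    then have "u - \<xi> \<alpha>\<^sub>1 p \<in> Q.unit_hor"
      unfolding phi_null_congruence_def sphere Q.unit_hor_def by simp
    then show "\<exists>x\<in>Q.unit_hor. u = \<xi> \<alpha>\<^sub>1 p + x" by (intro bexI[of _ "u - \<xi> \<alpha>\<^sub>1 p"]) auto
  next
    assume "\<exists>x\<in>Q.unit_hor. u = \<xi> \<alpha>\<^sub>1 p + x"
    then obtain x where x: "P.hor x" "g p x x = 1" "u = \<xi> \<alpha>\<^sub>1 p + x" by (auto simp: Q.unit_hor_def)
    then show "u \<in> phi_null_congruence g \<phi> p (\<xi> \<alpha>\<^sub>1 p)"
      using P.g_sym[of "\<xi> \<alpha>\<^sub>1 p" x]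
      by (simp add: phi_null_congruence_def null_congruence_def sphere P.g_linear P.g_\<xi>_\<xi> \<epsilon>1 P.hor_def)
  qed
  have mult: "null_jacobi_mult A g p (\<xi> \<alpha>\<^sub>1 p + x) \<mu> = dim {y. g p y (\<xi> \<alpha>\<^sub>1 p + x) = 0 \<and>
      riem A g p y (\<xi> \<alpha>\<^sub>1 p + x) (\<xi> \<alpha>\<^sub>1 p + x) - \<mu> *\<^sub>R y \<in> span {\<xi> \<alpha>\<^sub>1 p + x}} - 1"
    if x: "x \<in> Q.unit_hor" for x \<mu>
  proof (rule null_jacobi_mult_eq[OF P.bilinear_g Q.linear_R(3) Q.R_self])
    have "\<xi> \<alpha>\<^sub>1 p + x \<in> phi_null_congruence g \<phi> p (\<xi> \<alpha>\<^sub>1 p)" using u x by blast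
    then have null: "g p (\<xi> \<alpha>\<^sub>1 p + x) (\<xi> \<alpha>\<^sub>1 p + x) = 0" "g p (\<xi> \<alpha>\<^sub>1 p + x) (\<xi> \<alpha>\<^sub>1 p) = - 1"
      by (auto simp: phi_null_congruence_def null_congruence_def)
    then show "g p (\<xi> \<alpha>\<^sub>1 p + x) (\<xi> \<alpha>\<^sub>1 p + x) = 0" by simp
    show "\<xi> \<alpha>\<^sub>1 p + x \<noteq> 0"
    proof
      assume "\<xi> \<alpha>\<^sub>1 p + x = 0"
      then show False using null(2) by (simp add: P.g_linear)
    qed
  qed
  have "phi_null_osserman A g \<phi> p (\<xi> \<alpha>\<^sub>1 p) \<longleftrightarrow> (\<forall>x\<in>Q.unit_hor. \<forall>x'\<in>Q.unit_hor. \<forall>\<mu>.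
      null_jacobi_mult A g p (\<xi> \<alpha>\<^sub>1 p + x) \<mu> = null_jacobi_mult A g p (\<xi> \<alpha>\<^sub>1 p + x') \<mu>)"
  proof -
    have "phi_null_congruence g \<phi> p (\<xi> \<alpha>\<^sub>1 p) = (\<lambda>x. \<xi> \<alpha>\<^sub>1 p + x) ` Q.unit_hor" using u by blast
    then show ?thesis unfolding phi_null_osserman_def by simp
  qed
  also have "\<dots> \<longleftrightarrow> (\<forall>z z'. G (\<pi> p) z z = 1 \<longrightarrow> G (\<pi> p) z' z' = 1 \<longrightarrow>
      (\<forall>\<mu>. dim {y. G (\<pi> p) y z = 0 \<and> riem B G (\<pi> p) y z z = \<mu> *\<^sub>R y}
        = dim {y. G (\<pi> p) y z' = 0 \<and> riem B G (\<pi> p) y z' z' = \<mu> *\<^sub>R y}))"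
    unfolding Q.null_osserman_iff_base_osserman[symmetric] by (simp add: mult)
  also have "\<dots> \<longleftrightarrow> osserman_at B G (\<pi> p)"
    unfolding osserman_at_def jacobi_mult_def orth_def jacobi_def by simp
  finally show ?thesis .
qed

end
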